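(* Let $d\in\mathbf{Z}\setminus\{0\}$ and $g>0$. For any admissible solution $(f_*,m_* )$ of $(GL)_{\infty,g}$ with $m_*>0$ there exists a constant $\sigma_*>0$ such that $$\mathcal{E}_{\infty,g}''(f_*,m_* )[u,w]\ge\sigma_*\big(\|u\|_X^2+\|w\|_H^2\big)$$ for all $u\in X$, $w\in H$.
   Context: All functions are real-valued functions of $r$, and $\int u\,r\,dr=\int_0^\infty u(r)\,r\,dr$. $H$ is the space of radial functions in $H^1(\mathbf{R}^2)$, with $\|u\|_H^2=\int[(u')^2+u^2]\,r\,dr$; $X=\{u\in H:\int\frac{u^2}{r^2}\,r\,dr<\infty\}$ with $\|u\|_X^2=\int[(u')^2+u^2+\frac{u^2}{r^2}]\,r\,dr$. $(GL)_{\infty,g}$ is the system $-f''-\frac1r f'+\frac{d^2}{r^2}f=(1-f^2-m^2)f$, $\;-m''-\frac1r m'+gm=(1-f^2-m^2)m$, with energy $$\mathcal{E}_{\infty,g}(f,m)=\frac12\int\Big\{(f')^2+(m')^2+gm^2+\tfrac{d^2}{r^2}[f^2-\tilde f_\infty^2]+\tfrac12(1-f^2-m^2)^2\Big\}r\,dr,$$ where $\tilde f_\infty$ is the unique positive solution of $-f''-\frac1rf'+\frac{d^2}{r^2}f=(1-f^2)f$ with $f(0)=0$, $f(r)\to1$ as $r\to\infty$. $(f_*,m_* )$ is an admissible solution if: the system holds for all $r\in(0,\infty)$; $\mathcal{E}_{\infty,g}(f_*,m_* )<\infty$; $f_*\ge0$ and $m_*\ge0$ for all $r\ge0$; $m_*'(0)=0$.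 The second variation is $\mathcal{E}_{\infty,g}''(f_*,m_* )[u,w]=\frac{d^2}{dt^2}\big|_{t=0}\mathcal{E}_{\infty,g}(f_*+tu,m_*+tw)$, i.e. $$\int\Big\{(u')^2+(w')^2+\tfrac{d^2}{r^2}u^2+gw^2-(1-f_*^2-m_*^2)(u^2+w^2)+2(f_*u+m_*w)^2\Big\}r\,dr.$$ *)

theory Defs
  imports "HOL-Analysis.Analysis"
begin

section \<open>Weak derivatives and the Sobolev space \<open>H\<^sup>1\<close>\<close>

text \<open>
  Test functions are of class \<open>C\<^sup>1\<close> with compact support in \<open>\<Omega>\<close>; for locally
  integrable functions they give the same weak first derivatives as \<open>C\<^sup>\<infinity>\<close> ones.
\<close>

definition test_function :: "'a::euclidean_space set \<Rightarrow> ('a \<Rightarrow> real) \<Rightarrow> bool" where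
  "test_function \<Omega> \<phi> \<longleftrightarrow>
     (\<forall>x. \<phi> differentiable (at x)) \<and>
     (\<forall>i\<in>Basis. continuous_on UNIV (\<lambda>x. frechet_derivative \<phi> (at x) i)) \<and>
     compact (closure {x. \<phi> x \<noteq> 0}) \<and> closure {x. \<phi> x \<noteq> 0} \<subseteq> \<Omega>"

definition locally_integrable_on :: "('a::euclidean_space \<Rightarrow> real) \<Rightarrow> 'a set \<Rightarrow> bool" where
  "locally_integrable_on U \<Omega> \<longleftrightarrow>
     (\<forall>K. compact K \<longrightarrow> K \<subseteq> \<Omega> \<longrightarrow> U absolutely_integrable_on K)"

definition weak_partial_derivative ::
    "'a::euclidean_space set \<Rightarrow> 'a \<Rightarrow> ('a \<Rightarrow> real) \<Rightarrow> ('a \<Rightarrow> real) \<Rightarrow> bool" where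
  "weak_partial_derivative \<Omega> i U G \<longleftrightarrow>
     locally_integrable_on U \<Omega> \<and> locally_integrable_on G \<Omega> \<and>
     (\<forall>\<phi>. test_function \<Omega> \<phi> \<longrightarrow>
        (LINT x:\<Omega>|lebesgue. U x * frechet_derivative \<phi> (at x) i) =
        - (LINT x:\<Omega>|lebesgue. G x * \<phi> x))"

definition L2 :: "('a::euclidean_space \<Rightarrow> real) set" where
  "L2 = {U. U \<in> borel_measurable lebesgue \<and> integrable lebesgue (\<lambda>x. (U x)\<^sup>2)}"

definition H1 :: "('a::euclidean_space \<Rightarrow> real) set" where
  "H1 = {U \<in> L2. \<forall>i\<in>Basis. \<exists>G\<in>L2. weak_partial_derivative UNIV i U G}"

section \<open>Radial function spaces\<close>

text \<open>
  A radial function on the plane is represented by its profile \<open>u\<close>, a function of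
  \<open>r = norm x\<close>. The values of profiles at negative arguments are irrelevant.
\<close>

definition H_space :: "(real \<Rightarrow> real) set" where
  "H_space = {u. (\<lambda>x::real^2. u (norm x)) \<in> H1}"

definition X_space :: "(real \<Rightarrow> real) set" where
  "X_space = {u \<in> H_space. (\<lambda>r. (u r)\<^sup>2 / r\<^sup>2 * r) absolutely_integrable_on {0<..}}"

text \<open>
  The derivative \<open>u'\<close> of a profile is its weak derivative on \<open>(0,\<infinity>)\<close>, which is
  unique up to a null set.
\<close>

definition weak_deriv :: "(real \<Rightarrow> real) \<Rightarrow> real \<Rightarrow> real" where
  "weak_deriv u = (SOME v. weak_partial_derivative {0<..} 1 u v)"

definition radial_integral :: "(real \<Rightarrow> real) \<Rightarrow> real" where
  "radial_integral F = (LINT r:{0<..}|lebesgue. F r * r)"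

definition H_norm_sq :: "(real \<Rightarrow> real) \<Rightarrow> real" where
  "H_norm_sq u = radial_integral (\<lambda>r. (weak_deriv u r)\<^sup>2 + (u r)\<^sup>2)"

definition X_norm_sq :: "(real \<Rightarrow> real) \<Rightarrow> real" where
  "X_norm_sq u = radial_integral (\<lambda>r. (weak_deriv u r)\<^sup>2 + (u r)\<^sup>2 + (u r)\<^sup>2 / r\<^sup>2)"

section \<open>The Ginzburg--Landau system\<close>

definition twice_differentiable_on_halfline :: "(real \<Rightarrow> real) \<Rightarrow> bool" where
  "twice_differentiable_on_halfline f \<longleftrightarrow>
     (\<forall>r>0. f differentiable (at r) \<and> deriv f differentiable (at r))"

definition GL_system :: "int \<Rightarrow> real \<Rightarrow> (real \<Rightarrow> real) \<Rightarrow> (real \<Rightarrow> real) \<Rightarrow> bool" where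
  "GL_system d g f m \<longleftrightarrow>
     twice_differentiable_on_halfline f \<and> twice_differentiable_on_halfline m \<and>
     (\<forall>r>0. - deriv (deriv f) r - 1 / r * deriv f r + (of_int d)\<^sup>2 / r\<^sup>2 * f r
              = (1 - (f r)\<^sup>2 - (m r)\<^sup>2) * f r) \<and>
     (\<forall>r>0. - deriv (deriv m) r - 1 / r * deriv m r + g * m r
              = (1 - (f r)\<^sup>2 - (m r)\<^sup>2) * m r)"

text \<open>
  The scalar vortex profile entering the renormalised energy. The boundary value at
  \<open>0\<close> is attained continuously.
\<close>

definition vortex_profile :: "int \<Rightarrow> (real \<Rightarrow> real) \<Rightarrow> bool" where
  "vortex_profile d ft \<longleftrightarrow>
     twice_differentiable_on_halfline ft \<and>
     (\<forall>r>0. - deriv (deriv ft) r - 1 / r * deriv ft r + (of_int d)\<^sup>2 / r\<^sup>2 * ft r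
              = (1 - (ft r)\<^sup>2) * ft r) \<and>
     (\<forall>r>0. ft r > 0) \<and>
     continuous_on {0..} ft \<and> ft 0 = 0 \<and> (ft \<longlongrightarrow> 1) at_top"

definition energy_density ::
    "int \<Rightarrow> real \<Rightarrow> (real \<Rightarrow> real) \<Rightarrow> (real \<Rightarrow> real) \<Rightarrow> (real \<Rightarrow> real) \<Rightarrow> real \<Rightarrow> real" where
  "energy_density d g ft f m r =
     1 / 2 * ((deriv f r)\<^sup>2 + (deriv m r)\<^sup>2 + g * (m r)\<^sup>2
              + (of_int d)\<^sup>2 / r\<^sup>2 * ((f r)\<^sup>2 - (ft r)\<^sup>2)
              + 1 / 2 * (1 - (f r)\<^sup>2 - (m r)\<^sup>2)\<^sup>2)"

text \<open>
  The energy density is not of one sign, so finiteness of the energy is expressed as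
  Lebesgue integrability of the density against \<open>r dr\<close>.
\<close>

definition finite_energy ::
    "int \<Rightarrow> real \<Rightarrow> (real \<Rightarrow> real) \<Rightarrow> (real \<Rightarrow> real) \<Rightarrow> (real \<Rightarrow> real) \<Rightarrow> bool" where
  "finite_energy d g ft f m \<longleftrightarrow>
     (\<lambda>r. energy_density d g ft f m r * r) absolutely_integrable_on {0<..}"

definition admissible_solution ::
    "int \<Rightarrow> real \<Rightarrow> (real \<Rightarrow> real) \<Rightarrow> (real \<Rightarrow> real) \<Rightarrow> (real \<Rightarrow> real) \<Rightarrow> bool" where
  "admissible_solution d g ft f m \<longleftrightarrow>
     GL_system d g f m \<and>
     finite_energy d g ft f m \<and>
     (\<forall>r\<ge>0. f r \<ge> 0 \<and> m r \<ge> 0) \<and>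
     (m has_real_derivative 0) (at 0 within {0..})"

text \<open>
  The quadratic form \<open>d\<^sup>2/dt\<^sup>2\<close> at \<open>t = 0\<close> of the energy of \<open>(f + t u, m + t w)\<close>; the
  reference term with \<open>ft\<close> does not depend on \<open>t\<close> and drops out.
\<close>

definition second_variation ::
    "int \<Rightarrow> real \<Rightarrow> (real \<Rightarrow> real) \<Rightarrow> (real \<Rightarrow> real) \<Rightarrow> (real \<Rightarrow> real) \<Rightarrow> (real \<Rightarrow> real) \<Rightarrow> real" where
  "second_variation d g f m u w = radial_integral (\<lambda>r.
     (weak_deriv u r)\<^sup>2 + (weak_deriv w r)\<^sup>2
     + (of_int d)\<^sup>2 / r\<^sup>2 * (u r)\<^sup>2 + g * (w r)\<^sup>2
     - (1 - (f r)\<^sup>2 - (m r)\<^sup>2) * ((u r)\<^sup>2 + (w r)\<^sup>2)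
     + 2 * (f r * u r + m r * w r)\<^sup>2)"

end

theory Submission
  imports Defs
begin

text \<open>
  Writing \<open>u = f \<phi>\<close> and \<open>w = m \<psi>\<close>, Picone's identity (\<open>f\<close> and \<open>m\<close> being positive solutions of the linear equations
  obtained by freezing \<open>1 - f\<^sup>2 - m\<^sup>2\<close>) shows that the second variation dominates the integrals of
  \<open>f\<^sup>2 \<phi>'\<^sup>2\<close>, \<open>m\<^sup>2 \<psi>'\<^sup>2\<close> and \<open>2 (f u + m w)\<^sup>2\<close> against \<open>r dr\<close>. The first two make \<open>\<phi>\<close> and \<open>\<psi>\<close> nearly
  constant on bounded intervals; the third makes \<open>f\<^sup>2 \<phi> + m\<^sup>2 \<psi>\<close> small, and since \<open>m\<^sup>2 / f\<^sup>2\<close> is not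
  constant (\<open>f\<close> tends to 1 and \<open>m\<close> to 0) both constants are small. Hence the form controls \<open>u\<close> and \<open>w\<close> in
  \<open>L\<^sup>2\<close> on bounded discs. For large \<open>r\<close> its density is pointwise coercive, so the local bound upgrades to the full
  norm, with an explicit argument in place of compactness.
\<close>

section \<open>Primitives of integrable functions\<close>

text \<open>Two obstacles shape the proof. Membership in \<open>H_space\<close> concerns weak
  gradients in the plane, while the norms use \<open>weak_deriv\<close>, a choice of weak derivative
  on the half-line. The planar gradient is not known to be radial; the half-line derivative is built
  as the circle average of its radial component, and uniqueness almost everywhere hands its square
  integrability to the chosen one. Picone's identity on \<open>{a..b}\<close> leaves boundary terms
  \<open>r * q r * (u r)\<^sup>2\<close>, with \<open>q\<close> the logarithmic derivative of
  \<open>f\<close> or \<open>m\<close>. No limits are available, but signs help: it suffices to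
  bound the term from above along radii tending to 0 and from below along radii tending to infinity.
  The matching one-sided bounds on \<open>q\<close> come from finite energy, positivity and
  comparison arguments for the equations. No value of \<open>f\<close> at 0 is assumed. Near 0 the
  quotients \<open>u / f\<close> and \<open>w / m\<close> may oscillate by the square root of a
  logarithm, so local control is proved for \<open>r * ((u r)\<^sup>2 + (w r)\<^sup>2)\<close>,
  where the weight absorbs the logarithm. This is what the measure \<open>r dr\<close>
  needs.\<close>

lemma fubini_by_parts:
  fixes f h :: "real \<Rightarrow> real"
  assumes f: "integrable lborel f" and h: "integrable lborel h"
  shows "integrable lborel (\<lambda>x. f x * (LINT y|lborel. indicator {..x} y * h y))"
    and "integrable lborel (\<lambda>y. h y * (LINT x|lborel. indicator {..y} x * f x))"
    and "(LINT x|lborel. f x * (LINT y|lborel. indicator {..x} y * h y)) +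
         (LINT y|lborel. h y * (LINT x|lborel. indicator {..y} x * f x)) = integral\<^sup>L lborel f * integral\<^sup>L lborel h"
proof -
  note [measurable] = borel_measurable_integrable[OF f] borel_measurable_integrable[OF h]
  have prod: "integrable (lborel \<Otimes>\<^sub>M lborel) (\<lambda>(x,y). f x * h y)"
    by (rule lborel_pair.Fubini_integrable) (auto simp: abs_mult f h intro!: integrable_mult_left)
  have P1: "integrable (lborel \<Otimes>\<^sub>M lborel) (\<lambda>(x,y). f x * (indicator {..x} y * h y))"
    by (rule Bochner_Integration.integrable_bound[OF prod])
       (auto simp: indicator_def split: if_splits)
  have P2: "integrable (lborel \<Otimes>\<^sub>M lborel) (\<lambda>(y,x). h y * (indicator {..y} x * f x))"
    by (rule Bochner_Integration.integrable_bound[OF lborel_pair.integrable_product_swap[OF prod]])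
       (auto simp: indicator_def mult.commute split: if_splits)
  \<comment> \<open>The half-plane y >= x belongs to the second iterated integral with the order of
    integration exchanged, so that both terms become integrals in x.\<close>
  have P2': "integrable (lborel \<Otimes>\<^sub>M lborel) (\<lambda>(x,y). f x * (indicator {x..} y * h y))"
    by (rule Bochner_Integration.integrable_bound[OF prod])
       (auto simp: indicator_def split: if_splits)
  show I1: "integrable lborel (\<lambda>x. f x * (LINT y|lborel. indicator {..x} y * h y))"
    using lborel_pair.integrable_fst'[OF P1] by simp
  show I2: "integrable lborel (\<lambda>y. h y * (LINT x|lborel. indicator {..y} x * f x))"
    using lborel_pair.integrable_fst'[OF P2] by simp
  have eq: "(LINT y|lborel. h y * (LINT x|lborel. indicator {..y} x * f x)) =
     (LINT y|lborel. LINT x|lborel. f x * (indicator {x..} y * h y))"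
  proof (intro Bochner_Integration.integral_cong refl)
    fix y
    show "h y * (LINT x|lborel. indicator {..y} x * f x) = (LINT x|lborel. f x * (indicator {x..} y * h y))"
      by (subst integral_mult_right_zero[symmetric], rule Bochner_Integration.integral_cong[OF refl])
         (simp add: indicator_def)
  qed
  also have "\<dots> = (LINT x|lborel. LINT y|lborel. f x * (indicator {x..} y * h y))"
    using lborel_pair.Fubini_integral[OF P2'] by simp
  finally have eq2: "(LINT y|lborel. h y * (LINT x|lborel. indicator {..y} x * f x)) =
      (LINT x|lborel. f x * (LINT y|lborel. indicator {x..} y * h y))" by simp
  have I3: "integrable lborel (\<lambda>x. f x * (LINT y|lborel. indicator {x..} y * h y))"
    using lborel_pair.integrable_fst'[OF P2'] by simp
  have inth: "integrable lborel (\<lambda>y. indicator A y * h y)" if "A \<in> sets borel" for A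
    using integrable_mult_indicator[OF _ h, of A] that by simp
  have "(LINT y|lborel. indicator {..x} y * h y) + (LINT y|lborel. indicator {x..} y * h y) = integral\<^sup>L lborel h" for x
  proof -
    have "(LINT y|lborel. indicator {..x} y * h y) + (LINT y|lborel. indicator {x..} y * h y)
      = (LINT y|lborel. indicator {..x} y * h y + indicator {x..} y * h y)"
      by (intro Bochner_Integration.integral_add[symmetric] inth) auto
    \<comment> \<open>The two closed half-lines share only the point \<open>x\<close>, a null
      set.\<close>
    also have "\<dots> = integral\<^sup>L lborel h"
      by (intro integral_cong_AE) (use AE_lborel_singleton[of x] in \<open>auto simp: indicator_def elim!: eventually_mono\<close>)
    finally show ?thesis .
  qed
  then have "f x * (LINT y|lborel. indicator {..x} y * h y) + f x * (LINT y|lborel. indicator {x..} y * h y) = f x * integral\<^sup>L lborel h" for x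
    by (simp flip: distrib_left)
  then show "(LINT x|lborel. f x * (LINT y|lborel. indicator {..x} y * h y)) +
         (LINT y|lborel. h y * (LINT x|lborel. indicator {..y} x * f x)) = integral\<^sup>L lborel f * integral\<^sup>L lborel h"
    unfolding eq2 by (subst Bochner_Integration.integral_add[OF I1 I3, symmetric]) simp
qed

text \<open>Product-measure arguments run over \<open>lborel\<close>, whereas absolute integrability
  gives only Lebesgue measurability. The Borel version also builds in the cutoff to
  \<open>S\<close>, so later integrals can be taken over the whole line.\<close>

lemma lebesgue_borel_version:
  fixes \<alpha> :: "real \<Rightarrow> real"
  assumes "\<alpha> absolutely_integrable_on S"
  obtains f where "integrable lborel f" "AE x in lebesgue. f x = indicator S x * \<alpha> x"
proof -
  have i: "integrable lebesgue (\<lambda>x. indicator S x * \<alpha> x)"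
    using assms by (simp add: set_integrable_def)
  obtain f where f: "f \<in> borel_measurable lborel" "AE x in lborel. indicator S x * \<alpha> x = f x"
    using completion_ex_borel_measurable_real[OF borel_measurable_integrable[OF i]] by auto
  have ae: "AE x in lebesgue. f x = indicator S x * \<alpha> x"
    using f(2) by (auto dest!: AE_completion elim!: eventually_mono)
  have "integrable lebesgue f"
    using ae i f(1) by (subst integrable_cong_AE[where g="\<lambda>x. indicator S x * \<alpha> x"]) (auto intro!: measurable_completion)
  then have "integrable lborel f"
    using f(1) by (simp add: integrable_completion)
  with ae show ?thesis using that by blast
qed

lemma indicator_integral_Icc:
  fixes \<alpha> :: "real \<Rightarrow> real"
  assumes \<alpha>: "\<alpha> absolutely_integrable_on {a..b}" and "integrable lborel f"
   and ae: "AE x in lebesgue. f x = indicator {a..b} x * \<alpha> x" and x: "x \<in> {a..b}"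
  shows "(LINT y|lborel. indicator {..x} y * f y) = integral {a..x} \<alpha>"
proof -
  have m[measurable]: "f \<in> borel_measurable borel" using assms(2) by auto
  have ai: "\<alpha> absolutely_integrable_on {a..x}"
    using absolutely_integrable_on_subinterval[OF \<alpha>] x by auto
  have "(LINT y|lborel. indicator {..x} y * f y) = (LINT y|lebesgue. indicator {..x} y * f y)"
    by (subst integral_completion) auto
  also have "\<dots> = (LINT y|lebesgue. indicator {a..x} y *\<^sub>R \<alpha> y)"
  proof (rule integral_cong_AE)
    show "(\<lambda>y. indicator {..x} y * f y) \<in> borel_measurable lebesgue"
      by (rule measurable_completion) measurable
    show "(\<lambda>y. indicat_real {a..x} y *\<^sub>R \<alpha> y) \<in> borel_measurable lebesgue"
      using ai unfolding set_integrable_def by auto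
    show "AE y in lebesgue. indicator {..x} y * f y = indicat_real {a..x} y *\<^sub>R \<alpha> y"
      using ae x by (auto elim!: eventually_mono simp: indicator_def)
  qed
  also have "\<dots> = integral {a..x} \<alpha>"
    using set_lebesgue_integral_eq_integral(2)[OF ai] by (simp add: set_lebesgue_integral_def)
  finally show ?thesis .
qed

text \<open>Obtained from Fubini on the two triangles of the square rather than by differentiating:
  an indefinite integral of a merely integrable function need not be differentiable
  everywhere.\<close>

lemma integral_by_parts_indefinite:
  fixes \<alpha> \<beta> :: "real \<Rightarrow> real"
  assumes ab: "a \<le> b" and \<alpha>: "\<alpha> absolutely_integrable_on {a..b}" and \<beta>: "\<beta> absolutely_integrable_on {a..b}"
  defines "A \<equiv> \<lambda>x. integral {a..x} \<alpha>" and "B \<equiv> \<lambda>x. integral {a..x} \<beta>"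
  shows "(\<lambda>x. \<alpha> x * B x) absolutely_integrable_on {a..b}" and "(\<lambda>x. A x * \<beta> x) absolutely_integrable_on {a..b}"
    and "integral {a..b} (\<lambda>x. \<alpha> x * B x) + integral {a..b} (\<lambda>x. A x * \<beta> x) = A b * B b"
proof -
  obtain f where f: "integrable lborel f" "AE x in lebesgue. f x = indicator {a..b} x * \<alpha> x"
    using lebesgue_borel_version[OF \<alpha>] .
  obtain h where h: "integrable lborel h" "AE x in lebesgue. h x = indicator {a..b} x * \<beta> x"
    using lebesgue_borel_version[OF \<beta>] .
  note F = fubini_by_parts[OF f(1) h(1)]
  \<comment> \<open>Kept generic because it is applied twice, with the roles of
    \<open>\<alpha>\<close> and \<open>\<beta>\<close> exchanged.\<close>
  have *: "set_integrable lebesgue {a..b} (\<lambda>x. \<alpha>' x * integral {a..x} \<beta>') \<and>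
     integral {a..b} (\<lambda>x. \<alpha>' x * integral {a..x} \<beta>') = (LINT x|lborel. f' x * (LINT y|lborel. indicator {..x} y * h' y))"
    if f': "integrable lborel (\<lambda>x. f' x * (LINT y|lborel. indicator {..x} y * h' y))" "AE x in lebesgue. f' x = indicator {a..b} x * \<alpha>' x" "\<alpha>' absolutely_integrable_on {a..b}"
     and h': "integrable lborel h'" "AE x in lebesgue. h' x = indicator {a..b} x * \<beta>' x" "\<beta>' absolutely_integrable_on {a..b}"
    for f' h' \<alpha>' \<beta>' :: "real \<Rightarrow> real"
  proof -
    let ?L = "\<lambda>x. indicator {a..b} x * (\<alpha>' x * integral {a..x} \<beta>')"
    let ?R = "\<lambda>x. f' x * (LINT y|lborel. indicator {..x} y * h' y)"
    have ae: "AE x in lebesgue. ?R x = ?L x"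
      using f'(2)
    proof eventually_elim
      case (elim x)
      show ?case
      proof (cases "x \<in> {a..b}")
        case True
        then show ?thesis using indicator_integral_Icc[OF h'(3,1,2) True] elim by simp
      qed (use elim in simp)
    qed
    have R: "integrable lebesgue ?R" using f'(1) by (subst integrable_completion) auto
    have mL: "?L \<in> borel_measurable lebesgue"
    proof -
      have "(\<lambda>x. indicator {a..b} x *\<^sub>R \<alpha>' x) \<in> borel_measurable lebesgue" using f'(3) unfolding set_integrable_def by auto
      moreover have "(\<lambda>x. integral {a..x} \<beta>') absolutely_integrable_on {a..b}"
        using indefinite_integral_continuous_1[of \<beta>' a b] h'(3)
        by (intro absolutely_integrable_continuous_real) (auto simp: set_lebesgue_integral_eq_integral(1))
      then have "(\<lambda>x. indicator {a..b} x *\<^sub>R integral {a..x} \<beta>') \<in> borel_measurable lebesgue" unfolding set_integrable_def by auto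
      ultimately have "(\<lambda>x. (indicator {a..b} x *\<^sub>R \<alpha>' x) * (indicator {a..b} x *\<^sub>R integral {a..x} \<beta>')) \<in> borel_measurable lebesgue"
        by measurable
      also have "(\<lambda>x. (indicator {a..b} x *\<^sub>R \<alpha>' x) * (indicator {a..b} x *\<^sub>R integral {a..x} \<beta>')) = ?L"
        by (auto simp: indicator_def)
      finally show ?thesis .
    qed
    have L: "integrable lebesgue ?L"
      using R ae mL by (subst integrable_cong_AE[where g="?R"]) (auto elim!: eventually_mono)
    then have s: "set_integrable lebesgue {a..b} (\<lambda>x. \<alpha>' x * integral {a..x} \<beta>')"
      by (simp add: set_integrable_def)
    have "integral {a..b} (\<lambda>x. \<alpha>' x * integral {a..x} \<beta>') = integral\<^sup>L lebesgue ?L"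
      using set_lebesgue_integral_eq_integral(2)[OF s] by (simp add: set_lebesgue_integral_def)
    also have "\<dots> = integral\<^sup>L lebesgue ?R"
      using ae mL R by (intro integral_cong_AE) (auto elim!: eventually_mono)
    also have "\<dots> = integral\<^sup>L lborel ?R" using f'(1) by (subst integral_completion) auto
    finally show ?thesis using s by auto
  qed
  note X = *[OF F(1) f(2) \<alpha> h \<beta>] and Y = *[OF F(2) h(2) \<beta> f \<alpha>]
  show "(\<lambda>x. \<alpha> x * B x) absolutely_integrable_on {a..b}" using X by (simp add: B_def)
  show "(\<lambda>x. A x * \<beta> x) absolutely_integrable_on {a..b}" using Y by (simp add: A_def mult.commute)
  have tot: "integral\<^sup>L lborel f = A b" if f: "integrable lborel f" "AE x in lebesgue. f x = indicator {a..b} x * \<alpha> x"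
     and \<alpha>: "\<alpha> absolutely_integrable_on {a..b}" and A: "A b = integral {a..b} \<alpha>" for f \<alpha> A :: "real \<Rightarrow> real"
  proof -
    have "integral\<^sup>L lborel f = integral\<^sup>L lebesgue f" using f(1) by (subst integral_completion) auto
    also have "\<dots> = (LINT x|lebesgue. indicator {a..b} x *\<^sub>R \<alpha> x)"
      using f \<alpha> by (intro integral_cong_AE) (auto simp: set_integrable_def intro!: measurable_completion)
    also have "\<dots> = A b" using set_lebesgue_integral_eq_integral(2)[OF \<alpha>] by (simp add: set_lebesgue_integral_def A)
    finally show ?thesis .
  qed
  have "integral {a..b} (\<lambda>x. \<alpha> x * B x) + integral {a..b} (\<lambda>x. \<beta> x * A x) = A b * B b"
    using X Y F(3) tot[OF f \<alpha>, of A] tot[OF h \<beta>, of B] by (simp add: A_def B_def)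
  then show "integral {a..b} (\<lambda>x. \<alpha> x * B x) + integral {a..b} (\<lambda>x. A x * \<beta> x) = A b * B b"
    by (simp add: mult.commute)
qed

text \<open>Product rule for absolutely continuous functions. The initial values \<open>A a\<close>
  and \<open>B a\<close> contribute only multiples of \<open>\<beta>\<close> and
  \<open>\<alpha>\<close>, which reduces it to primitives vanishing at \<open>a\<close>.\<close>

lemma primitive_mult:
  fixes \<alpha> \<beta> A B :: "real \<Rightarrow> real"
  assumes ab: "a \<le> b" and \<alpha>: "\<alpha> absolutely_integrable_on {a..b}" and \<beta>: "\<beta> absolutely_integrable_on {a..b}"
    and A: "\<And>x. x \<in> {a..b} \<Longrightarrow> integral {a..x} \<alpha> = A x - A a"
    and B: "\<And>x. x \<in> {a..b} \<Longrightarrow> integral {a..x} \<beta> = B x - B a"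
  shows "(\<lambda>x. \<alpha> x * B x + A x * \<beta> x) absolutely_integrable_on {a..b}"
    and "integral {a..b} (\<lambda>x. \<alpha> x * B x + A x * \<beta> x) = A b * B b - A a * B a"
proof -
  note I = integral_by_parts_indefinite[OF ab \<alpha> \<beta>]
  let ?J = "\<lambda>x. (\<alpha> x * integral {a..x} \<beta> + integral {a..x} \<alpha> * \<beta> x) + (B a * \<alpha> x + A a * \<beta> x)"
  have i1: "(\<lambda>x. B a * \<alpha> x) absolutely_integrable_on {a..b}" "(\<lambda>x. A a * \<beta> x) absolutely_integrable_on {a..b}"
    using \<alpha> \<beta> by auto
  have eq: "?J x = \<alpha> x * B x + A x * \<beta> x" if "x \<in> {a..b}" for x
  proof -
    have "A x = A a + integral {a..x} \<alpha>" "B x = B a + integral {a..x} \<beta>" using A[OF that] B[OF that] by auto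
    then show ?thesis by (simp only:) (simp add: algebra_simps)
  qed
  have J: "?J absolutely_integrable_on {a..b}"
    by (intro set_integral_add I i1)
  show "(\<lambda>x. \<alpha> x * B x + A x * \<beta> x) absolutely_integrable_on {a..b}"
    using J eq by (subst set_integrable_cong[OF refl refl, where f'="?J"]) auto
  have "integral {a..b} (\<lambda>x. \<alpha> x * B x + A x * \<beta> x) = integral {a..b} ?J"
    using eq by (intro Henstock_Kurzweil_Integration.integral_cong) auto
  also have "\<dots> = (integral {a..b} (\<lambda>x. \<alpha> x * integral {a..x} \<beta>) + integral {a..b} (\<lambda>x. integral {a..x} \<alpha> * \<beta> x))
      + (B a * integral {a..b} \<alpha> + A a * integral {a..b} \<beta>)"
    using I(1,2) i1 \<alpha> \<beta>
    by (simp add: Henstock_Kurzweil_Integration.integral_add set_lebesgue_integral_eq_integral(1) integrable_add)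
  also have "\<dots> = A b * B b - A a * B a"
  proof -
    have e: "integral {a..b} \<alpha> = A b - A a" "integral {a..b} \<beta> = B b - B a" using A[of b] B[of b] ab by auto
    show ?thesis unfolding I(3) e by (simp add: algebra_simps)
  qed
  finally show "integral {a..b} (\<lambda>x. \<alpha> x * B x + A x * \<beta> x) = A b * B b - A a * B a" .
qed

text \<open>Local absolute continuity of \<open>u\<close> on the open half-line, with derivative
  \<open>v\<close> almost everywhere. Intervals stay away from 0, where a profile in
  \<open>H_space\<close> may be unbounded.\<close>

definition has_primitive :: "(real \<Rightarrow> real) \<Rightarrow> (real \<Rightarrow> real) \<Rightarrow> bool" where
  "has_primitive v u \<longleftrightarrow> (\<forall>a b. 0 < a \<longrightarrow> a \<le> b \<longrightarrow>
     v absolutely_integrable_on {a..b} \<and> integral {a..b} v = u b - u a)"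

lemma has_primitiveD:
  assumes "has_primitive v u" "0 < a" "a \<le> b"
  shows "v absolutely_integrable_on {a..b}" "v integrable_on {a..b}" "integral {a..b} v = u b - u a"
  using assms by (auto simp: has_primitive_def set_lebesgue_integral_eq_integral(1))

lemma has_primitive_continuous:
  assumes "has_primitive v u" "0 < a"
  shows "continuous_on {a..b} u"
proof (cases "a \<le> b")
  case True
  have "continuous_on {a..b} (\<lambda>x. u a + integral {a..x} v)"
    by (intro continuous_intros indefinite_integral_continuous_1 has_primitiveD(2)[OF assms True])
  then show ?thesis
    by (rule continuous_on_eq) (use has_primitiveD(3)[OF assms] in auto)
qed auto

lemma AE_lebesgue_negligible:
  "(AE x in lebesgue. P x) \<Longrightarrow> negligible {x. \<not> P x}"
  by (simp add: eventually_ae_filter_negligible) (meson negligible_subset)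

lemma absolutely_integrable_cong_AE:
  fixes f g :: "'a::euclidean_space \<Rightarrow> real"
  assumes "f absolutely_integrable_on S" "AE x in lebesgue. x \<in> S \<longrightarrow> f x = g x"
  shows "g absolutely_integrable_on S"
  by (rule absolutely_integrable_spike[OF assms(1) AE_lebesgue_negligible[OF assms(2)]]) auto

lemma integral_cong_AE_lebesgue:
  fixes f g :: "'a::euclidean_space \<Rightarrow> real"
  assumes "AE x in lebesgue. x \<in> S \<longrightarrow> f x = g x"
  shows "integral S f = integral S g"
  by (rule integral_spike[OF AE_lebesgue_negligible[OF assms]]) auto

text \<open>The positive and negative parts of a Borel version of \<open>z\<close> are densities of
  two measures that agree on all rays \<open>{x<..}\<close>. Hence the measures coincide, and so do
  their densities almost everywhere; two parts with disjoint supports can agree only by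
  vanishing.\<close>

lemma AE_zero_if_interval_integrals_zero_aux:
  fixes z :: "real \<Rightarrow> real"
  assumes z: "z absolutely_integrable_on {a..b}" and "\<And>x. x \<in> {a..b} \<Longrightarrow> integral {a..x} z = 0"
  shows "AE x in lebesgue. x \<in> {a..b} \<longrightarrow> z x = 0"
proof (cases "a \<le> b")
  case True
  obtain f where f: "integrable lborel f" "AE x in lebesgue. f x = indicator {a..b} x * z x"
    using lebesgue_borel_version[OF z] .
  have [measurable]: "f \<in> borel_measurable borel" using f(1) by auto
  have tot: "integral\<^sup>L lborel f = integral {a..b} z"
  proof -
    have "integral\<^sup>L lborel f = integral\<^sup>L lebesgue f" using f(1) by (subst integral_completion) auto
    also have "\<dots> = (LINT x|lebesgue. indicator {a..b} x *\<^sub>R z x)"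
      using f z by (intro integral_cong_AE) (auto simp: set_integrable_def intro!: measurable_completion)
    also have "\<dots> = integral {a..b} z" using set_lebesgue_integral_eq_integral(2)[OF z] by (simp add: set_lebesgue_integral_def)
    finally show ?thesis .
  qed
  have ind: "integrable lborel (\<lambda>y. indicator A y * f y)" if "A \<in> sets borel" for A
    using integrable_mult_indicator[OF _ f(1), of A] that by simp
  have le: "(LINT y|lborel. indicator {..x} y * f y) = 0" for x
  proof -
    consider "x < a" | "x \<in> {a..b}" | "x > b" by fastforce
    then show ?thesis
    proof cases
      case 1
      have "(LINT y|lborel. indicator {..x} y * f y) = (LINT y|lebesgue. indicator {..x} y * f y)"
        by (subst integral_completion) auto
      also have "\<dots> = 0"
        by (rule integral_eq_zero_AE) (use f(2) 1 in \<open>auto elim!: eventually_mono simp: indicator_def\<close>)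
      finally show ?thesis .
    next
      case 2
      then show ?thesis using indicator_integral_Icc[OF z f 2] assms(2) by simp
    next
      case 3
      have "(LINT y|lborel. indicator {..x} y * f y) = (LINT y|lebesgue. indicator {..x} y * f y)"
        by (subst integral_completion) auto
      also have "\<dots> = (LINT y|lebesgue. f y)"
        by (rule integral_cong_AE) (use f(2) 3 in \<open>auto elim!: eventually_mono simp: indicator_def intro!: measurable_completion\<close>)
      also have "\<dots> = (LINT y|lborel. f y)" by (subst integral_completion) auto
      finally show ?thesis using tot assms(2)[of b] True by simp
    qed
  qed
  have gt: "(LINT y|lborel. indicator {x<..} y * f y) = 0" for x
  proof -
    have "(LINT y|lborel. indicator {..x} y * f y) + (LINT y|lborel. indicator {x<..} y * f y)
       = (LINT y|lborel. indicator {..x} y * f y + indicator {x<..} y * f y)"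
      by (intro Bochner_Integration.integral_add[symmetric] ind) auto
    also have "\<dots> = integral\<^sup>L lborel f"
      by (intro Bochner_Integration.integral_cong) (auto simp: indicator_def)
    finally show ?thesis using le[of x] tot assms(2)[of b] True by simp
  qed
  have pn: "integrable lborel (\<lambda>y. max 0 (f y))" "integrable lborel (\<lambda>y. max 0 (- f y))"
    using f(1) by auto
  have em: "emeasure (density lborel (\<lambda>x. ennreal (max 0 (h x)))) {x<..} = ennreal (LINT y|lborel. indicator {x<..} y * max 0 (h y))"
    if h: "integrable lborel (\<lambda>y. max 0 (h y))" and [measurable]: "h \<in> borel_measurable borel" for h :: "real \<Rightarrow> real" and x
  proof -
    have "emeasure (density lborel (\<lambda>x. ennreal (max 0 (h x)))) {x<..} = (\<integral>\<^sup>+y. ennreal (max 0 (h y)) * indicator {x<..} y \<partial>lborel)"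
      by (subst emeasure_density) auto
    also have "\<dots> = (\<integral>\<^sup>+y. ennreal (indicator {x<..} y * max 0 (h y)) \<partial>lborel)"
      by (intro nn_integral_cong) (auto simp: indicator_def)
    also have "\<dots> = ennreal (LINT y|lborel. indicator {x<..} y * max 0 (h y))"
      using integrable_mult_indicator[OF _ h, of "{x<..}"] by (intro nn_integral_eq_integral) auto
    finally show ?thesis .
  qed
  have "density lborel (\<lambda>x. ennreal (max 0 (f x))) = density lborel (\<lambda>x. ennreal (max 0 (- f x)))"
  proof (rule measure_eqI_lessThan)
    fix x
    have "(LINT y|lborel. indicator {x<..} y * max 0 (f y)) - (LINT y|lborel. indicator {x<..} y * max 0 (- f y))
       = (LINT y|lborel. indicator {x<..} y * max 0 (f y) - indicator {x<..} y * max 0 (- f y))"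
      using integrable_mult_indicator[OF _ pn(1), of "{x<..}"] integrable_mult_indicator[OF _ pn(2), of "{x<..}"]
      by (intro Bochner_Integration.integral_diff[symmetric]) auto
    also have "\<dots> = (LINT y|lborel. indicator {x<..} y * f y)"
      by (intro Bochner_Integration.integral_cong) (auto simp: indicator_def)
    finally show "emeasure (density lborel (\<lambda>x. ennreal (max 0 (f x)))) {x<..} = emeasure (density lborel (\<lambda>x. ennreal (max 0 (- f x)))) {x<..}"
      using gt[of x] pn by (simp add: em)
  qed (use pn in \<open>simp_all add: em\<close>)
  then have "AE x in lborel. ennreal (max 0 (f x)) = ennreal (max 0 (- f x))"
    by (intro sigma_finite_measure.density_unique[OF sigma_finite_lborel]) auto
  then have "AE x in lborel. f x = 0"
  proof eventually_elim
    case (elim x)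
    then have "max 0 (f x) = max 0 (- f x)" by (subst (asm) ennreal_inj) auto
    then show ?case by (auto simp: max_def split: if_splits)
  qed
  then have "AE x in lebesgue. f x = 0" by (rule AE_completion)
  with f(2) show ?thesis by eventually_elim auto
qed auto

lemma AE_zero_if_interval_integrals_zero:
  fixes z :: "real \<Rightarrow> real"
  assumes z: "\<And>a b. 0 < a \<Longrightarrow> a \<le> b \<Longrightarrow> z absolutely_integrable_on {a..b}"
    and 0: "\<And>a b. 0 < a \<Longrightarrow> a \<le> b \<Longrightarrow> integral {a..b} z = 0"
  shows "AE x in lebesgue. 0 < x \<longrightarrow> z x = 0"
proof -
  have "AE x in lebesgue. \<forall>n::nat. x \<in> {1 / Suc n .. Suc n} \<longrightarrow> z x = 0"
  proof (subst AE_all_countable, intro allI)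
    fix n :: nat
    have "1 / real (Suc n) \<le> real (Suc n)" by (simp add: field_simps)
    then show "AE x in lebesgue. x \<in> {1 / Suc n .. Suc n} \<longrightarrow> z x = 0"
      by (intro AE_zero_if_interval_integrals_zero_aux z) (auto simp: 0)
  qed
  then show ?thesis
  proof eventually_elim
    case (elim x)
    show ?case
    proof
      assume "0 < x"
      obtain n1 where n1: "x \<le> real n1" using real_arch_simple by blast
      obtain n2 where n2: "inverse (real (Suc n2)) < x" using reals_Archimedean[OF \<open>0<x\<close>] by blast
      define n where "n = max n1 n2"
      have "1 / real (Suc n) \<le> 1 / real (Suc n2)" by (intro divide_left_mono) (auto simp: n_def)
      moreover have "x \<le> real (Suc n)" using n1 by (simp add: n_def)
      ultimately have "x \<in> {1 / real (Suc n) .. real (Suc n)}" using n2 by (simp add: inverse_eq_divide del: of_nat_Suc)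
      then show "z x = 0" using elim by blast
    qed
  qed
qed

text \<open>Turns the weak derivative condition around: any continuous \<open>k\<close> supported in
  \<open>{a..b}\<close> with mean zero is the derivative of an admissible test function. Mean zero
  is what makes the primitive vanish to the right of \<open>b\<close>.\<close>

lemma test_function_integral:
  fixes k :: "real \<Rightarrow> real"
  assumes k: "continuous_on UNIV k" and supp: "\<forall>x. x \<notin> {a..b} \<longrightarrow> k x = 0" and ab: "0 < a" "a \<le> b"
   and 0: "integral {a..b} k = 0"
  defines "\<phi> \<equiv> \<lambda>x. integral {a..x} k"
  shows "test_function {0<..} \<phi>" "\<And>x. frechet_derivative \<phi> (at x) 1 = k x" "\<And>x. x \<notin> {a..b} \<Longrightarrow> \<phi> x = 0"
    "\<And>x. (\<phi> has_real_derivative k x) (at x)"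
proof -
  have out: "k x = 0" if "x \<notin> {a..b}" for x using supp that by auto
  have int: "k integrable_on {c..d}" for c d
    by (rule integrable_continuous_real) (use k continuous_on_subset in blast)
  show D: "(\<phi> has_real_derivative k x) (at x)" for x
  proof (cases "x < a")
    case True
    have "((\<lambda>_. 0) has_real_derivative k x) (at x)" using out[of x] True by auto
    then show ?thesis
      by (rule has_field_derivative_transform_within_open[where S="{..<a}"]) (use True in \<open>auto simp: \<phi>_def\<close>)
  next
    case False
    \<comment> \<open>Starting the integral at \<open>a - 1\<close> makes \<open>x = a\<close> an
      interior point, so the derivative there is two-sided.\<close>
    have "((\<lambda>y. integral {a-1..y} k) has_real_derivative k x) (at x within {a-1..x+1})"
      by (rule integral_has_real_derivative) (use k continuous_on_subset False in \<open>blast, auto\<close>)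
    then have "((\<lambda>y. integral {a-1..y} k) has_real_derivative k x) (at x)"
      using False by (simp add: at_within_Icc_at)
    then show ?thesis
    proof (rule has_field_derivative_transform_within_open[where S="{a-1<..}"])
      fix y assume y: "y \<in> {a-1<..}"
      show "integral {a-1..y} k = \<phi> y"
      proof (cases "y \<le> a")
        case True
        have "integral {a-1..y} k = integral {a-1..y} (\<lambda>_. 0)"
        proof (rule integral_spike[where S="{a}"])
          show "0 = k x" if "x \<in> {a-1..y} - {a}" for x
            using out[of x] that True by auto
        qed auto
        moreover have "\<phi> y = 0" using True by (cases "y = a") (auto simp: \<phi>_def)
        ultimately show ?thesis by simp
      next
        case False
        have "integral {a-1..y} k = integral {a-1..a} k + integral {a..y} k"
          using False by (intro Henstock_Kurzweil_Integration.integral_combine[symmetric] int) auto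
        moreover have "integral {a-1..a} k = integral {a-1..a} (\<lambda>_. 0)"
        proof (rule integral_spike[where S="{a}"])
          show "0 = k x" if "x \<in> {a-1..a} - {a}" for x
            using out[of x] that by auto
        qed auto
        ultimately show ?thesis by (simp add: \<phi>_def)
      qed
    qed (use False in auto)
  qed
  show F: "frechet_derivative \<phi> (at x) 1 = k x" for x
    using frechet_derivative_at[OF D[of x, unfolded has_field_derivative_def]] by (metis mult.right_neutral)
  show Z: "\<phi> x = 0" if "x \<notin> {a..b}" for x
  proof (cases "x < a")
    case False
    then have "x > b" using that by auto
    have "integral {a..x} k = integral {a..b} k + integral {b..x} k"
      using ab \<open>x > b\<close> by (intro Henstock_Kurzweil_Integration.integral_combine[symmetric] int) auto
    moreover have "integral {b..x} k = integral {b..x} (\<lambda>_. 0)"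
    proof (rule integral_spike[where S="{b}"])
      show "0 = k y" if "y \<in> {b..x} - {b}" for y
        using out[of y] that by auto
    qed auto
    ultimately show ?thesis using 0 by (simp add: \<phi>_def)
  qed (simp add: \<phi>_def)
  have "{x. \<phi> x \<noteq> 0} \<subseteq> {a..b}" using Z by blast
  then have cl: "closure {x. \<phi> x \<noteq> 0} \<subseteq> {a..b}" by (simp add: closure_minimal)
  have "compact (closure {x. \<phi> x \<noteq> 0})"
    using cl by (metis bounded_closed_interval bounded_subset closed_closure compact_eq_bounded_closed)
  then show "test_function {0<..} \<phi>"
    unfolding test_function_def using cl ab D k F
    by (auto simp: real_differentiable_def differentiable_def has_field_derivative_def)
qed

section \<open>Weak derivatives on the half-line\<close>

text \<open>Continuous cutoffs that tend to the indicator of the open interval, rising with slope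
  \<open>n\<close> at both ends. Continuity suffices, since test functions will be their
  primitives.\<close>

definition trapezoid :: "nat \<Rightarrow> real \<Rightarrow> real \<Rightarrow> real \<Rightarrow> real" where
  "trapezoid n a b x = max 0 (min 1 (real n * min (x - a) (b - x)))"

lemma continuous_on_trapezoid: "continuous_on S (trapezoid n a b)"
  unfolding trapezoid_def by (intro continuous_intros)

lemma trapezoid_bounds: "0 \<le> trapezoid n a b x" "trapezoid n a b x \<le> 1"
  by (auto simp: trapezoid_def)

lemma trapezoid_outside:
  assumes "x \<notin> {a<..<b}" shows "trapezoid n a b x = 0"
proof -
  have "min (x - a) (b - x) \<le> 0" using assms by auto
  then have "real n * min (x - a) (b - x) \<le> 0" by (simp add: mult_nonneg_nonpos)
  then show ?thesis by (simp add: trapezoid_def)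
qed

lemma trapezoid_tendsto:
  assumes "x \<in> {a<..<b}" shows "(\<lambda>n. trapezoid n a b x) \<longlonglongrightarrow> 1"
proof (rule tendsto_eventually)
  let ?d = "min (x - a) (b - x)"
  have d: "?d > 0" using assms by auto
  obtain N :: nat where N: "1 / ?d < N" using reals_Archimedean2 by blast
  show "\<forall>\<^sub>F n in sequentially. trapezoid n a b x = 1"
  proof (rule eventually_sequentiallyI[of N])
    fix n assume "N \<le> n"
    then have "1 / ?d \<le> n" using N by linarith
    then have "1 \<le> real n * ?d" using d by (simp only: pos_divide_le_eq)
    then show "trapezoid n a b x = 1" by (simp add: trapezoid_def)
  qed
qed

lemma integral_trapezoid_mult_tendsto:
  fixes z :: "real \<Rightarrow> real"
  assumes z: "z absolutely_integrable_on {L..R}" and ab: "L \<le> a" "a \<le> b" "b \<le> R"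
  shows "(\<lambda>x. z x * trapezoid n a b x) absolutely_integrable_on {L..R}"
   and "(\<lambda>n. integral {L..R} (\<lambda>x. z x * trapezoid n a b x)) \<longlonglongrightarrow> integral {a..b} z"
proof -
  have ai: "(\<lambda>x. z x * trapezoid n a b x) absolutely_integrable_on {L..R}" for n
  proof (rule measurable_bounded_by_integrable_imp_absolutely_integrable)
    show "(\<lambda>x. z x * trapezoid n a b x) \<in> borel_measurable (lebesgue_on {L..R})"
      using absolutely_integrable_imp_borel_measurable[OF z]
        continuous_imp_measurable_on_sets_lebesgue[OF continuous_on_trapezoid[of "{L..R}" n a b]] by simp
    show "(\<lambda>x. norm (z x)) integrable_on {L..R}"
      using z by (simp add: absolutely_integrable_on_def)
    show "norm (z x * trapezoid n a b x) \<le> norm (z x)" for x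
      using trapezoid_bounds[of n a b x] by (simp add: abs_mult mult_left_le)
  qed auto
  show "(\<lambda>x. z x * trapezoid n a b x) absolutely_integrable_on {L..R}" by (rule ai)
  have "(\<lambda>n. integral {L..R} (\<lambda>x. z x * trapezoid n a b x)) \<longlonglongrightarrow> integral {L..R} (\<lambda>x. if x \<in> {a<..<b} then z x else 0)"
  proof (rule dominated_convergence(2)[where h="\<lambda>x. norm (z x)"])
    show "(\<lambda>x. z x * trapezoid k a b x) integrable_on {L..R}" for k
      using ai set_lebesgue_integral_eq_integral(1) by blast
    show "(\<lambda>x. norm (z x)) integrable_on {L..R}"
      using z by (simp add: absolutely_integrable_on_def)
    show "norm (z x * trapezoid k a b x) \<le> norm (z x)" for k x
      using trapezoid_bounds[of k a b x] by (simp add: abs_mult mult_left_le)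
    show "(\<lambda>k. z x * trapezoid k a b x) \<longlonglongrightarrow> (if x \<in> {a<..<b} then z x else 0)" for x
      using tendsto_mult[OF tendsto_const[of "z x"] trapezoid_tendsto[of x a b]] trapezoid_outside[of x a b] by auto
  qed
  also have "integral {L..R} (\<lambda>x. if x \<in> {a<..<b} then z x else 0) = integral {a<..<b} z"
    using ab by (subst integral_restrict_Int) (auto intro!: arg_cong[where f="\<lambda>S. integral S z"])
  also have "\<dots> = integral {a..b} z" by (simp add: integral_open_interval_real)
  finally show "(\<lambda>n. integral {L..R} (\<lambda>x. z x * trapezoid n a b x)) \<longlonglongrightarrow> integral {a..b} z" .
qed

lemma weak_derivative_integrable_Icc:
  fixes a b :: real
  assumes "weak_partial_derivative {0<..} 1 u v" "0 < a"
  shows "u absolutely_integrable_on {a..b}" "v absolutely_integrable_on {a..b}"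
proof -
  have "compact {a..b}" "{a..b} \<subseteq> {0<..}" using assms(2) by auto
  then show "u absolutely_integrable_on {a..b}" "v absolutely_integrable_on {a..b}"
    using assms(1) unfolding weak_partial_derivative_def locally_integrable_on_def by blast+
qed

lemma weak_derivative_integral_identity:
  fixes k u v :: "real \<Rightarrow> real"
  assumes w: "weak_partial_derivative {0<..} 1 u v"
   and k: "continuous_on UNIV k" and out: "\<forall>x. x \<notin> {a..b} \<longrightarrow> k x = 0" and ab: "0 < a" "a \<le> b"
   and 0: "integral {a..b} k = 0"
  shows "integral {a..b} (\<lambda>x. u x * k x) = - integral {a..b} (\<lambda>x. v x * integral {a..x} k)"
proof -
  note T = test_function_integral[OF k out ab 0]
  let ?\<phi> = "\<lambda>x. integral {a..x} k"
  note u = weak_derivative_integrable_Icc(1)[OF w ab(1), of b] and v = weak_derivative_integrable_Icc(2)[OF w ab(1), of b]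
  have bm: "(\<lambda>x. f x * h x) absolutely_integrable_on {a..b}" if f: "f absolutely_integrable_on {a..b}" and h: "continuous_on {a..b} h" for f h :: "real \<Rightarrow> real"
    using absolutely_integrable_bounded_measurable_product_real[of h "{a..b}" f] f h
    by (simp add: mult.commute continuous_imp_measurable_on_sets_lebesgue compact_imp_bounded compact_continuous_image)
  have c\<phi>: "continuous_on {a..b} ?\<phi>"
    by (intro indefinite_integral_continuous_1 integrable_continuous_real) (use k continuous_on_subset in blast)
  have "(LINT x:{0<..}|lebesgue. u x * k x) = integral {a..b} (\<lambda>x. u x * k x)"
  proof -
    have "(LINT x:{0<..}|lebesgue. u x * k x) = (LINT x:{a..b}|lebesgue. u x * k x)"
      unfolding set_lebesgue_integral_def using ab out by (intro Bochner_Integration.integral_cong) (auto simp: indicator_def)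
    then show ?thesis using set_lebesgue_integral_eq_integral(2)[OF bm[OF u, of k]] k continuous_on_subset by auto
  qed
  moreover have "(LINT x:{0<..}|lebesgue. v x * ?\<phi> x) = integral {a..b} (\<lambda>x. v x * ?\<phi> x)"
  proof -
    have "(LINT x:{0<..}|lebesgue. v x * ?\<phi> x) = (LINT x:{a..b}|lebesgue. v x * ?\<phi> x)"
      unfolding set_lebesgue_integral_def using ab T(3) by (intro Bochner_Integration.integral_cong) (auto simp: indicator_def)
    then show ?thesis using set_lebesgue_integral_eq_integral(2)[OF bm[OF v c\<phi>]] by auto
  qed
  moreover have "(LINT x:{0<..}|lebesgue. u x * frechet_derivative ?\<phi> (at x) 1) = - (LINT x:{0<..}|lebesgue. v x * ?\<phi> x)"
    using w T(1) unfolding weak_partial_derivative_def by blast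
  moreover have "(\<lambda>x. u x * frechet_derivative ?\<phi> (at x) 1) = (\<lambda>x. u x * k x)"
    by (rule ext) (simp only: T(2))
  ultimately show ?thesis by simp
qed

text \<open>The du Bois-Reymond argument: if \<open>t\<close> is a primitive of \<open>v\<close>,
  then \<open>u - t\<close> integrates to zero against every compactly supported continuous
  \<open>k\<close> of mean zero, so it is constant almost everywhere.\<close>

lemma weak_derivative_imp_primitive:
  assumes w: "weak_partial_derivative {0<..} (1::real) u v"
  obtains U where "has_primitive v U" "AE x in lebesgue. 0 < x \<longrightarrow> u x = U x"
proof -
  note u = weak_derivative_integrable_Icc(1)[OF w] and v = weak_derivative_integrable_Icc(2)[OF w]
  have vi: "v integrable_on {a..b}" if "0 < a" for a b
    using v[OF that] set_lebesgue_integral_eq_integral(1) by blast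
  \<comment> \<open>The base point is 1; two cases are needed because the integral over a reversed
    interval is 0.\<close>
  define t where "t x = (if x \<ge> 1 then integral {1..x} v else - integral {x..1} v)" for x
  have t: "has_primitive v t"
    unfolding has_primitive_def
  proof (intro allI impI conjI)
    fix a b :: real assume ab: "0 < a" "a \<le> b"
    then show "v absolutely_integrable_on {a..b}" using v by auto
    consider "b < 1" | "a < 1" "1 \<le> b" | "1 \<le> a" using ab by linarith
    then show "integral {a..b} v = t b - t a"
    proof cases
      case 1
      then have "integral {a..b} v + integral {b..1} v = integral {a..1} v"
        using ab vi by (intro Henstock_Kurzweil_Integration.integral_combine) auto
      with 1 ab show ?thesis by (simp add: t_def)
    next
      case 2
      then have "integral {a..1} v + integral {1..b} v = integral {a..b} v"
        using ab vi by (intro Henstock_Kurzweil_Integration.integral_combine) auto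
      with 2 ab show ?thesis by (simp add: t_def)
    next
      case 3
      then have "integral {1..a} v + integral {a..b} v = integral {1..b} v"
        using ab vi by (intro Henstock_Kurzweil_Integration.integral_combine) auto
      with 3 ab show ?thesis by (simp add: t_def)
    qed
  qed
  define z where "z x = u x - t x" for x
  have ti: "t absolutely_integrable_on {a..b}" if "0 < a" for a b
    by (intro absolutely_integrable_continuous_real has_primitive_continuous[OF t that])
  have z: "z absolutely_integrable_on {a..b}" if "0 < a" for a b
    unfolding z_def using u[OF that] ti[OF that] by (rule set_integral_diff)
  have key: "integral {L..R} (\<lambda>x. z x * k x) = 0"
    if k: "continuous_on UNIV k" and out: "\<forall>x. x \<notin> {L..R} \<longrightarrow> k x = 0" and LR: "0 < L" "L \<le> R"
   and 0: "integral {L..R} k = 0" for k L R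
  proof -
    note I = weak_derivative_integral_identity[OF w k out LR 0]
    have kL: "continuous_on {L..R} k" using k continuous_on_subset by blast
    have kint: "k absolutely_integrable_on {L..R}" by (intro absolutely_integrable_continuous_real kL)
    have P: "integral {L..R} (\<lambda>x. v x * integral {L..x} k + t x * k x) = t R * integral {L..R} k - t L * integral {L..L} k"
     "(\<lambda>x. v x * integral {L..x} k + t x * k x) absolutely_integrable_on {L..R}"
      using has_primitiveD[OF t] LR
      by (intro primitive_mult[where A=t and B="\<lambda>x. integral {L..x} k"] v kint; simp)+
    have bm: "(\<lambda>x. f x * k x) absolutely_integrable_on {L..R}" if f: "f absolutely_integrable_on {L..R}" for f :: "real \<Rightarrow> real"
      using absolutely_integrable_bounded_measurable_product_real[of k "{L..R}" f] f kL
      by (simp add: mult.commute continuous_imp_measurable_on_sets_lebesgue compact_imp_bounded compact_continuous_image)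
    note b = bm[OF u] bm[OF ti]
    have "(\<lambda>x. (v x * integral {L..x} k + t x * k x) - t x * k x) absolutely_integrable_on {L..R}"
      by (intro set_integral_diff P(2) b LR)
    then have vk: "(\<lambda>x. v x * integral {L..x} k) absolutely_integrable_on {L..R}" by simp
    have "integral {L..R} (\<lambda>x. v x * integral {L..x} k) + integral {L..R} (\<lambda>x. t x * k x) = 0"
      using P(1) 0 LR b(2)[OF LR(1)] vk by (subst Henstock_Kurzweil_Integration.integral_add[symmetric]) (auto simp: set_lebesgue_integral_eq_integral(1))
    moreover have "integral {L..R} (\<lambda>x. z x * k x) = integral {L..R} (\<lambda>x. u x * k x) - integral {L..R} (\<lambda>x. t x * k x)"
      unfolding z_def left_diff_distrib using b LR
      by (intro Henstock_Kurzweil_Integration.integral_diff) (auto simp: set_lebesgue_integral_eq_integral(1))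
    ultimately show ?thesis using I by simp
  qed
  \<comment> \<open>The candidate constant is the mean of \<open>z\<close> over
    \<open>{1..2}\<close>, an interval of length one.\<close>
  define C where "C = integral {1..2} z"
  have zC: "integral {a..b} z = C * (b - a)" if ab: "0 < a" "a \<le> b" for a b
  proof -
    define L R where "L = min a 1" and "R = max b 2"
    have LR: "0 < L" "L \<le> R" "L \<le> a" "b \<le> R" "L \<le> 1" "2 \<le> R" using ab by (auto simp: L_def R_def)
    define p q where "p n = integral {L..R} (\<lambda>x. 1 * trapezoid n a b x)" and "q n = integral {L..R} (\<lambda>x. 1 * trapezoid n 1 2 x)" for n
    note T1 = integral_trapezoid_mult_tendsto[where L=L and R=R, OF _ LR(3) ab(2) LR(4)]
    note T2 = integral_trapezoid_mult_tendsto[where L=L and R=R, OF _ LR(5) _ LR(6), simplified]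
    have one: "(\<lambda>x. 1::real) absolutely_integrable_on {L..R}" by simp
    have 0: "q n * integral {L..R} (\<lambda>x. z x * trapezoid n a b x) - p n * integral {L..R} (\<lambda>x. z x * trapezoid n 1 2 x) = 0" for n
    proof -
      \<comment> \<open>Weighting each trapezoid with the mass of the other gives a function of mean
        zero. In the limit this compares the average of \<open>z\<close> over \<open>{a..b}\<close>
        with that over \<open>{1..2}\<close>.\<close>
      let ?k = "\<lambda>x. q n * trapezoid n a b x - p n * trapezoid n 1 2 x"
      have "integral {L..R} ?k = 0"
        using T1(1)[OF one, of n] T2(1)[OF one, of n]
        by (subst Henstock_Kurzweil_Integration.integral_diff) (auto simp: p_def q_def set_lebesgue_integral_eq_integral(1))
      then have "integral {L..R} (\<lambda>x. z x * ?k x) = 0"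
        using LR by (intro key continuous_intros continuous_on_trapezoid) (auto simp: trapezoid_outside)
      moreover have "integral {L..R} (\<lambda>x. z x * ?k x) = integral {L..R} (\<lambda>x. q n * (z x * trapezoid n a b x) - p n * (z x * trapezoid n 1 2 x))"
        by (simp add: algebra_simps)
      moreover have "\<dots> = q n * integral {L..R} (\<lambda>x. z x * trapezoid n a b x) - p n * integral {L..R} (\<lambda>x. z x * trapezoid n 1 2 x)"
        using T1(1)[OF z, of n] T2(1)[OF z, of n] LR(1)
        by (subst Henstock_Kurzweil_Integration.integral_diff) (auto simp: set_lebesgue_integral_eq_integral(1))
      ultimately show ?thesis by simp
    qed
    have "(\<lambda>n. q n * integral {L..R} (\<lambda>x. z x * trapezoid n a b x) - p n * integral {L..R} (\<lambda>x. z x * trapezoid n 1 2 x))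
       \<longlonglongrightarrow> integral {1..2::real} (\<lambda>_. 1) * integral {a..b} z - integral {a..b} (\<lambda>_. 1) * integral {1..2} z"
      unfolding p_def q_def by (intro tendsto_intros T1(2) T2(2) one z LR)
    with 0 have "integral {1..2::real} (\<lambda>_. 1::real) * integral {a..b} z - integral {a..b} (\<lambda>_. 1) * integral {1..2} z = 0"
      using LIMSEQ_unique[OF tendsto_const[of 0]] by fastforce
    then show ?thesis using ab by (simp add: C_def mult.commute)
  qed
  have "AE x in lebesgue. 0 < x \<longrightarrow> z x - C = 0"
  proof (rule AE_zero_if_interval_integrals_zero)
    fix a b :: real assume ab: "0 < a" "a \<le> b"
    show "(\<lambda>x. z x - C) absolutely_integrable_on {a..b}" using z[OF ab(1)] by (rule set_integral_diff) simp
    show "integral {a..b} (\<lambda>x. z x - C) = 0"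
      using z[OF ab(1)] zC[OF ab] ab by (subst Henstock_Kurzweil_Integration.integral_diff) (auto simp: set_lebesgue_integral_eq_integral(1))
  qed
  then have "AE x in lebesgue. 0 < x \<longrightarrow> u x = t x + C" by eventually_elim (auto simp: z_def)
  moreover have "has_primitive v (\<lambda>x. t x + C)" using t by (simp add: has_primitive_def)
  ultimately show ?thesis using that by blast
qed

lemma continuous_AE_eq_imp_eq:
  fixes F G :: "real \<Rightarrow> real"
  assumes ae: "AE x in lebesgue. 0 < x \<longrightarrow> F x = G x" and F: "continuous_on {0<..} F" and G: "continuous_on {0<..} G" and x: "0 < x"
  shows "F x = G x"
proof (rule ccontr)
  assume ne: "F x \<noteq> G x"
  have "open ((\<lambda>x. F x - G x) -` (- {0}) \<inter> {0<..})"
    by (subst Int_commute, rule continuous_open_preimage) (auto intro!: continuous_intros F G)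
  moreover have "(\<lambda>x. F x - G x) -` (- {0}) \<inter> {0<..} \<noteq> {}" using ne x by auto
  ultimately have "\<not> negligible ((\<lambda>x. F x - G x) -` (- {0}) \<inter> {0<..})" by (rule open_not_negligible)
  moreover have "negligible {x. \<not> (0 < x \<longrightarrow> F x = G x)}"
    by (rule AE_lebesgue_negligible[OF ae])
  moreover have "(\<lambda>x. F x - G x) -` (- {0}) \<inter> {0<..} \<subseteq> {x. \<not> (0 < x \<longrightarrow> F x = G x)}" by auto
  ultimately show False using negligible_subset by blast
qed

lemma has_primitive_continuous_on_halfline:
  assumes "has_primitive v u" shows "continuous_on {0<..} u"
proof -
  have "isCont u x" if "0 < x" for x
    using continuous_on_interior[OF has_primitive_continuous[OF assms, of "x/2" "2*x"]] that by auto
  then show ?thesis by (simp add: continuous_at_imp_continuous_on)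
qed

text \<open>Primitives of the two derivatives agree almost everywhere with \<open>u\<close>, hence
  everywhere by continuity, so all interval integrals of the difference vanish. This is what makes
  the choice in \<open>weak_deriv\<close> harmless.\<close>

lemma weak_derivative_unique:
  assumes "weak_partial_derivative {0<..} (1::real) u v1" "weak_partial_derivative {0<..} (1::real) u v2"
  shows "AE x in lebesgue. 0 < x \<longrightarrow> v1 x = v2 x"
proof -
  obtain U1 where U1: "has_primitive v1 U1" "AE x in lebesgue. 0 < x \<longrightarrow> u x = U1 x"
    using weak_derivative_imp_primitive[OF assms(1)] .
  obtain U2 where U2: "has_primitive v2 U2" "AE x in lebesgue. 0 < x \<longrightarrow> u x = U2 x"
    using weak_derivative_imp_primitive[OF assms(2)] .
  have "AE x in lebesgue. 0 < x \<longrightarrow> U1 x = U2 x" using U1(2) U2(2) by eventually_elim auto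
  then have eq: "U1 x = U2 x" if "0 < x" for x
    using continuous_AE_eq_imp_eq has_primitive_continuous_on_halfline U1(1) U2(1) that by blast
  have "AE x in lebesgue. 0 < x \<longrightarrow> v1 x - v2 x = 0"
  proof (rule AE_zero_if_interval_integrals_zero)
    fix a b :: real assume ab: "0 < a" "a \<le> b"
    note D = has_primitiveD[OF U1(1) ab] has_primitiveD[OF U2(1) ab]
    show "(\<lambda>x. v1 x - v2 x) absolutely_integrable_on {a..b}" by (intro set_integral_diff D)
    show "integral {a..b} (\<lambda>x. v1 x - v2 x) = 0"
      using D ab eq by (subst Henstock_Kurzweil_Integration.integral_diff) auto
  qed
  then show ?thesis by eventually_elim auto
qed

section \<open>Integration of radial functions in the plane\<close>

text \<open>Polar coordinates for radial functions, checked on rays \<open>{..r}\<close>, where the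
  left side is the area of a disc. For negative \<open>r\<close> the conversion to
  \<open>ennreal\<close> makes the density zero.\<close>

lemma distr_norm_plane:
  "distr lborel borel (norm :: real^2 \<Rightarrow> real) = density lborel (\<lambda>r. ennreal (2 * pi * r))"
proof (rule measure_eqI_generator_eq)
  let ?E = "range (\<lambda>r::real. {..r})"
  have sb: "sets (borel :: real measure) = sigma_sets UNIV ?E"
    unfolding borel_eq_atMost by simp
  show "Int_stable ?E" by (auto simp: Int_stable_def)
  show "?E \<subseteq> Pow UNIV" by auto
  show "sets (distr lborel borel (norm :: real^2 \<Rightarrow> real)) = sigma_sets UNIV ?E" using sb by simp
  show "sets (density lborel (\<lambda>r. ennreal (2 * pi * r))) = sigma_sets UNIV ?E" using sb by simp
  show "range (\<lambda>n::nat. {..real n}) \<subseteq> ?E" by auto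
  show "(\<Union>n::nat. {..real n}) = UNIV" by (auto intro: real_arch_simple)
  have 1: "emeasure (distr lborel borel (norm :: real^2 \<Rightarrow> real)) {..r} = (if r \<ge> 0 then ennreal (pi * r^2) else 0)" for r
  proof -
    have "emeasure (distr lborel borel (norm :: real^2 \<Rightarrow> real)) {..r} = emeasure lborel (cball (0::real^2) r)"
      by (subst emeasure_distr) (auto intro!: arg_cong[where f="emeasure lborel"] simp: cball_def)
    also have "\<dots> = (if r \<ge> 0 then ennreal (pi * r^2) else 0)"
      by (auto simp: emeasure_cball unit_ball_vol_2)
    finally show ?thesis .
  qed
  show "emeasure (distr lborel borel (norm :: real^2 \<Rightarrow> real)) {..real n} \<noteq> \<infinity>" for n
    by (simp add: 1)
  fix X assume "X \<in> ?E"
  then obtain r where X: "X = {..r}" by auto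
  have "emeasure (density lborel (\<lambda>r. ennreal (2 * pi * r))) {..r} = (\<integral>\<^sup>+x. ennreal (2 * pi * x) * indicator {..r} x \<partial>lborel)"
    by (subst emeasure_density) auto
  also have "\<dots> = (\<integral>\<^sup>+x. ennreal (2 * pi * x) * indicator {0..r} x \<partial>lborel)"
    by (intro nn_integral_cong) (auto simp: indicator_def ennreal_neg mult_nonneg_nonpos)
  also have "\<dots> = (if r \<ge> 0 then ennreal (pi * r^2) else 0)"
  proof (cases "r \<ge> 0")
    case True
    have "(\<integral>\<^sup>+x. ennreal (2 * pi * x) * indicator {0..r} x \<partial>lborel) = ennreal (pi * r^2 - pi * 0^2)"
      by (rule nn_integral_FTC_Icc) (use True in \<open>auto intro!: derivative_eq_intros\<close>)
    then show ?thesis using True by simp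
  qed (simp add: indicator_def)
  finally show "emeasure (distr lborel borel (norm :: real^2 \<Rightarrow> real)) X = emeasure (density lborel (\<lambda>r. ennreal (2 * pi * r))) X"
    using X 1 by simp
qed

lemma borel_norm_image_closed:
  fixes C :: "(real^2) set"
  assumes "closed C" shows "norm ` C \<in> sets borel"
proof -
  have "C = (\<Union>n::nat. C \<inter> cball 0 (real n))"
    by (auto simp: real_arch_simple)
  then have "norm ` C = (\<Union>n::nat. norm ` (C \<inter> cball 0 (real n)))"
    by (metis image_UN)
  also have "\<dots> \<in> sets borel"
  proof (intro sets.countable_UN subsetI, clarify)
    fix n :: nat
    have "compact (norm ` (C \<inter> cball 0 (real n)))"
      using assms by (intro compact_continuous_image continuous_intros closed_Int_compact) auto
    then show "norm ` (C \<inter> cball 0 (real n)) \<in> sets borel" by (simp add: borel_compact)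
  qed
  finally show ?thesis .
qed

text \<open>Open supersets of the preimage need not be radial. The circles lying entirely inside
  such a set form a radial subset that still contains the preimage; intersecting over shrinking open
  sets gives a Borel set of radii, whose length vanishes by the polar formula because
  \<open>2 * pi * r\<close> is positive there.\<close>

lemma null_sets_of_vimage_norm:
  assumes B: "B \<subseteq> {0<..}" and null: "norm -` B \<in> null_sets (lebesgue :: (real^2) measure)"
  shows "B \<in> null_sets lebesgue"
proof -
  let ?E = "norm -` B :: (real^2) set"
  have "\<exists>T. open T \<and> ?E \<subseteq> T \<and> emeasure lebesgue (T - ?E) < ennreal (1 / Suc n)" for n
    using sets_lebesgue_outer_open[of ?E "1 / Suc n"] null by (metis null_setsD2 of_nat_0_less_iff zero_less_Suc zero_less_divide_1_iff)
  then obtain G where G: "\<And>n. open (G n)" "\<And>n. ?E \<subseteq> G n" "\<And>n. emeasure lebesgue (G n - ?E) < ennreal (1 / Suc n)"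
    by metis
  \<comment> \<open>Radius \<open>r\<close> survives exactly when the whole circle of radius
    \<open>r\<close> lies in every \<open>G n\<close>; images of closed sets under the norm are
    Borel.\<close>
  define A where "A = (\<Inter>n::nat. {0<..} - norm ` (- G n))"
  have A[measurable]: "A \<in> sets borel"
    unfolding A_def by (intro sets.countable_INT image_subsetI sets.Diff borel_norm_image_closed) (use G(1) in auto)
  have BA: "B \<subseteq> A"
  proof
    fix r assume r: "r \<in> B"
    have "r \<notin> norm ` (- G n)" for n using G(2)[of n] r by auto
    then show "r \<in> A" using r B by (auto simp: A_def)
  qed
  have sub: "norm -` A \<subseteq> G n" for n by (auto simp: A_def)
  have "emeasure lborel (norm -` A :: (real^2) set) \<le> ennreal (1 / Suc n)" for n
  proof -
    have "norm -` A \<in> sets (borel :: (real^2) measure)" using measurable_sets[of norm borel borel A] A by simp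
    then have "emeasure lborel (norm -` A :: (real^2) set) = emeasure lebesgue (norm -` A :: (real^2) set)" by simp
    also have "\<dots> \<le> emeasure lebesgue (G n)" using sub G(1) by (intro emeasure_mono) auto
    also have "\<dots> = emeasure lebesgue (?E \<union> (G n - ?E))" using G(2)[of n] by (intro arg_cong[where f="emeasure lebesgue"]) auto
    also have "\<dots> \<le> emeasure lebesgue ?E + emeasure lebesgue (G n - ?E)"
      using null G(1) by (intro emeasure_subadditive) auto
    also have "\<dots> \<le> ennreal (1 / Suc n)" using null_setsD1[OF null] G(3)[of n] by (simp add: less_imp_le)
    finally show ?thesis .
  qed
  then have "emeasure lborel (norm -` A :: (real^2) set) = 0"
  proof -
    have "(\<lambda>n. ennreal (1 / Suc n)) \<longlonglongrightarrow> ennreal 0" by (intro tendsto_ennrealI lim_1_over_n[THEN LIMSEQ_Suc])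
    then have "emeasure lborel (norm -` A :: (real^2) set) \<le> ennreal 0"
      by (rule LIMSEQ_le_const) (use \<open>\<And>n. emeasure lborel (norm -` A :: (real^2) set) \<le> ennreal (1 / Suc n)\<close> in auto)
    then show ?thesis by simp
  qed
  then have "emeasure (distr lborel borel (norm :: real^2 \<Rightarrow> real)) A = 0"
    by (subst emeasure_distr) auto
  then have "(\<integral>\<^sup>+r. ennreal (2 * pi * r) * indicator A r \<partial>lborel) = 0"
    unfolding distr_norm_plane by (subst (asm) emeasure_density) auto
  then have "AE r in lborel. ennreal (2 * pi * r) * indicator A r = 0"
    by (subst (asm) nn_integral_0_iff_AE) auto
  then have "AE r in lborel. r \<notin> A"
  proof eventually_elim
    case (elim r)
    show ?case
    proof
      assume r: "r \<in> A"
      then have "0 < 2 * pi * r" by (simp add: A_def)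
      then have "ennreal (2 * pi * r) \<noteq> 0" by (simp only: ennreal_eq_0_iff not_le)
      with elim r show False by simp
    qed
  qed
  then have "A \<in> null_sets lborel"
    using A by (subst AE_iff_null_sets) auto
  then have "A \<in> null_sets lebesgue" by (rule null_sets_completionI)
  with BA show ?thesis by (rule null_sets_completion_subset)
qed

text \<open>Inner regularity covers the preimage by compact sets up to a negligible set. The norm
  images of the compact sets are compact, and the remaining radii have a negligible preimage.
  Measurability of a planar radial function thereby passes to its profile.\<close>

lemma sets_lebesgue_of_vimage_norm:
  assumes "norm -` A \<in> sets (lebesgue :: (real^2) measure)"
  shows "A \<inter> {0<..} \<in> sets lebesgue"
proof -
  obtain K C where K: "negligible K" and C: "\<And>n::nat. compact (C n)" and eq: "(norm -` A :: (real^2) set) = (\<Union>n. C n) \<union> K"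
    using lebesgue_regular_inner[OF assms] by blast
  let ?A = "\<Union>n. norm ` C n"
  let ?B = "(A - ?A) \<inter> {0<..}"
  have A: "?A \<in> sets borel"
    using C by (intro sets.countable_UN) (auto intro!: borel_compact compact_continuous_image continuous_intros)
  have AA: "?A \<subseteq> A" using eq by blast
  have "norm -` ?B \<subseteq> K" using eq by blast
  then have "norm -` ?B \<in> null_sets (lebesgue :: (real^2) measure)"
    using K negligible_subset by (auto simp: negligible_iff_null_sets)
  then have "?B \<in> null_sets lebesgue" by (intro null_sets_of_vimage_norm) auto
  then have "?B \<in> sets lebesgue" by auto
  moreover have "?A \<inter> {0<..} \<in> sets lebesgue" using A by auto
  ultimately have "(?A \<inter> {0<..}) \<union> ?B \<in> sets lebesgue" by (rule sets.Un[rotated])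
  also have "(?A \<inter> {0<..}) \<union> ?B = A \<inter> {0<..}" using AA by auto
  finally show ?thesis .
qed

lemma null_set_vimage_norm:
  assumes "N \<in> null_sets lborel"
  shows "AE x in lborel. norm (x :: real^2) \<notin> N"
proof -
  have [measurable]: "N \<in> sets borel" using assms by auto
  have "AE r in lborel. r \<notin> N" using assms by (rule AE_not_in)
  then have "AE r in lborel. ennreal (2 * pi * r) * indicator N r = 0"
    by eventually_elim auto
  then have "(\<integral>\<^sup>+r. ennreal (2 * pi * r) * indicator N r \<partial>lborel) = 0"
    by (subst nn_integral_0_iff_AE) auto
  then have "emeasure (density lborel (\<lambda>r. ennreal (2 * pi * r))) N = 0"
    by (subst emeasure_density) auto
  then have "N \<in> null_sets (distr lborel borel (norm :: real^2 \<Rightarrow> real))"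
    unfolding distr_norm_plane by auto
  then have "AE r in distr lborel borel (norm :: real^2 \<Rightarrow> real). r \<notin> N" by (rule AE_not_in)
  then show ?thesis by (rule AE_distrD[rotated]) auto
qed

lemma radial_borel_version:
  fixes u :: "real \<Rightarrow> real"
  assumes "(\<lambda>x::real^2. u (norm x)) \<in> borel_measurable lebesgue"
  obtains u' where "u' \<in> borel_measurable borel" "AE r in lborel. 0 < r \<longrightarrow> u r = u' r"
    "AE x in lborel. u (norm (x::real^2)) = u' (norm x)"
proof -
  \<comment> \<open>Nonpositive arguments are cut off: negative ones are never seen by the norm, and
    0 only at one point of the plane.\<close>
  let ?u = "\<lambda>r. if 0 < r then u r else 0"
  have "?u \<in> borel_measurable lebesgue"
  proof (rule measurableI)
    fix S :: "real set" assume S: "S \<in> sets borel"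
    have "(\<lambda>x::real^2. u (norm x)) -` S \<inter> space lebesgue \<in> sets lebesgue"
      using measurable_sets[OF assms S] .
    then have "norm -` (u -` S) \<in> sets (lebesgue :: (real^2) measure)"
      by (simp add: vimage_def)
    then have "u -` S \<inter> {0<..} \<in> sets lebesgue" by (rule sets_lebesgue_of_vimage_norm)
    moreover have "(if 0 \<in> S then {..0} else {}) \<in> sets (lebesgue :: real measure)" by auto
    ultimately have "(u -` S \<inter> {0<..}) \<union> (if 0 \<in> S then {..0} else {}) \<in> sets lebesgue" by (rule sets.Un)
    also have "(u -` S \<inter> {0<..}) \<union> (if 0 \<in> S then {..0} else {}) = ?u -` S \<inter> space lebesgue"
      by (auto split: if_splits)
    finally show "?u -` S \<inter> space lebesgue \<in> sets lebesgue" .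
  qed auto
  then obtain u' where u': "u' \<in> borel_measurable lborel" "AE r in lborel. ?u r = u' r"
    using completion_ex_borel_measurable_real by blast
  from u'(2) obtain N where N: "N \<in> null_sets lborel" "{r. ?u r \<noteq> u' r} \<subseteq> N"
    by (auto elim!: AE_E simp: null_sets_def)
  have "AE x in lborel. u (norm (x::real^2)) = u' (norm x)"
    using null_set_vimage_norm[OF N(1)] AE_lborel_singleton[of "0::real^2"]
  proof eventually_elim
    case (elim x)
    then have "?u (norm x) = u' (norm x)" using N(2) by blast
    then show ?case using elim by simp
  qed
  moreover have "AE r in lborel. 0 < r \<longrightarrow> u r = u' r" using u'(2) by eventually_elim auto
  ultimately show ?thesis using u'(1) that by simp
qed

lemma nn_integral_radial:
  assumes [measurable]: "k \<in> borel_measurable borel"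
  shows "(\<integral>\<^sup>+x. k (norm (x::real^2)) \<partial>lborel) = (\<integral>\<^sup>+r. ennreal (2 * pi * r) * k r \<partial>lborel)"
proof -
  have "(\<integral>\<^sup>+x. k (norm (x::real^2)) \<partial>lborel) = (\<integral>\<^sup>+r. k r \<partial>distr lborel borel (norm :: real^2 \<Rightarrow> real))"
    by (subst nn_integral_distr) auto
  also have "\<dots> = (\<integral>\<^sup>+r. ennreal (2 * pi * r) * k r \<partial>lborel)"
    unfolding distr_norm_plane by (subst nn_integral_density) auto
  finally show ?thesis .
qed

lemma integral_radial:
  fixes k :: "real \<Rightarrow> real"
  assumes [measurable]: "k \<in> borel_measurable borel"
  shows "(LINT x|lborel. k (norm (x::real^2))) = (LINT r|lborel. indicator {0<..} r * (2 * pi * r * k r))"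
proof -
  have mx: "max 0 (2 * pi * r) = indicator {0<..} r * (2 * pi * r)" for r
    by (cases "0 < r") (auto simp: mult_nonneg_nonpos)
  have "(LINT x|lborel. k (norm (x::real^2))) = (LINT r|distr lborel borel (norm :: real^2 \<Rightarrow> real). k r)"
    by (subst integral_distr) auto
  also have "\<dots> = (LINT r|density lborel (\<lambda>r. ennreal (max 0 (2 * pi * r))). k r)"
    unfolding distr_norm_plane by (simp add: ennreal_max_0)
  also have "\<dots> = (LINT r|lborel. max 0 (2 * pi * r) * k r)"
    by (subst integral_density) auto
  also have "\<dots> = (LINT r|lborel. indicator {0<..} r * (2 * pi * r * k r))"
    unfolding mx by (simp add: mult_ac)
  finally show ?thesis .
qed

lemma radial_square_integrable:
  fixes u :: "real \<Rightarrow> real"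
  assumes m: "(\<lambda>x::real^2. u (norm x)) \<in> borel_measurable lebesgue" and i: "integrable lebesgue (\<lambda>x::real^2. (u (norm x))\<^sup>2)"
  shows "(\<lambda>r. (u r)\<^sup>2 * r) absolutely_integrable_on {0<..}"
proof -
  obtain u' where u'[measurable]: "u' \<in> borel_measurable borel" and ae: "AE r in lborel. 0 < r \<longrightarrow> u r = u' r"
    "AE x in lborel. u (norm (x::real^2)) = u' (norm x)" using radial_borel_version[OF m] .
  have "integrable lebesgue (\<lambda>x::real^2. (u' (norm x))\<^sup>2)"
    using AE_completion[OF ae(2)] i
    by (subst integrable_cong_AE[where g="\<lambda>x. (u (norm x))\<^sup>2"]) (auto intro!: measurable_completion elim!: eventually_mono)
  then have "integrable lborel (\<lambda>x::real^2. (u' (norm x))\<^sup>2)" by (simp add: integrable_completion)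
  then have "(\<integral>\<^sup>+x. ennreal ((u' (norm (x::real^2)))\<^sup>2) \<partial>lborel) < \<infinity>"
    by (simp add: integrable_iff_bounded)
  then have fin: "(\<integral>\<^sup>+r. ennreal (2 * pi * r) * ennreal ((u' r)\<^sup>2) \<partial>lborel) < \<infinity>"
    by (subst (asm) nn_integral_radial) auto
  have "integrable lborel (\<lambda>r. indicator {0<..} r * (2 * pi * ((u' r)\<^sup>2 * r)))"
  proof (rule integrableI_bounded)
    have "(\<integral>\<^sup>+r. ennreal (norm (indicator {0<..} r * (2 * pi * ((u' r)\<^sup>2 * r)))) \<partial>lborel) =
        (\<integral>\<^sup>+r. ennreal (2 * pi * r) * ennreal ((u' r)\<^sup>2) \<partial>lborel)"
      by (intro nn_integral_cong)
        (auto simp: indicator_def ennreal_mult''[symmetric] ennreal_neg mult_nonneg_nonpos abs_mult mult_ac intro!: ennreal_neg mult_nonpos_nonneg)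
    then show "(\<integral>\<^sup>+r. ennreal (norm (indicator {0<..} r * (2 * pi * ((u' r)\<^sup>2 * r)))) \<partial>lborel) < \<infinity>" using fin by simp
  qed auto
  then have "integrable lborel (\<lambda>r. (1 / (2*pi)) * (indicator {0<..} r * (2 * pi * ((u' r)\<^sup>2 * r))))" by (rule integrable_mult_right)
  then have I': "integrable lebesgue (\<lambda>r. indicator {0<..} r * ((u' r)\<^sup>2 * r))" by (simp add: integrable_completion)
  have "(\<lambda>r. (u' r)\<^sup>2 * r) absolutely_integrable_on {0<..}" using I' by (simp add: set_integrable_def)
  then show ?thesis
    by (rule absolutely_integrable_cong_AE) (use AE_completion[OF ae(1)] in \<open>eventually_elim, auto\<close>)
qed

lemma ennreal_two_mult_le_sum_squares:
  fixes a b :: real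
  assumes "0 \<le> a" "0 \<le> b" shows "ennreal a * ennreal b + ennreal a * ennreal b \<le> ennreal (a\<^sup>2) + ennreal (b\<^sup>2)"
  using assms sum_squares_bound[of a b]
  by (simp add: ennreal_mult''[symmetric] ennreal_plus[symmetric] del: ennreal_plus)

text \<open>
  Averaging over circles: the push-forward of the measure with density \<open>h\<close> under the norm has a
  density by Radon--Nikodym, and testing it against its own truncations gives the \<open>L\<^sup>2\<close> bound.
\<close>

lemma circle_average:
  fixes h :: "real^2 \<Rightarrow> real"
  assumes h[measurable]: "h \<in> borel_measurable borel" and h0: "\<And>x. 0 \<le> h x" and h2: "(\<integral>\<^sup>+x. ennreal ((h x)\<^sup>2) \<partial>lborel) < \<infinity>"
  obtains v :: "real \<Rightarrow> real" where "v \<in> borel_measurable borel" "\<forall>r. 0 \<le> v r" "\<forall>r\<le>0. v r = 0"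
   "density lborel (\<lambda>r. ennreal (2 * pi * r * v r)) = distr (density lborel (\<lambda>x. ennreal (h x))) borel norm"
   "(\<integral>\<^sup>+r. ennreal (2 * pi * r) * ennreal ((v r)\<^sup>2) \<partial>lborel) < \<infinity>"
proof -
  let ?\<mu> = "distr (density lborel (\<lambda>x. ennreal (h x))) borel (norm :: real^2 \<Rightarrow> real)"
  define J where "J = (\<integral>\<^sup>+x. ennreal ((h x)\<^sup>2) \<partial>lborel)"
  have em: "emeasure ?\<mu> A = (\<integral>\<^sup>+x. ennreal (h x) * indicator A (norm x) \<partial>lborel)" if [measurable]: "A \<in> sets borel" for A
    using measurable_sets[of "norm :: real^2 \<Rightarrow> real" borel borel A]
    by (subst emeasure_distr, simp_all, subst emeasure_density) (auto intro!: nn_integral_cong simp: indicator_def)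
  have null: "emeasure ?\<mu> A = 0" if A: "A \<in> sets borel" and ae: "AE x in lborel. norm (x::real^2) \<notin> A" for A
    unfolding em[OF A] by (subst nn_integral_0_iff_AE) (use ae A in \<open>auto elim!: eventually_mono\<close>)
  have ac: "absolutely_continuous lborel ?\<mu>"
    unfolding absolutely_continuous_def
  proof
    fix N :: "real set" assume N: "N \<in> null_sets lborel"
    then show "N \<in> null_sets ?\<mu>"
      using null[of N] null_set_vimage_norm[OF N] by (auto simp: null_sets_def)
  qed
  obtain w where w[measurable]: "w \<in> borel_measurable borel" and dw: "density lborel w = ?\<mu>"
    using sigma_finite_measure.Radon_Nikodym[OF sigma_finite_lborel ac] by auto
  have wint: "(\<integral>\<^sup>+r. w r * k r \<partial>lborel) = (\<integral>\<^sup>+x. ennreal (h x) * k (norm x) \<partial>lborel)" if [measurable]: "k \<in> borel_measurable borel" for k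
  proof -
    have "(\<integral>\<^sup>+r. w r * k r \<partial>lborel) = (\<integral>\<^sup>+r. k r \<partial>density lborel w)"
      by (subst nn_integral_density) auto
    also have "\<dots> = (\<integral>\<^sup>+x. ennreal (h x) * k (norm x) \<partial>lborel)"
      unfolding dw by (simp add: nn_integral_distr nn_integral_density)
    finally show ?thesis .
  qed
  have wfin: "AE r in lborel. w r \<noteq> \<infinity>"
  proof -
    have "AE r in lborel. \<forall>n::nat. w r * indicator {..real n} r \<noteq> \<infinity>"
    proof (subst AE_all_countable, intro allI nn_integral_PInf_AE)
      fix n :: nat
      show "(\<lambda>r. w r * indicator {..real n} r) \<in> borel_measurable lborel" by measurable
      have "(\<integral>\<^sup>+r. w r * indicator {..real n} r \<partial>lborel) = (\<integral>\<^sup>+x. ennreal (h x) * indicator {..real n} (norm x) \<partial>lborel)"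
        by (rule wint) measurable
      also have "\<dots> \<le> (\<integral>\<^sup>+x. indicator (cball 0 (real n)) x + ennreal ((h x)\<^sup>2) \<partial>lborel)"
      proof (intro nn_integral_mono)
        fix x :: "real^2"
        have "h x \<le> 1 + (h x)\<^sup>2" using sum_squares_bound[of 1 "h x"] h0[of x] by (simp add: algebra_simps)
        then have "ennreal (h x) \<le> 1 + ennreal ((h x)\<^sup>2)"
          by (metis ennreal_1 ennreal_leI ennreal_plus zero_le_one zero_le_power2)
        then show "ennreal (h x) * indicator {..real n} (norm x) \<le> indicator (cball 0 (real n)) x + ennreal ((h x)\<^sup>2)"
          by (auto simp: indicator_def)
      qed
      also have "\<dots> = emeasure lborel (cball (0::real^2) (real n)) + J"
        unfolding J_def by (subst nn_integral_add) (auto intro!: borel_measurable_indicator)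
      also have "\<dots> < \<infinity>" using h2 by (simp add: J_def emeasure_cball ennreal_mult_less_top)
      finally show "(\<integral>\<^sup>+r. w r * indicator {..real n} r \<partial>lborel) \<noteq> \<infinity>" by simp
    qed
    then show ?thesis
    proof eventually_elim
      case (elim r)
      obtain n :: nat where "r \<le> real n" using real_arch_simple by blast
      with elim[rule_format, of n] show ?case by simp
    qed
  qed
  have w0: "AE r in lborel. r \<le> 0 \<longrightarrow> w r = 0"
  proof -
    have "(\<integral>\<^sup>+r. w r * indicator {..0} r \<partial>lborel) = (\<integral>\<^sup>+x. ennreal (h x) * indicator {..0} (norm x) \<partial>lborel)"
      by (rule wint) measurable
    also have "\<dots> = 0"
      using AE_lborel_singleton[of "0::real^2"] by (subst nn_integral_0_iff_AE) (auto elim!: eventually_mono)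
    finally have "AE r in lborel. w r * indicator {..0} r = 0"
      by (subst (asm) nn_integral_0_iff_AE) auto
    then show ?thesis by eventually_elim (auto simp: indicator_def split: if_splits)
  qed
  \<comment> \<open>Dividing by the circumference makes \<open>v r\<close> the average of
    \<open>h\<close> over the circle of radius \<open>r\<close>.\<close>
  define v where "v r = (if r \<le> 0 then 0 else enn2real (w r) / (2 * pi * r))" for r
  have v[measurable]: "v \<in> borel_measurable borel" unfolding v_def by measurable
  have v0: "0 \<le> v r" for r by (simp add: v_def)
  have wv: "AE r in lborel. w r = ennreal (2 * pi * r * v r)"
    using wfin w0 by eventually_elim (auto simp: v_def less_top ennreal_enn2real_if)
  have dv: "density lborel (\<lambda>r. ennreal (2 * pi * r * v r)) = ?\<mu>"
    unfolding dw[symmetric] by (rule density_cong) (use wv in \<open>auto elim!: eventually_mono\<close>)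
  have vint: "(\<integral>\<^sup>+r. ennreal (2 * pi * r) * (ennreal (v r) * k r) \<partial>lborel) = (\<integral>\<^sup>+x. ennreal (h x) * k (norm x) \<partial>lborel)" if [measurable]: "k \<in> borel_measurable borel" for k
  proof -
    have "(\<integral>\<^sup>+r. ennreal (2 * pi * r) * (ennreal (v r) * k r) \<partial>lborel) = (\<integral>\<^sup>+r. w r * k r \<partial>lborel)"
    proof (rule nn_integral_cong_AE)
      show "AE r in lborel. ennreal (2 * pi * r) * (ennreal (v r) * k r) = w r * k r"
        using wv
      proof eventually_elim
        case (elim r)
        show ?case by (subst elim, subst ennreal_mult''[OF v0], simp only: mult.assoc)
      qed
    qed
    then show ?thesis using wint[OF that] by simp
  qed
  \<comment> \<open>Truncating both height and radius makes \<open>I n\<close> finite, so that it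
    can be cancelled in \<open>I n + I n <= J + I n\<close>; cancellation in \<open>ennreal\<close>
    fails at infinity.\<close>
  define k where "k n r = indicator {..real n} r * min (v r) (real n)" for n :: nat and r
  have k0: "0 \<le> k n r" "k n r \<le> v r" for n r using v0[of r] by (auto simp: k_def indicator_def)
  have [measurable]: "k n \<in> borel_measurable borel" for n unfolding k_def by measurable
  define I where "I n = (\<integral>\<^sup>+r. ennreal (2 * pi * r) * ennreal ((k n r)\<^sup>2) \<partial>lborel)" for n
  have IJ: "I n \<le> J" for n
  proof -
    let ?T = "\<integral>\<^sup>+x. ennreal (h x) * ennreal (k n (norm x)) \<partial>lborel"
    have "I n \<le> (\<integral>\<^sup>+r. ennreal (2 * pi * r) * (ennreal (v r) * ennreal (k n r)) \<partial>lborel)"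
      unfolding I_def
    proof (intro nn_integral_mono mult_left_mono)
      fix r
      have "(k n r)\<^sup>2 \<le> v r * k n r" using mult_right_mono[OF k0(2,1)] by (simp add: power2_eq_square)
      then show "ennreal ((k n r)\<^sup>2) \<le> ennreal (v r) * ennreal (k n r)"
        unfolding ennreal_mult[OF v0 k0(1), symmetric] by (rule ennreal_leI)
    qed auto
    also have "\<dots> = ?T" by (rule vint) measurable
    finally have 1: "I n \<le> ?T" .
    have "?T + ?T = (\<integral>\<^sup>+x. ennreal (h x) * ennreal (k n (norm x)) + ennreal (h x) * ennreal (k n (norm x)) \<partial>lborel)"
      by (subst nn_integral_add) auto
    also have "\<dots> \<le> (\<integral>\<^sup>+x. ennreal ((h x)\<^sup>2) + ennreal ((k n (norm x))\<^sup>2) \<partial>lborel)"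
      by (intro nn_integral_mono ennreal_two_mult_le_sum_squares h0 k0)
    also have "\<dots> = J + (\<integral>\<^sup>+x. ennreal ((k n (norm (x::real^2)))\<^sup>2) \<partial>lborel)"
      unfolding J_def by (subst nn_integral_add) auto
    also have "(\<integral>\<^sup>+x. ennreal ((k n (norm (x::real^2)))\<^sup>2) \<partial>lborel) = I n"
      unfolding I_def by (rule nn_integral_radial) measurable
    finally have 2: "?T + ?T \<le> J + I n" .
    have "I n + I n \<le> J + I n" using add_mono[OF 1 1] 2 by (rule order_trans)
    moreover have "I n < \<infinity>"
    proof -
      have "I n \<le> (\<integral>\<^sup>+r. ennreal (2 * pi * r) * (ennreal ((real n)\<^sup>2) * indicator {..real n} r) \<partial>lborel)"
        unfolding I_def
      proof (intro nn_integral_mono mult_left_mono)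
        fix r
        have "(k n r)\<^sup>2 \<le> (real n)\<^sup>2 * indicator {..real n} r"
          using v0[of r] by (auto simp: k_def indicator_def intro!: power_mono)
        then show "ennreal ((k n r)\<^sup>2) \<le> ennreal ((real n)\<^sup>2) * indicator {..real n} r"
          by (auto simp: indicator_def k_def intro!: ennreal_leI split: if_splits)
      qed auto
      also have "\<dots> = (\<integral>\<^sup>+x. ennreal ((real n)\<^sup>2) * indicator {..real n} (norm (x::real^2)) \<partial>lborel)"
        by (rule nn_integral_radial[symmetric]) measurable
      also have "\<dots> = ennreal ((real n)\<^sup>2) * (\<integral>\<^sup>+x. indicator {..real n} (norm (x::real^2)) \<partial>lborel)"
        by (rule nn_integral_cmult) measurable
      also have "(\<integral>\<^sup>+x. indicator {..real n} (norm (x::real^2)) \<partial>lborel) = (\<integral>\<^sup>+x. indicator (cball 0 (real n)) (x::real^2) \<partial>lborel)"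
        by (intro nn_integral_cong) (auto simp: indicator_def)
      also have "\<dots> = emeasure lborel (cball (0::real^2) (real n))" by simp
      also have "ennreal ((real n)\<^sup>2) * emeasure lborel (cball (0::real^2) (real n)) < \<infinity>"
        by (simp add: emeasure_cball ennreal_mult_less_top)
      finally show ?thesis .
    qed
    ultimately show ?thesis by (auto simp: ennreal_add_left_cancel_le add.commute)
  qed
  have "(\<integral>\<^sup>+r. ennreal (2 * pi * r) * ennreal ((v r)\<^sup>2) \<partial>lborel) \<le> (\<integral>\<^sup>+r. liminf (\<lambda>n. ennreal (2 * pi * r) * ennreal ((k n r)\<^sup>2)) \<partial>lborel)"
  proof (intro nn_integral_mono)
    fix r
    obtain N :: nat where N: "max r (v r) \<le> real N" using real_arch_simple by blast
    have "(\<lambda>n. ennreal (2 * pi * r) * ennreal ((k n r)\<^sup>2)) \<longlonglongrightarrow> ennreal (2 * pi * r) * ennreal ((v r)\<^sup>2)"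
    proof (rule tendsto_eventually, rule eventually_sequentiallyI[of N])
      fix n assume "N \<le> n"
      then have "max r (v r) \<le> real n" using N by linarith
      then show "ennreal (2 * pi * r) * ennreal ((k n r)\<^sup>2) = ennreal (2 * pi * r) * ennreal ((v r)\<^sup>2)"
        by (simp add: k_def)
    qed
    then show "ennreal (2 * pi * r) * ennreal ((v r)\<^sup>2) \<le> liminf (\<lambda>n. ennreal (2 * pi * r) * ennreal ((k n r)\<^sup>2))"
      by (subst lim_imp_Liminf[OF sequentially_bot]) auto
  qed
  also have "\<dots> \<le> liminf I"
    unfolding I_def by (rule nn_integral_liminf) measurable
  also have "\<dots> \<le> liminf (\<lambda>n. J)" by (intro Liminf_mono) (auto simp: IJ)
  also have "\<dots> = J" by (simp add: Liminf_const)
  also have "\<dots> < \<infinity>" using h2 by (simp add: J_def)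
  finally have "(\<integral>\<^sup>+r. ennreal (2 * pi * r) * ennreal ((v r)\<^sup>2) \<partial>lborel) < \<infinity>" .
  moreover have "v r = 0" if "r \<le> 0" for r using that by (simp add: v_def)
  ultimately show ?thesis using that[OF v _ _ dv] v0 by blast
qed

lemma circle_average_integral:
  fixes h :: "real^2 \<Rightarrow> real"
  assumes [measurable]: "h \<in> borel_measurable borel" and h0: "\<And>x. 0 \<le> h x"
   and [measurable]: "v \<in> borel_measurable borel" and v0: "\<And>r. 0 \<le> v r"  "\<And>r. r \<le> 0 \<Longrightarrow> v r = 0"
   and d: "density lborel (\<lambda>r. ennreal (2 * pi * r * v r)) = distr (density lborel (\<lambda>x. ennreal (h x))) borel norm"
   and [measurable]: "k \<in> borel_measurable borel"
 shows "integrable lborel (\<lambda>x. h x * k (norm x)) \<longleftrightarrow> integrable lborel (\<lambda>r. 2 * pi * r * v r * k r)"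
   and "(LINT x|lborel. h x * k (norm x)) = (LINT r|lborel. 2 * pi * r * v r * k r)"
proof -
  have nn: "0 \<le> 2 * pi * r * v r" for r using v0[of r] by (cases "r \<le> 0") auto
  have "integrable lborel (\<lambda>r. 2 * pi * r * v r * k r) \<longleftrightarrow> integrable (density lborel (\<lambda>r. ennreal (2 * pi * r * v r))) k"
    using nn by (subst integrable_density) auto
  also have "\<dots> \<longleftrightarrow> integrable lborel (\<lambda>x. h x * k (norm x))"
    unfolding d using h0 by (simp add: integrable_distr_eq integrable_density)
  finally show "integrable lborel (\<lambda>x. h x * k (norm x)) \<longleftrightarrow> integrable lborel (\<lambda>r. 2 * pi * r * v r * k r)" ..
  have "(LINT r|lborel. 2 * pi * r * v r * k r) = integral\<^sup>L (density lborel (\<lambda>r. ennreal (2 * pi * r * v r))) k"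
    using nn by (subst integral_density) auto
  also have "\<dots> = (LINT x|lborel. h x * k (norm x))"
    unfolding d using h0 by (simp add: integral_distr integral_density)
  finally show "(LINT x|lborel. h x * k (norm x)) = (LINT r|lborel. 2 * pi * r * v r * k r)" ..
qed

section \<open>Weak derivatives of radial Sobolev functions\<close>

lemma test_function_halfline:
  fixes \<eta> :: "real \<Rightarrow> real"
  assumes "test_function {0<..} \<eta>"
  obtains \<eta>' a b where "0 < a" "a \<le> b" "\<And>r. (\<eta> has_real_derivative \<eta>' r) (at r)" "continuous_on UNIV \<eta>'"
    "\<And>r. r \<notin> {a..b} \<Longrightarrow> \<eta> r = 0" "\<And>r. r \<notin> {a..b} \<Longrightarrow> \<eta>' r = 0"
    "\<And>r. frechet_derivative \<eta> (at r) 1 = \<eta>' r"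
proof -
  define \<eta>' where "\<eta>' r = frechet_derivative \<eta> (at r) 1" for r
  define K where "K = closure {r. \<eta> r \<noteq> 0}"
  have K: "compact K" "K \<subseteq> {0<..}" using assms by (auto simp: test_function_def K_def)
  have diff: "\<eta> differentiable (at r)" for r using assms by (auto simp: test_function_def)
  have D: "(\<eta> has_real_derivative \<eta>' r) (at r)" for r
  proof -
    have F: "(\<eta> has_derivative frechet_derivative \<eta> (at r)) (at r)" using diff frechet_derivative_works by blast
    interpret linear "frechet_derivative \<eta> (at r)" using F has_derivative_linear by blast
    have "frechet_derivative \<eta> (at r) = (*) (\<eta>' r)"
    proof (rule ext)
      show "frechet_derivative \<eta> (at r) h = \<eta>' r * h" for h
        using scaleR[of h 1] unfolding \<eta>'_def by (simp add: mult.commute[of h])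
    qed
    with F show ?thesis by (simp add: has_field_derivative_def)
  qed
  have c: "continuous_on UNIV \<eta>'" using assms by (auto simp: test_function_def \<eta>'_def[abs_def])
  obtain a b where ab: "0 < a" "a \<le> b" "K \<subseteq> {a..b}"
  proof (cases "K = {}")
    case True then show ?thesis using that[of 1 1] by (metis empty_subsetI order_refl zero_less_one)
  next
    case False
    obtain s where s: "s \<in> K" "\<forall>t\<in>K. s \<le> t" using compact_attains_inf[OF K(1) False] by blast
    obtain t where t: "t \<in> K" "\<forall>x\<in>K. x \<le> t" using compact_attains_sup[OF K(1) False] by blast
    have "0 < s" "s \<le> t" "K \<subseteq> {s..t}" using s t K(2) by auto
    then show ?thesis by (rule that)
  qed
  have z: "\<eta> r = 0" if "r \<notin> K" for r using that closure_subset[of "{r. \<eta> r \<noteq> 0}"] by (auto simp: K_def)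
  have z': "\<eta>' r = 0" if r: "r \<notin> K" for r
  proof -
    have "((\<lambda>_. 0) has_real_derivative \<eta>' r) (at r)"
      by (rule has_field_derivative_transform_within_open[OF D, where S="- K"]) (use r z compact_imp_closed[OF K(1)] in auto)
    then show ?thesis by (rule DERIV_unique[OF _ DERIV_const])
  qed
  have "\<eta> r = 0" "\<eta>' r = 0" if "r \<notin> {a..b}" for r using z[of r] z'[of r] ab(3) that by blast+
  then show ?thesis by (intro that[OF ab(1,2) D c]) (auto simp: \<eta>'_def)
qed

lemma integrable_mult_test:
  fixes U P :: "'a::euclidean_space \<Rightarrow> real"
  assumes U: "U absolutely_integrable_on (cball 0 R)" and P: "continuous_on UNIV P" and out: "\<And>x. norm x > R \<Longrightarrow> P x = 0"
  shows "integrable lebesgue (\<lambda>x. U x * P x)"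
proof -
  have c: "continuous_on (cball 0 R) P" using P continuous_on_subset by blast
  have "(\<lambda>x. P x * U x) absolutely_integrable_on (cball 0 R)"
    using continuous_imp_measurable_on_sets_lebesgue[OF c] compact_imp_bounded[OF compact_continuous_image[OF c]] U
    by (intro absolutely_integrable_bounded_measurable_product[OF bilinear_times]) auto
  then have "integrable lebesgue (\<lambda>x. indicator (cball 0 R) x *\<^sub>R (P x * U x))" by (simp add: set_integrable_def)
  also have "(\<lambda>x. indicator (cball 0 R) x *\<^sub>R (P x * U x)) = (\<lambda>x. U x * P x)"
    using out by (auto simp: indicator_def fun_eq_iff)
  finally show ?thesis .
qed

text \<open>\<open>\<Phi>\<close> is the component along \<open>i\<close> of the field obtained by
  multiplying \<open>x / (norm x)\<^sup>2\<close> by \<open>\<eta> (norm x)\<close>. The support of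
  \<open>\<eta>\<close> keeps away from 0, so the singularity disappears and the components are
  legitimate test functions. The field is chosen for its planar divergence, which contains
  \<open>\<eta>'\<close> but not \<open>\<eta>\<close>.\<close>

lemma radial_vector_field:
  fixes \<eta> \<eta>' :: "real \<Rightarrow> real" and i :: "'a::euclidean_space"
  assumes a: "0 < a" and D: "\<And>r. (\<eta> has_real_derivative \<eta>' r) (at r)" and c: "continuous_on UNIV \<eta>'"
    and supp: "\<forall>r. r \<notin> {a..b} \<longrightarrow> \<eta> r = 0 \<and> \<eta>' r = 0"
  defines "\<Phi> \<equiv> \<lambda>x. \<eta> (norm x) * (x \<bullet> i) / (norm x)\<^sup>2"
    and "P \<equiv> \<lambda>x h. \<eta>' (norm x) * (x \<bullet> h) * (x \<bullet> i) / (norm x)^3 + \<eta> (norm x) * ((h \<bullet> i) / (norm x)\<^sup>2 - 2 * (x \<bullet> i) * (x \<bullet> h) / (norm x)^4)"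
  shows "(\<Phi> has_derivative P x) (at x)" "continuous_on UNIV \<Phi>" "continuous_on UNIV (\<lambda>x. P x h)" "test_function UNIV \<Phi>"
    "frechet_derivative \<Phi> (at x) = P x"
proof -
  have z: "\<eta> r = 0" and z': "\<eta>' r = 0" if "r \<notin> {a..b}" for r using supp that by auto
  have z2: "\<eta> (norm x) = 0" "\<eta>' (norm x) = 0" if "x \<in> ball 0 a" for x :: 'a using that z z' by auto
  show D: "(\<Phi> has_derivative P x) (at x)" for x
  proof (cases "x = 0")
    case True
    have "((\<lambda>_. 0) has_derivative P x) (at x)"
      using z2[of x] a True by (simp add: P_def)
    then show ?thesis
      by (rule has_derivative_transform_within_open[where s="ball 0 a"]) (use True a z2 in \<open>auto simp: \<Phi>_def\<close>)
  next
    case False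
    have n: "(norm has_derivative (\<lambda>h. (x \<bullet> h) / norm x)) (at x)"
      using has_derivative_norm[OF False] by (simp add: sgn_div_norm inner_commute divide_inverse mult.commute)
    have e: "((\<lambda>y. \<eta> (norm y)) has_derivative (\<lambda>h. \<eta>' (norm x) * ((x \<bullet> h) / norm x))) (at x)"
      using has_derivative_compose[OF n D[of "norm x", unfolded has_field_derivative_def]] by simp
    show ?thesis
      unfolding \<Phi>_def P_def
      by (rule has_derivative_eq_rhs, (rule derivative_intros e n | simp add: False)+)
         (use False in \<open>auto simp: fun_eq_iff field_simps power2_eq_square power3_eq_cube power4_eq_xxxx\<close>)
  qed
  show "continuous_on UNIV \<Phi>"
    using D by (meson continuous_at_imp_continuous_on has_derivative_continuous)
  have c\<eta>: "continuous_on UNIV \<eta>" using assms(2) by (meson DERIV_isCont continuous_at_imp_continuous_on)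
  show C: "continuous_on UNIV (\<lambda>x. P x h)" for h
  proof -
    have "continuous_on (- {0}) (\<lambda>x. P x h)"
      unfolding P_def by (intro continuous_intros continuous_on_compose2[OF c] continuous_on_compose2[OF c\<eta>]) auto
    moreover have "continuous_on (ball 0 a) (\<lambda>x. P x h)"
      by (rule continuous_on_eq[OF continuous_on_const[of _ 0]]) (use z2 in \<open>auto simp: P_def\<close>)
    ultimately have "continuous_on (- {0} \<union> ball 0 a) (\<lambda>x. P x h)"
      by (intro continuous_on_open_Un) auto
    moreover have "- {0} \<union> ball (0::'a) a = UNIV" using a by auto
    ultimately show ?thesis by simp
  qed
  show F: "frechet_derivative \<Phi> (at x) = P x" for x
    using frechet_derivative_at[OF D] by simp
  have "{x. \<Phi> x \<noteq> 0} \<subseteq> cball 0 b"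
  proof
    fix x assume "x \<in> {x. \<Phi> x \<noteq> 0}"
    then have "\<eta> (norm x) \<noteq> 0" by (auto simp: \<Phi>_def)
    then have "norm x \<in> {a..b}" using z by blast
    then show "x \<in> cball 0 b" by simp
  qed
  then have "bounded {x. \<Phi> x \<noteq> 0}" using bounded_subset bounded_cball by blast
  then have "compact (closure {x. \<Phi> x \<noteq> 0})" by (simp add: compact_closure)
  then show "test_function UNIV \<Phi>"
    unfolding test_function_def using D C F by (auto simp: differentiable_def)
qed

lemma weighted_square_integrable_imp_locally_integrable:
  fixes f :: "real \<Rightarrow> real"
  assumes "(\<lambda>r. (f r)\<^sup>2 * r) absolutely_integrable_on {0<..}" and m: "f \<in> borel_measurable (lebesgue_on {0<..})"
  shows "locally_integrable_on f {0<..}"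
  unfolding locally_integrable_on_def
proof (intro allI impI)
  fix K :: "real set" assume K: "compact K" "K \<subseteq> {0<..}"
  have Kl: "K \<in> sets lebesgue" using K(1) by (simp add: borel_compact)
  show "f absolutely_integrable_on K"
  proof (cases "K = {}")
    case False
    obtain a where a: "a \<in> K" "\<forall>t\<in>K. a \<le> t" using compact_attains_inf[OF K(1) False] by blast
    have a0: "a > 0" using a K(2) by auto
    show ?thesis
    proof (rule measurable_bounded_by_integrable_imp_absolutely_integrable[where g="\<lambda>r. 1 + (1/a) * ((f r)\<^sup>2 * r)"])
      show "f \<in> borel_measurable (lebesgue_on K)" by (rule measurable_restrict_mono[OF m K(2)])
      show "K \<in> sets lebesgue" by fact
      have "(\<lambda>r. (f r)\<^sup>2 * r) absolutely_integrable_on K" by (rule set_integrable_subset[OF assms(1) Kl K(2)])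
      moreover have "(\<lambda>r. 1::real) absolutely_integrable_on K" using lmeasurable_compact[OF K(1)] by (simp add: set_integrable_def lmeasurable_iff_integrable)
      ultimately have "(\<lambda>r. 1 + (1/a) * ((f r)\<^sup>2 * r)) absolutely_integrable_on K"
        by (intro set_integral_add set_integrable_mult_right) auto
      then show "(\<lambda>r. 1 + (1/a) * ((f r)\<^sup>2 * r)) integrable_on K" using set_lebesgue_integral_eq_integral(1) by blast
      fix r assume r: "r \<in> K"
      have "\<bar>f r\<bar> \<le> 1 + (f r)\<^sup>2" using sum_squares_bound[of 1 "\<bar>f r\<bar>"] by simp
      also have "(f r)\<^sup>2 \<le> (1/a) * ((f r)\<^sup>2 * r)"
        using a a0 r mult_left_mono[of a r "(f r)\<^sup>2"] by (simp add: field_simps)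
      finally show "norm (f r) \<le> 1 + (1/a) * ((f r)\<^sup>2 * r)" by simp
    qed
  qed simp
qed

lemma sum_Basis_inner_self: "(\<Sum>i\<in>Basis. (x \<bullet> i) * (x \<bullet> i)) = (norm (x::'a::euclidean_space))\<^sup>2"
  by (simp add: euclidean_inner[symmetric] power2_norm_eq_inner)

text \<open>In two dimensions \<open>x / (norm x)\<^sup>2\<close> is divergence free away from 0:
  the trace contributes twice \<open>e / (norm x)\<^sup>2\<close>, cancelling the term from
  differentiating the denominator.\<close>

lemma radial_divergence:
  fixes x :: "real^2"
  shows "(\<Sum>i\<in>Basis. e' * (x \<bullet> i) * (x \<bullet> i) / (norm x)^3 + e * ((i \<bullet> i) / (norm x)\<^sup>2 - 2 * (x \<bullet> i) * (x \<bullet> i) / (norm x)^4)) = e' / norm x"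
proof (cases "x = 0")
  case False
  have "(\<Sum>i\<in>Basis. e' * (x \<bullet> i) * (x \<bullet> i) / (norm x)^3 + e * ((i \<bullet> i) / (norm x)\<^sup>2 - 2 * (x \<bullet> i) * (x \<bullet> i) / (norm x)^4))
    = (\<Sum>i\<in>Basis. (e' / (norm x)^3 - 2 * e / (norm x)^4) * ((x \<bullet> i) * (x \<bullet> i)) + e / (norm x)\<^sup>2)"
    by (intro sum.cong refl) (simp add: field_simps)
  also have "\<dots> = (e' / (norm x)^3 - 2 * e / (norm x)^4) * (norm x)\<^sup>2 + 2 * (e / (norm x)\<^sup>2)"
    unfolding sum.distrib sum_distrib_left[symmetric] sum_Basis_inner_self by simp
  also have "\<dots> = e' / norm x" using False by (simp add: field_simps power2_eq_square power3_eq_cube power4_eq_xxxx)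
  finally show ?thesis .
qed simp

lemma integral_radial_lebesgue:
  fixes u k :: "real \<Rightarrow> real"
  assumes m: "(\<lambda>x::real^2. u (norm x)) \<in> borel_measurable lebesgue" and [measurable]: "k \<in> borel_measurable borel"
  shows "(LINT x|lebesgue. u (norm (x::real^2)) * k (norm x)) = (LINT r:{0<..}|lebesgue. 2 * pi * r * (u r * k r))"
    and "u \<in> borel_measurable (lebesgue_on {0<..})"
proof -
  obtain u' where u'[measurable]: "u' \<in> borel_measurable borel" and ae: "AE r in lborel. 0 < r \<longrightarrow> u r = u' r"
    "AE x in lborel. u (norm (x::real^2)) = u' (norm x)" using radial_borel_version[OF m] .
  have mu: "u \<in> borel_measurable (lebesgue_on {0<..})"
  proof (rule measurableI)
    fix S :: "real set" assume S: "S \<in> sets borel"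
    have "norm -` (u -` S) \<in> sets (lebesgue :: (real^2) measure)"
      using measurable_sets[OF m S] by (simp add: vimage_def)
    then have "u -` S \<inter> {0<..} \<in> sets lebesgue" by (rule sets_lebesgue_of_vimage_norm)
    then show "u -` S \<inter> space (lebesgue_on {0<..}) \<in> sets (lebesgue_on {0<..})"
      by (simp add: sets_restrict_space_iff)
  qed auto
  show "u \<in> borel_measurable (lebesgue_on {0<..})" by fact
  have "(LINT x|lebesgue. u (norm (x::real^2)) * k (norm x)) = (LINT x|lebesgue. u' (norm (x::real^2)) * k (norm x))"
  proof (rule integral_cong_AE)
    show "AE x in lebesgue. u (norm (x::real^2)) * k (norm x) = u' (norm x) * k (norm x)"
      using AE_completion[OF ae(2)] by eventually_elim simp
    have "(\<lambda>x::real^2. k (norm x)) \<in> borel_measurable lebesgue" by (rule measurable_completion) measurable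
    with m show "(\<lambda>x::real^2. u (norm x) * k (norm x)) \<in> borel_measurable lebesgue" by (rule borel_measurable_times)
    show "(\<lambda>x::real^2. u' (norm x) * k (norm x)) \<in> borel_measurable lebesgue" by (rule measurable_completion) measurable
  qed
  also have "\<dots> = (LINT x|lborel. u' (norm (x::real^2)) * k (norm x))" by (subst integral_completion) auto
  also have "\<dots> = (LINT r|lborel. indicator {0<..} r * (2 * pi * r * (u' r * k r)))"
    by (rule integral_radial[of "\<lambda>r. u' r * k r"]) measurable
  also have "\<dots> = (LINT r|lebesgue. indicator {0<..} r * (2 * pi * r * (u' r * k r)))" by (subst integral_completion) auto
  also have "\<dots> = (LINT r|lebesgue. indicator {0<..} r * (2 * pi * r * (u r * k r)))"
  proof (rule integral_cong_AE)
    show "AE r in lebesgue. indicator {0<..} r * (2 * pi * r * (u' r * k r)) = indicator {0<..} r * (2 * pi * r * (u r * k r))"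
      using AE_completion[OF ae(1)] by eventually_elim (simp add: indicator_def)
    show "(\<lambda>r. indicator {0<..} r * (2 * pi * r * (u' r * k r))) \<in> borel_measurable lebesgue"
      by (rule measurable_completion) measurable
    have "(\<lambda>r. indicator {0<..} r *\<^sub>R u r) \<in> borel_measurable lebesgue"
      using mu by (subst (asm) borel_measurable_restrict_space_iff) auto
    moreover have "(\<lambda>r. 2 * pi * r * k r) \<in> borel_measurable lebesgue" by (rule measurable_completion) measurable
    ultimately have "(\<lambda>r. (indicator {0<..} r *\<^sub>R u r) * (2 * pi * r * k r)) \<in> borel_measurable lebesgue" by (rule borel_measurable_times)
    then show "(\<lambda>r. indicator {0<..} r * (2 * pi * r * (u r * k r))) \<in> borel_measurable lebesgue" by (simp add: mult_ac)
  qed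
  finally show "(LINT x|lebesgue. u (norm (x::real^2)) * k (norm x)) = (LINT r:{0<..}|lebesgue. 2 * pi * r * (u r * k r))"
    by (simp add: set_lebesgue_integral_def)
qed

text \<open>Testing the planar gradient with a radial vector field sees only its radial component,
  and of that only the averages over circles. These averages form a weak derivative of the profile,
  with the weighted square bound supplied by \<open>circle_average\<close>.\<close>

lemma H_space_weak_derivative:
  assumes u: "u \<in> H_space"
  obtains v where "weak_partial_derivative {0<..} 1 u v" "(\<lambda>r. (v r)\<^sup>2 * r) absolutely_integrable_on {0<..}"
    "(\<lambda>r. (u r)\<^sup>2 * r) absolutely_integrable_on {0<..}"
proof -
  define U where "U x = u (norm x)" for x :: "real^2"
  have "U \<in> H1" using u by (simp add: H_space_def U_def[abs_def])
  then have "U \<in> L2" "\<forall>i\<in>Basis. \<exists>G\<in>L2. weak_partial_derivative UNIV i U G" by (auto simp: H1_def)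
  then obtain G where G: "\<And>i. i \<in> Basis \<Longrightarrow> G i \<in> L2" "\<And>i. i \<in> Basis \<Longrightarrow> weak_partial_derivative UNIV i U (G i)"
    by metis
  have Um: "U \<in> borel_measurable lebesgue" and Ui: "integrable lebesgue (\<lambda>x. (U x)\<^sup>2)"
    using \<open>U \<in> L2\<close> by (auto simp: L2_def)
  have Gm: "\<And>i. i \<in> Basis \<Longrightarrow> G i \<in> borel_measurable lebesgue" and Gi: "\<And>i. i \<in> Basis \<Longrightarrow> integrable lebesgue (\<lambda>x. (G i x)\<^sup>2)"
    using G(1) by (auto simp: L2_def)
  have u2: "(\<lambda>r. (u r)\<^sup>2 * r) absolutely_integrable_on {0<..}"
    by (rule radial_square_integrable) (use Um Ui in \<open>simp_all add: U_def[abs_def]\<close>)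
  have um: "u \<in> borel_measurable (lebesgue_on {0<..})"
    by (rule integral_radial_lebesgue(2)[where k="\<lambda>_. 0"]) (use Um in \<open>simp_all add: U_def[abs_def]\<close>)
  \<comment> \<open>Radial component of the weak gradient; Cauchy-Schwarz bounds it by the full
    gradient.\<close>
  define g where "g x = (\<Sum>i\<in>Basis. (x \<bullet> i) * G i x) / norm x" for x
  have gm: "g \<in> borel_measurable lebesgue"
    unfolding g_def
  proof (intro borel_measurable_divide borel_measurable_sum borel_measurable_times Gm)
    show "(\<lambda>x::real^2. x \<bullet> i) \<in> borel_measurable lebesgue" for i by (rule measurable_completion) measurable
    show "(\<lambda>x::real^2. norm x) \<in> borel_measurable lebesgue" by (rule measurable_completion) measurable
  qed
  have gG: "(g x)\<^sup>2 \<le> (\<Sum>i\<in>Basis. (G i x)\<^sup>2)" for x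
  proof (cases "x = 0")
    case False
    have "(\<Sum>i\<in>Basis. (x \<bullet> i) * G i x)\<^sup>2 \<le> (\<Sum>i\<in>Basis. (x \<bullet> i)\<^sup>2) * (\<Sum>i\<in>Basis. (G i x)\<^sup>2)"
      by (rule Cauchy_Schwarz_ineq_sum)
    also have "(\<Sum>i\<in>Basis. (x \<bullet> i)\<^sup>2) = (norm x)\<^sup>2" using sum_Basis_inner_self[of x] by (simp add: power2_eq_square)
    finally show ?thesis using False by (simp add: g_def power_divide field_simps)
  qed (simp add: g_def sum_nonneg)
  have g2: "integrable lebesgue (\<lambda>x. (g x)\<^sup>2)"
    by (rule Bochner_Integration.integrable_bound[of _ "\<lambda>x. \<Sum>i\<in>Basis. (G i x)\<^sup>2"])
      (use gG gm Gi in \<open>auto intro!: Bochner_Integration.integrable_sum simp: sum_nonneg\<close>)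
  obtain g' where g'[measurable]: "g' \<in> borel_measurable borel" and aeg: "AE x in lborel. g x = g' x"
    using completion_ex_borel_measurable_real[OF gm] by auto
  have aeg': "AE x in lebesgue. g x = g' x" using aeg by (rule AE_completion)
  have "integrable lebesgue (\<lambda>x. (g' x)\<^sup>2)"
    by (rule integrable_cong_AE_imp[OF g2]) (use aeg' in \<open>auto intro!: measurable_completion elim!: eventually_mono\<close>)
  then have "integrable lborel (\<lambda>x. (g' x)\<^sup>2)" by (simp add: integrable_completion)
  then have g'2: "(\<integral>\<^sup>+x. ennreal ((g' x)\<^sup>2) \<partial>lborel) < \<infinity>" by (simp add: integrable_iff_bounded)
  \<comment> \<open>Circle averages were built from densities of measures, so the two signs are
    averaged separately.\<close>
  define hp hm where "hp x = max 0 (g' x)" and "hm x = max 0 (- g' x)" for x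
  have hpm[measurable]: "hp \<in> borel_measurable borel" and hmm[measurable]: "hm \<in> borel_measurable borel" by (auto simp: hp_def[abs_def] hm_def[abs_def])
  have h0: "0 \<le> hp x" "0 \<le> hm x" for x by (auto simp: hp_def hm_def)
  have hp2: "(\<integral>\<^sup>+x. ennreal ((hp x)\<^sup>2) \<partial>lborel) < \<infinity>" and hm2: "(\<integral>\<^sup>+x. ennreal ((hm x)\<^sup>2) \<partial>lborel) < \<infinity>"
  proof -
    have "(hp x)\<^sup>2 \<le> (g' x)\<^sup>2" "(hm x)\<^sup>2 \<le> (g' x)\<^sup>2" for x by (auto simp: hp_def hm_def max_def)
    then show "(\<integral>\<^sup>+x. ennreal ((hp x)\<^sup>2) \<partial>lborel) < \<infinity>" "(\<integral>\<^sup>+x. ennreal ((hm x)\<^sup>2) \<partial>lborel) < \<infinity>"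
      by - (rule le_less_trans[OF nn_integral_mono g'2], rule ennreal_leI, simp)+
  qed
  obtain vp where vp[measurable]: "vp \<in> borel_measurable borel" and vp0': "\<forall>r. 0 \<le> vp r" "\<forall>r\<le>0. vp r = 0"
   and vpd: "density lborel (\<lambda>r. ennreal (2 * pi * r * vp r)) = distr (density lborel (\<lambda>x. ennreal (hp x))) borel norm"
   and vp2: "(\<integral>\<^sup>+r. ennreal (2 * pi * r) * ennreal ((vp r)\<^sup>2) \<partial>lborel) < \<infinity>"
    using circle_average[OF hpm h0(1) hp2] .
  obtain vm where vm[measurable]: "vm \<in> borel_measurable borel" and vm0': "\<forall>r. 0 \<le> vm r" "\<forall>r\<le>0. vm r = 0"
   and vmd: "density lborel (\<lambda>r. ennreal (2 * pi * r * vm r)) = distr (density lborel (\<lambda>x. ennreal (hm x))) borel norm"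
   and vm2: "(\<integral>\<^sup>+r. ennreal (2 * pi * r) * ennreal ((vm r)\<^sup>2) \<partial>lborel) < \<infinity>"
    using circle_average[OF hmm h0(2) hm2] .
  have vp0: "\<And>r. 0 \<le> vp r" "\<And>r. r \<le> 0 \<Longrightarrow> vp r = 0" and vm0: "\<And>r. 0 \<le> vm r" "\<And>r. r \<le> 0 \<Longrightarrow> vm r = 0"
    using vp0' vm0' by auto
  define v where "v r = vp r - vm r" for r
  have vmeas[measurable]: "v \<in> borel_measurable borel" unfolding v_def[abs_def] by measurable
  have v2: "(\<lambda>r. (v r)\<^sup>2 * r) absolutely_integrable_on {0<..}"
  proof -
    have I: "integrable lborel (\<lambda>r. indicator {0<..} r * (2 * pi * r * (w r)\<^sup>2))"
      if [measurable]: "w \<in> borel_measurable borel" and fin: "(\<integral>\<^sup>+r. ennreal (2 * pi * r) * ennreal ((w r)\<^sup>2) \<partial>lborel) < \<infinity>" for w :: "real \<Rightarrow> real"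
    proof (rule integrableI_bounded)
      have "(\<integral>\<^sup>+r. ennreal (norm (indicator {0<..} r * (2 * pi * r * (w r)\<^sup>2))) \<partial>lborel) = (\<integral>\<^sup>+r. ennreal (2 * pi * r) * ennreal ((w r)\<^sup>2) \<partial>lborel)"
      proof (intro nn_integral_cong)
        fix r
        show "ennreal (norm (indicator {0<..} r * (2 * pi * r * (w r)\<^sup>2))) = ennreal (2 * pi * r) * ennreal ((w r)\<^sup>2)"
        proof (cases "0 < r")
          case False
          then have "ennreal (2 * pi * r) = 0" by (intro ennreal_neg mult_nonneg_nonpos) auto
          then show ?thesis using False by simp
        qed (simp add: ennreal_mult''[symmetric] abs_mult)
      qed
      then show "(\<integral>\<^sup>+r. ennreal (norm (indicator {0<..} r * (2 * pi * r * (w r)\<^sup>2))) \<partial>lborel) < \<infinity>" using fin by simp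
    qed measurable
    have "integrable lborel (\<lambda>r. indicator {0<..} r * ((v r)\<^sup>2 * r))"
    proof (rule Bochner_Integration.integrable_bound[OF Bochner_Integration.integrable_add[OF I[OF vp vp2] I[OF vm vm2]]])
      show "(\<lambda>r. indicator {0<..} r * ((v r)\<^sup>2 * r)) \<in> borel_measurable lborel" by measurable
      show "AE r in lborel. norm (indicator {0<..} r * ((v r)\<^sup>2 * r)) \<le> norm (indicator {0<..} r * (2 * pi * r * (vp r)\<^sup>2) + indicator {0<..} r * (2 * pi * r * (vm r)\<^sup>2))"
      proof (intro AE_I2)
        fix r
        have a: "(v r)\<^sup>2 \<le> (vp r)\<^sup>2 + (vm r)\<^sup>2" using mult_nonneg_nonneg[OF vp0(1) vm0(1), of r r] by (simp add: v_def power2_diff mult_ac)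
        show "norm (indicator {0<..} r * ((v r)\<^sup>2 * r)) \<le> norm (indicator {0<..} r * (2 * pi * r * (vp r)\<^sup>2) + indicator {0<..} r * (2 * pi * r * (vm r)\<^sup>2))"
        proof (cases "0 < r")
          case True
          have "(v r)\<^sup>2 * r \<le> ((vp r)\<^sup>2 + (vm r)\<^sup>2) * r" using a True by (intro mult_right_mono) auto
          also have "\<dots> \<le> (2 * pi) * (((vp r)\<^sup>2 + (vm r)\<^sup>2) * r)"
            using mult_right_mono[of 1 "2*pi" "((vp r)\<^sup>2 + (vm r)\<^sup>2) * r"] True pi_ge_two by simp
          finally have *: "(v r)\<^sup>2 * r \<le> 2 * pi * r * (vp r)\<^sup>2 + 2 * pi * r * (vm r)\<^sup>2" by (simp add: algebra_simps)
          have "0 \<le> 2 * pi * r * (vp r)\<^sup>2 + 2 * pi * r * (vm r)\<^sup>2" using True by simp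
          then show ?thesis using * True by (simp add: abs_mult)
        qed simp
      qed
    qed
    then have "integrable lebesgue (\<lambda>r. indicator {0<..} r * ((v r)\<^sup>2 * r))" by (simp add: integrable_completion)
    then show ?thesis by (simp add: set_integrable_def)
  qed
  have "weak_partial_derivative {0<..} 1 u v"
    unfolding weak_partial_derivative_def
  proof (intro conjI allI impI)
    show "locally_integrable_on u {0<..}" by (rule weighted_square_integrable_imp_locally_integrable[OF u2 um])
    have "v \<in> borel_measurable lebesgue" by (rule measurable_completion) simp
    then show "locally_integrable_on v {0<..}" by (intro weighted_square_integrable_imp_locally_integrable[OF v2] measurable_restrict_space1)
    fix \<eta> :: "real \<Rightarrow> real" assume "test_function {0<..} \<eta>"
    then obtain \<eta>' a b where ab: "0 < a" "a \<le> b" and D: "\<And>r. (\<eta> has_real_derivative \<eta>' r) (at r)" and c: "continuous_on UNIV \<eta>'"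
      and z: "\<And>r. r \<notin> {a..b} \<Longrightarrow> \<eta> r = 0" and z': "\<And>r. r \<notin> {a..b} \<Longrightarrow> \<eta>' r = 0"
      and fr: "\<And>r. frechet_derivative \<eta> (at r) 1 = \<eta>' r"
      using test_function_halfline by metis
    define \<Phi> where "\<Phi> i x = \<eta> (norm x) * (x \<bullet> i) / (norm x)\<^sup>2" for i x :: "real^2"
    define P where "P i x h = \<eta>' (norm x) * (x \<bullet> h) * (x \<bullet> i) / (norm x)^3 + \<eta> (norm x) * ((h \<bullet> i) / (norm x)\<^sup>2 - 2 * (x \<bullet> i) * (x \<bullet> h) / (norm x)^4)"
      for i x h :: "real^2"
    have zz: "\<forall>r. r \<notin> {a..b} \<longrightarrow> \<eta> r = 0 \<and> \<eta>' r = 0" using z z' by auto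
    note R = radial_vector_field[where \<eta>=\<eta> and \<eta>'=\<eta>' and a=a and b=b and i="i :: real^2" for i, OF ab(1) D c zz, folded \<Phi>_def P_def]
    have wd: "(LINT x|lebesgue. U x * P i x i) = - (LINT x|lebesgue. G i x * \<Phi> i x)" if "i \<in> Basis" for i
    proof -
      have "(LINT x:UNIV|lebesgue. U x * frechet_derivative (\<Phi> i) (at x) i) = - (LINT x:UNIV|lebesgue. G i x * \<Phi> i x)"
        using G(2)[OF that] R(4)[of i] unfolding weak_partial_derivative_def by blast
      then show ?thesis by (simp add: set_lebesgue_integral_def R(5))
    qed
    have loc: "U absolutely_integrable_on (cball 0 b)" "G i absolutely_integrable_on (cball 0 b)" if "i \<in> Basis" for i
      using G(2)[OF that] unfolding weak_partial_derivative_def locally_integrable_on_def by auto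
    have iU: "integrable lebesgue (\<lambda>x. U x * P i x i)" if "i \<in> Basis" for i
      by (rule integrable_mult_test[OF loc(1)[OF that] R(3)]) (use z z' in \<open>simp add: P_def\<close>)
    have iG: "integrable lebesgue (\<lambda>x. G i x * \<Phi> i x)" if "i \<in> Basis" for i
      by (rule integrable_mult_test[OF loc(2)[OF that] R(2)]) (use z in \<open>simp add: \<Phi>_def\<close>)
    have eqG: "(\<Sum>i\<in>Basis. G i x * \<Phi> i x) = g x * (\<eta> (norm x) / norm x)" for x
      by (simp only: g_def \<Phi>_def sum_divide_distrib sum_distrib_right, intro sum.cong refl) (simp add: power2_eq_square)
    have eqU: "(\<Sum>i\<in>Basis. U x * P i x i) = u (norm x) * (\<eta>' (norm x) / norm x)" for x
      unfolding sum_distrib_left[symmetric] P_def radial_divergence U_def by simp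
    have ig: "integrable lebesgue (\<lambda>x. g x * (\<eta> (norm x) / norm x))"
      unfolding eqG[symmetric] by (intro Bochner_Integration.integrable_sum iG)
    \<comment> \<open>Summing the coordinate identities forms the divergence on the left and the
      radial component on the right. The factor \<open>1 / norm x\<close> on both sides later
      cancels the Jacobian \<open>r\<close>.\<close>
    have main: "(LINT x|lebesgue. u (norm (x::real^2)) * (\<eta>' (norm x) / norm x)) = - (LINT x|lebesgue. g x * (\<eta> (norm x) / norm x))"
    proof -
      have "(LINT x|lebesgue. u (norm (x::real^2)) * (\<eta>' (norm x) / norm x)) = (\<Sum>i\<in>Basis. LINT x|lebesgue. U x * P i x i)"
        unfolding eqU[symmetric] by (intro Bochner_Integration.integral_sum iU)
      also have "\<dots> = - (\<Sum>i\<in>Basis. LINT x|lebesgue. G i x * \<Phi> i x)" by (simp add: wd sum_negf)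
      also have "(\<Sum>i\<in>Basis. LINT x|lebesgue. G i x * \<Phi> i x) = (LINT x|lebesgue. g x * (\<eta> (norm x) / norm x))"
        unfolding eqG[symmetric] by (intro Bochner_Integration.integral_sum[symmetric] iG)
      finally show ?thesis .
    qed
    have [measurable]: "\<eta> \<in> borel_measurable borel" "\<eta>' \<in> borel_measurable borel"
      using c D by (auto intro!: borel_measurable_continuous_onI continuous_at_imp_continuous_on DERIV_isCont)
    have L: "(LINT x|lebesgue. u (norm (x::real^2)) * (\<eta>' (norm x) / norm x)) = 2 * pi * (LINT r:{0<..}|lebesgue. u r * \<eta>' r)"
    proof -
      have "(LINT x|lebesgue. u (norm (x::real^2)) * (\<eta>' (norm x) / norm x)) = (LINT r:{0<..}|lebesgue. 2 * pi * r * (u r * (\<eta>' r / r)))"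
        by (rule integral_radial_lebesgue(1)[of u "\<lambda>r. \<eta>' r / r"]) (use Um in \<open>simp_all add: U_def[abs_def]\<close>)
      also have "\<dots> = (LINT r:{0<..}|lebesgue. (2 * pi) * (u r * \<eta>' r))"
        by (rule set_lebesgue_integral_cong) auto
      finally show ?thesis by simp
    qed
    have Rr: "(LINT x|lebesgue. g x * (\<eta> (norm x) / norm x)) = 2 * pi * (LINT r:{0<..}|lebesgue. v r * \<eta> r)"
    proof -
      let ?k = "\<lambda>r. \<eta> r / r"
      have ae: "AE x in lebesgue. g x * ?k (norm x) = g' x * ?k (norm x)" using aeg' by eventually_elim simp
      have "integrable lebesgue (\<lambda>x. g' x * ?k (norm x))"
        by (rule integrable_cong_AE_imp[OF ig _ ae]) (rule measurable_completion, measurable)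
      then have ig': "integrable lborel (\<lambda>x. g' x * ?k (norm x))" by (simp add: integrable_completion)
      have ihp: "integrable lborel (\<lambda>x. hp x * ?k (norm x))" and ihm: "integrable lborel (\<lambda>x. hm x * ?k (norm x))"
      proof -
        have "norm (hp x * ?k (norm x)) \<le> norm (g' x * ?k (norm x))" "norm (hm x * ?k (norm x)) \<le> norm (g' x * ?k (norm x))" for x
          unfolding norm_mult by (intro mult_right_mono; simp add: hp_def hm_def)+
        then show "integrable lborel (\<lambda>x. hp x * ?k (norm x))" "integrable lborel (\<lambda>x. hm x * ?k (norm x))"
          by (auto intro!: Bochner_Integration.integrable_bound[OF ig'] simp del: norm_mult norm_divide real_norm_def)
      qed
      have ip: "integrable lborel (\<lambda>r. 2 * pi * r * vp r * ?k r)"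
        using circle_average_integral(1)[of hp vp ?k, OF _ h0(1) _ vp0 vpd] ihp by simp
      have im: "integrable lborel (\<lambda>r. 2 * pi * r * vm r * ?k r)"
        using circle_average_integral(1)[of hm vm ?k, OF _ h0(2) _ vm0 vmd] ihm by simp
      have "(LINT x|lebesgue. g x * ?k (norm x)) = (LINT x|lebesgue. g' x * ?k (norm x))"
        by (rule integral_cong_AE[OF borel_measurable_integrable[OF ig] _ ae]) (rule measurable_completion, measurable)
      also have "\<dots> = (LINT x|lborel. g' x * ?k (norm x))" by (subst integral_completion) auto
      also have "\<dots> = (LINT x|lborel. hp x * ?k (norm x) - hm x * ?k (norm x))"
        by (intro Bochner_Integration.integral_cong refl) (auto simp: hp_def hm_def max_def)
      also have "\<dots> = (LINT x|lborel. hp x * ?k (norm x)) - (LINT x|lborel. hm x * ?k (norm x))"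
        by (rule Bochner_Integration.integral_diff[OF ihp ihm])
      also have "\<dots> = (LINT r|lborel. 2 * pi * r * vp r * ?k r) - (LINT r|lborel. 2 * pi * r * vm r * ?k r)"
        using circle_average_integral(2)[of hp vp ?k, OF _ h0(1) _ vp0 vpd] circle_average_integral(2)[of hm vm ?k, OF _ h0(2) _ vm0 vmd] by simp
      also have "\<dots> = (LINT r|lborel. 2 * pi * r * vp r * ?k r - 2 * pi * r * vm r * ?k r)"
        by (rule Bochner_Integration.integral_diff[OF ip im, symmetric])
      also have "\<dots> = (LINT r|lborel. (2 * pi) * (indicator {0<..} r *\<^sub>R (v r * \<eta> r)))"
        using vp0(2) vm0(2) by (intro Bochner_Integration.integral_cong refl) (auto simp: v_def indicator_def field_simps)
      also have "\<dots> = (LINT r|lebesgue. (2 * pi) * (indicator {0<..} r *\<^sub>R (v r * \<eta> r)))"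
        by (subst integral_completion) auto
      also have "\<dots> = 2 * pi * (LINT r:{0<..}|lebesgue. v r * \<eta> r)"
        unfolding set_lebesgue_integral_def by (rule integral_mult_right_zero)
      finally show ?thesis .
    qed
    show "(LINT x:{0<..}|lebesgue. u x * frechet_derivative \<eta> (at x) 1) = - (LINT x:{0<..}|lebesgue. v x * \<eta> x)"
    proof -
      have "2 * pi * (LINT r:{0<..}|lebesgue. u r * \<eta>' r) = 2 * pi * (- (LINT r:{0<..}|lebesgue. v r * \<eta> r))"
        using main unfolding L Rr by simp
      then show ?thesis unfolding fr by (subst (asm) mult_left_cancel) simp_all
    qed
  qed
  then show ?thesis by (rule that[OF _ v2 u2])
qed

section \<open>Asymptotics of admissible solutions\<close>

text \<open>A strictly negative \<open>s * \<theta>' s\<close> near 0 forces logarithmic growth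
  towards 0. It serves to exclude such behaviour by contradiction with finite energy or with the
  sign of a solution.\<close>

lemma has_derivative_log_lower_bound:
  fixes \<theta> \<theta>' :: "real \<Rightarrow> real"
  assumes D: "\<And>r. 0 < r \<Longrightarrow> (\<theta> has_real_derivative \<theta>' r) (at r)" and r: "0 < r" "r \<le> r0"
    and le: "\<And>s. 0 < s \<Longrightarrow> s \<le> r0 \<Longrightarrow> s * \<theta>' s \<le> - c"
  shows "\<theta> r0 + c * ln (r0 / r) \<le> \<theta> r"
proof -
  have "\<theta> r0 + c * ln r0 \<le> \<theta> r + c * ln r"
  proof (rule DERIV_nonpos_imp_nonincreasing[where f="\<lambda>s. \<theta> s + c * ln s", OF r(2)])
    fix s assume s: "r \<le> s" "s \<le> r0"
    then have s0: "0 < s" using r by simp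
    have "((\<lambda>s. \<theta> s + c * ln s) has_real_derivative (\<theta>' s + c / s)) (at s)"
      using s0 by (auto intro!: derivative_eq_intros D)
    moreover have "\<theta>' s + c / s \<le> 0" using le[OF s0 s(2)] s0 by (simp add: field_simps)
    ultimately show "\<exists>y. ((\<lambda>s. \<theta> s + c * ln s) has_real_derivative y) (at s) \<and> y \<le> 0" by blast
  qed
  then show ?thesis using r by (simp add: ln_div algebra_simps)
qed

lemma log_unbounded_near_0:
  fixes c r0 A :: real
  assumes "0 < c" "0 < r0" obtains r where "0 < r" "r \<le> r0" "\<And>s. 0 < s \<Longrightarrow> s \<le> r \<Longrightarrow> A < c * ln (r0 / s)"
proof
  let ?r = "r0 * exp (- ((\<bar>A\<bar> + 1) / c))"
  show "0 < ?r" "?r \<le> r0" using assms by (auto simp: mult_le_cancel_left1 divide_le_0_iff)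
  fix s assume s: "0 < s" "s \<le> ?r"
  have "ln s \<le> ln ?r" using s by (subst ln_le_cancel_iff) auto
  also have "ln ?r = ln r0 - (\<bar>A\<bar> + 1) / c" using assms by (simp add: ln_mult)
  finally have "(\<bar>A\<bar> + 1) / c \<le> ln (r0 / s)" using s assms by (simp add: ln_div)
  then have "\<bar>A\<bar> + 1 \<le> c * ln (r0 / s)" using assms by (simp add: field_simps)
  then show "A < c * ln (r0 / s)" by linarith
qed

lemma absolutely_integrable_bounded_integrals:
  fixes F :: "real \<Rightarrow> real"
  assumes "F absolutely_integrable_on {0<..}"
  obtains I where "\<forall>a b. 0 < a \<longrightarrow> F absolutely_integrable_on {a..b} \<and> integral {a..b} F \<le> I" "0 \<le> I"
proof (rule that, intro allI impI conjI)
  let ?I = "integral {0<..} (\<lambda>r. \<bar>F r\<bar>)"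
  have A: "(\<lambda>r. \<bar>F r\<bar>) integrable_on {0<..}" using assms by (simp add: absolutely_integrable_on_def)
  show "0 \<le> ?I" by (rule Henstock_Kurzweil_Integration.integral_nonneg[OF A]) auto
  fix a b :: real assume a: "0 < a"
  show ab: "F absolutely_integrable_on {a..b}" by (rule set_integrable_subset[OF assms]) (use a in auto)
  have "integral {a..b} F \<le> integral {a..b} (\<lambda>r. \<bar>F r\<bar>)"
    using ab by (intro integral_le) (auto simp: absolutely_integrable_on_def)
  also have "\<dots> \<le> ?I"
    using ab A a by (intro integral_subset_le) (auto simp: absolutely_integrable_on_def)
  finally show "integral {a..b} F \<le> ?I" .
qed

lemma integral_inverse_Icc:
  fixes a b :: real
  assumes "0 < a" "a \<le> b" shows "(\<lambda>r. c / r) integrable_on {a..b}" "integral {a..b} (\<lambda>r. c / r) = c * ln (b / a)"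
proof -
  have "((\<lambda>r. c / r) has_integral (c * ln b - c * ln a)) {a..b}"
    by (rule fundamental_theorem_of_calculus)
       (use assms in \<open>auto intro!: derivative_eq_intros simp: has_real_derivative_iff_has_vector_derivative[symmetric]\<close>)
  then show "(\<lambda>r. c / r) integrable_on {a..b}" "integral {a..b} (\<lambda>r. c / r) = c * ln (b / a)"
    using assms by (auto simp: integral_unique integrable_on_def ln_div algebra_simps)
qed

text \<open>Otherwise \<open>k\<close> would dominate a multiple of \<open>1 / r\<close> near 0,
  whose integrals diverge logarithmically.\<close>

lemma small_values_near_0:
  fixes k :: "real \<Rightarrow> real"
  assumes k: "\<And>a. 0 < a \<Longrightarrow> k integrable_on {a..1}" and I: "\<And>a. 0 < a \<Longrightarrow> integral {a..1} k \<le> I" and "0 < \<epsilon>" "0 < \<delta>" "\<delta> \<le> 1"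
    and nn: "\<And>r. 0 < r \<Longrightarrow> r \<le> 1 \<Longrightarrow> 0 \<le> k r"
  shows "\<exists>r. 0 < r \<and> r \<le> \<delta> \<and> r * k r < \<epsilon>"
proof (rule ccontr)
  assume "\<not> ?thesis"
  then have ge: "\<epsilon> / r \<le> k r" if "0 < r" "r \<le> \<delta>" for r using that by (auto simp: field_simps not_less)
  obtain a where a: "0 < a" "a \<le> \<delta>" "\<And>s. 0 < s \<Longrightarrow> s \<le> a \<Longrightarrow> I < \<epsilon> * ln (\<delta> / s)"
    using log_unbounded_near_0[OF assms(3,4), of I] by blast
  have "\<epsilon> * ln (\<delta> / a) = integral {a..\<delta>} (\<lambda>r. \<epsilon> / r)" using integral_inverse_Icc(2)[OF a(1,2)] by simp
  also have "\<dots> \<le> integral {a..\<delta>} k"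
    using a assms(5) ge by (intro integral_le integral_inverse_Icc integrable_subinterval_real[OF k[OF a(1)]]) auto
  also have "\<dots> \<le> integral {a..1} k"
    using a assms(5) nn by (intro integral_subset_le integrable_subinterval_real[OF k[OF a(1)]]) auto
  also have "\<dots> \<le> I" by (rule I) (use a in auto)
  finally show False using a(3)[of a] a(1) by simp
qed

text \<open>Logarithmic divergence of \<open>1 / r\<close> at infinity. For densities that already
  carry the factor \<open>r\<close> this yields smallness of \<open>r\<^sup>2\<close> times a square
  along a sequence of radii.\<close>

lemma small_values_at_top:
  fixes k :: "real \<Rightarrow> real"
  assumes "0 < a" and k: "\<And>b. k integrable_on {a..b}" and I: "\<And>b. integral {a..b} k \<le> I" and "0 < \<epsilon>"
    and nn: "\<And>r. a \<le> r \<Longrightarrow> 0 \<le> k r"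
  shows "\<exists>r\<ge>R. r * k r < \<epsilon>"
proof (rule ccontr)
  assume "\<not> ?thesis"
  then have ge: "\<epsilon> / r \<le> k r" if "max a R \<le> r" for r using that assms(1) by (auto simp: field_simps not_less)
  let ?a = "max a R"
  \<comment> \<open>Chosen so that the integral of \<open>\<epsilon> / r\<close> up to
    \<open>b\<close> is \<open>\<bar>I\<bar> + 1\<close>, beyond the allowed bound.\<close>
  define b where "b = ?a * exp ((\<bar>I\<bar> + 1) / \<epsilon>)"
  have ab: "0 < ?a" "?a \<le> b" using assms by (auto simp: b_def mult_le_cancel_left1)
  have "\<epsilon> * ln (b / ?a) = \<bar>I\<bar> + 1" using ab(1) assms by (simp add: b_def)
  moreover have "\<epsilon> * ln (b / ?a) = integral {?a..b} (\<lambda>r. \<epsilon> / r)" using integral_inverse_Icc(2)[OF ab] by simp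
  moreover have "\<dots> \<le> integral {?a..b} k"
    using ab ge by (intro integral_le integral_inverse_Icc integrable_subinterval_real[OF k[of b]]) auto
  moreover have "\<dots> \<le> integral {a..b} k"
    using ab nn by (intro integral_subset_le integrable_subinterval_real[OF k[of b]]) auto
  moreover have "\<dots> \<le> I" by (rule I)
  ultimately show False by linarith
qed

text \<open>The variation of \<open>y\<close> beyond a large radius is at most the tail of the
  integral of \<open>k\<close>. Approaching \<open>l\<close> along some sequence therefore forces
  convergence.\<close>

lemma tendsto_at_top_of_integrable_derivative:
  fixes y y' k :: "real \<Rightarrow> real"
  assumes k: "\<And>b. k integrable_on {a..b}" and I: "\<And>b. integral {a..b} k \<le> I"
    and nn: "\<And>r. a \<le> r \<Longrightarrow> 0 \<le> k r"
    and D: "\<And>r. a \<le> r \<Longrightarrow> (y has_real_derivative y' r) (at r)" and le: "\<And>r. a \<le> r \<Longrightarrow> \<bar>y' r\<bar> \<le> k r"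
    and lim: "\<And>R \<epsilon>. 0 < \<epsilon> \<Longrightarrow> \<exists>r\<ge>R. \<bar>y r - l\<bar> < \<epsilon>"
  shows "(y \<longlongrightarrow> l) at_top"
proof (rule tendstoI)
  fix e :: real assume e: "0 < e"
  define S where "S = (SUP b\<in>{a..}. integral {a..b} k)"
  have bdd: "bdd_above ((\<lambda>b. integral {a..b} k) ` {a..})" using I by (auto intro!: bdd_aboveI[of _ I])
  have "\<exists>R\<in>{a..}. S - e / 2 < integral {a..R} k"
    using less_cSUP_iff[OF _ bdd, of "S - e / 2"] e by (auto simp: S_def)
  then obtain R where R: "a \<le> R" "S - e / 2 < integral {a..R} k" by auto
  have "dist (y r) l < e" if r: "R \<le> r" for r
  proof -
    obtain t where t: "r \<le> t" "\<bar>y t - l\<bar> < e / 2" using lim[of "e/2" r] e by auto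
    have ar: "a \<le> r" using r R by simp
    have "(y' has_integral (y t - y r)) {r..t}"
      by (rule fundamental_theorem_of_calculus[OF t(1)])
        (use D ar in \<open>auto simp: has_real_derivative_iff_has_vector_derivative[symmetric] intro: has_field_derivative_at_within\<close>)
    then have "\<bar>y t - y r\<bar> \<le> integral {r..t} k"
      using integral_norm_bound_integral[of y' "{r..t}" k] le ar integrable_subinterval_real[OF k[of t], of r t]
      by (auto simp: integral_unique integrable_on_def)
    moreover have "integral {r..t} k = integral {a..t} k - integral {a..r} k"
      using Henstock_Kurzweil_Integration.integral_combine[OF ar t(1) k] by simp
    moreover have "integral {a..t} k \<le> S" unfolding S_def by (rule cSUP_upper[OF _ bdd]) (use ar t in auto)
    moreover have "integral {a..R} k \<le> integral {a..r} k"
      using r R nn by (intro integral_subset_le k) auto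
    ultimately have "\<bar>y t - y r\<bar> < e / 2" using R(2) by linarith
    then show ?thesis using t(2) unfolding dist_real_def by linarith
  qed
  then show "\<forall>\<^sub>F r in at_top. dist (y r) l < e" by (auto simp: eventually_at_top_linorder)
qed

section \<open>Maximum principle for the reference profile\<close>

text \<open>At an interior maximum with value above 1 the first derivative vanishes and the equation
  makes the second one positive, which is impossible at a maximum.\<close>

lemma vortex_profile_le_1:
  assumes "vortex_profile d ft" "0 < r"
  shows "ft r \<le> 1"
proof (rule ccontr)
  assume gt: "\<not> ft r \<le> 1"
  have diff: "\<And>r. 0 < r \<Longrightarrow> (ft has_real_derivative deriv ft r) (at r)" "\<And>r. 0 < r \<Longrightarrow> (deriv ft has_real_derivative deriv (deriv ft) r) (at r)"
    using assms(1) by (auto simp: vortex_profile_def twice_differentiable_on_halfline_def DERIV_deriv_iff_real_differentiable)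
  have ode: "\<And>r. 0 < r \<Longrightarrow> - deriv (deriv ft) r - 1 / r * deriv ft r + (of_int d)\<^sup>2 / r\<^sup>2 * ft r = (1 - (ft r)\<^sup>2) * ft r"
    and c: "continuous_on {0..} ft" and z: "ft 0 = 0" and lim: "(ft \<longlongrightarrow> 1) at_top"
    using assms(1) by (auto simp: vortex_profile_def)
  have "eventually (\<lambda>x. ft x < ft r) at_top" using lim gt by (intro order_tendstoD(2)) auto
  then obtain R0 where R0: "\<And>x. R0 \<le> x \<Longrightarrow> ft x < ft r" by (auto simp: eventually_at_top_linorder)
  \<comment> \<open>Beyond \<open>R0\<close> the profile is below \<open>ft r\<close>, and at 0 it
    vanishes, so the maximum over \<open>{0..R}\<close> is interior.\<close>
  define R where "R = max R0 r"
  have R: "ft R < ft r" "r \<le> R" using R0 by (auto simp: R_def)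
  have "\<exists>s\<in>{0..R}. \<forall>y\<in>{0..R}. ft y \<le> ft s"
    using R assms(2) by (intro continuous_attains_sup continuous_on_subset[OF c]) auto
  then obtain s where s: "s \<in> {0..R}" and mx: "\<And>y. y \<in> {0..R} \<Longrightarrow> ft y \<le> ft s" by blast
  have s1: "ft r \<le> ft s" using mx[of r] R assms(2) by auto
  have s0: "0 < s" using s s1 gt z by (cases "s = 0") auto
  have sR: "s < R" using s s1 R by (cases "s = R") auto
  have d0: "deriv ft s = 0"
  proof (rule DERIV_local_max[OF diff(1)[OF s0]])
    show "0 < min s (R - s)" using s0 sR by auto
    show "\<forall>y. \<bar>s - y\<bar> < min s (R - s) \<longrightarrow> ft y \<le> ft s" by (intro allI impI mx) auto
  qed
  have "deriv (deriv ft) s = (of_int d)\<^sup>2 / s\<^sup>2 * ft s + ((ft s)\<^sup>2 - 1) * ft s"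
    using ode[OF s0] d0 by (simp add: algebra_simps)
  moreover have "1 < ft s" using s1 gt by simp
  ultimately have pos: "0 < deriv (deriv ft) s"
    by (simp add: add_nonneg_pos one_less_power)
  \<comment> \<open>The derivative becomes positive just to the right of \<open>s\<close>, so
    \<open>ft\<close> would exceed its maximum there.\<close>
  obtain e where e: "0 < e" "\<And>h. 0 < h \<Longrightarrow> h < e \<Longrightarrow> 0 < deriv ft (s + h)"
    using DERIV_pos_inc_right[OF diff(2)[OF s0] pos] d0 by auto
  define t where "t = s + min (e / 2) (R - s)"
  have t: "s < t" "t \<le> R" "t < s + e" using e sR by (auto simp: t_def)
  have "\<exists>z. s < z \<and> z < t \<and> ft t - ft s = (t - s) * deriv ft z"
    by (rule MVT2[OF t(1)]) (use diff(1) s0 in auto)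
  then obtain z where z: "s < z" "z < t" "ft t - ft s = (t - s) * deriv ft z" by auto
  have "0 < deriv ft z" using e(2)[of "z - s"] z t by auto
  then have "0 < ft t - ft s" using z t by simp
  moreover have "ft t \<le> ft s" using mx[of t] t s0 by auto
  ultimately show False by simp
qed

locale gl_vortex =
  fixes d :: int and g :: real and ft f m :: "real \<Rightarrow> real"
  assumes d: "d \<noteq> 0" and g: "0 < g" and ft: "vortex_profile d ft" and adm: "admissible_solution d g ft f m"
    and m_pos: "\<And>r. 0 \<le> r \<Longrightarrow> 0 < m r"
begin

definition D :: real where "D = (of_int d)\<^sup>2"
definition h :: "real \<Rightarrow> real" where "h r = 1 - (f r)\<^sup>2 - (m r)\<^sup>2"
definition f' :: "real \<Rightarrow> real" where "f' = deriv f"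
definition m' :: "real \<Rightarrow> real" where "m' = deriv m"

lemma D_ge_1: "1 \<le> D"
proof -
  have "1 \<le> d\<^sup>2" using d by (simp add: int_one_le_iff_zero_less)
  then have "real_of_int 1 \<le> real_of_int (d\<^sup>2)" by (rule of_int_le_iff[THEN iffD2])
  then show ?thesis by (simp add: D_def)
qed

lemma f_nonneg: "0 \<le> r \<Longrightarrow> 0 \<le> f r"
  using adm by (simp add: admissible_solution_def)

lemma f_deriv: "0 < r \<Longrightarrow> (f has_real_derivative f' r) (at r)"
  and m_deriv: "0 < r \<Longrightarrow> (m has_real_derivative m' r) (at r)"
  using adm by (auto simp: f'_def m'_def admissible_solution_def GL_system_def twice_differentiable_on_halfline_def DERIV_deriv_iff_real_differentiable)

lemma f'_deriv: "0 < r \<Longrightarrow> (f' has_real_derivative (D / r\<^sup>2 - h r) * f r - f' r / r) (at r)"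
proof -
  assume r: "0 < r"
  have "(deriv f has_real_derivative deriv (deriv f) r) (at r)"
    using adm r by (auto simp: admissible_solution_def GL_system_def twice_differentiable_on_halfline_def DERIV_deriv_iff_real_differentiable)
  moreover have "- deriv (deriv f) r - 1 / r * deriv f r + (of_int d)\<^sup>2 / r\<^sup>2 * f r = (1 - (f r)\<^sup>2 - (m r)\<^sup>2) * f r"
    using adm r by (auto simp: admissible_solution_def GL_system_def)
  then have "deriv (deriv f) r = (D / r\<^sup>2 - h r) * f r - f' r / r" by (simp add: D_def h_def f'_def algebra_simps)
  ultimately show ?thesis by (simp add: f'_def)
qed

lemma m'_deriv: "0 < r \<Longrightarrow> (m' has_real_derivative (g - h r) * m r - m' r / r) (at r)"
proof -
  assume r: "0 < r"
  have "(deriv m has_real_derivative deriv (deriv m) r) (at r)"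
    using adm r by (auto simp: admissible_solution_def GL_system_def twice_differentiable_on_halfline_def DERIV_deriv_iff_real_differentiable)
  moreover have "- deriv (deriv m) r - 1 / r * deriv m r + g * m r = (1 - (f r)\<^sup>2 - (m r)\<^sup>2) * m r"
    using adm r by (auto simp: admissible_solution_def GL_system_def)
  then have "deriv (deriv m) r = (g - h r) * m r - m' r / r" by (simp add: h_def m'_def algebra_simps)
  ultimately show ?thesis by (simp add: m'_def)
qed

lemma rf'_deriv: "0 < r \<Longrightarrow> ((\<lambda>r. r * f' r) has_real_derivative (D / r - r * h r) * f r) (at r)"
  by (rule derivative_eq_intros f'_deriv refl | assumption)+ (simp add: field_simps power2_eq_square)

lemma rm'_deriv: "0 < r \<Longrightarrow> ((\<lambda>r. r * m' r) has_real_derivative r * (g - h r) * m r) (at r)"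
  by (rule derivative_eq_intros m'_deriv refl | assumption)+ (simp add: field_simps)

lemma cont:
  assumes "S \<subseteq> {0<..}"
  shows "continuous_on S f" "continuous_on S m" "continuous_on S f'" "continuous_on S m'" "continuous_on S h"
proof -
  show c: "continuous_on S f" "continuous_on S m" "continuous_on S f'" "continuous_on S m'"
    using f_deriv m_deriv f'_deriv m'_deriv assms
    by (meson DERIV_isCont continuous_at_imp_continuous_on greaterThan_iff subsetD)+
  show "continuous_on S h" unfolding h_def by (intro continuous_intros c)
qed

lemma m_continuous: "continuous_on {0..R} m"
proof (rule continuous_on_eq_continuous_within[THEN iffD2], rule ballI)
  fix r assume r: "r \<in> {0..R}"
  show "continuous (at r within {0..R}) m"
  proof (cases "r = 0")
    case True
    have "(m has_real_derivative 0) (at 0 within {0..})" using adm by (simp add: admissible_solution_def)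
    then have "continuous (at 0 within {0..}) m" by (rule DERIV_continuous)
    then show ?thesis using True by (auto intro: continuous_within_subset)
  next
    case False
    then show ?thesis using m_deriv[of r] r by (auto intro!: continuous_at_imp_continuous_at_within DERIV_isCont)
  qed
qed

lemma m_lower_bound:
  obtains \<mu> where "0 < \<mu>" "\<And>r. 0 < r \<Longrightarrow> r \<le> R \<Longrightarrow> \<mu> \<le> m r"
proof (cases "0 \<le> R")
  case True
  then have "\<exists>x\<in>{0..R}. \<forall>y\<in>{0..R}. m x \<le> m y"
    by (intro continuous_attains_inf m_continuous) auto
  then obtain x where "x \<in> {0..R}" "\<forall>y\<in>{0..R}. m x \<le> m y" by blast
  then show ?thesis using m_pos[of x] by (intro that[of "m x"]) auto
next
  case False then show ?thesis by (intro that[of 1]) auto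
qed

lemma m_upper_bound:
  obtains M where "0 < M" "\<And>r. 0 < r \<Longrightarrow> r \<le> R \<Longrightarrow> m r \<le> M"
proof (cases "0 \<le> R")
  case True
  then have "\<exists>x\<in>{0..R}. \<forall>y\<in>{0..R}. m y \<le> m x"
    by (intro continuous_attains_sup m_continuous) auto
  then obtain x where "x \<in> {0..R}" "\<forall>y\<in>{0..R}. m y \<le> m x" by blast
  then show ?thesis using m_pos[of x] by (intro that[of "m x"]) auto
next
  case False then show ?thesis by (intro that[of 1]) auto
qed

lemma h_le_1: "h r \<le> 1" by (simp add: h_def)

lemma ft_bounds: "0 < r \<Longrightarrow> 0 \<le> ft r \<and> (ft r)\<^sup>2 \<le> 1"
  using vortex_profile_le_1[OF ft, of r] ft by (auto simp: vortex_profile_def power_le_one order.strict_implies_order)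

lemma energy_integrable: "(\<lambda>r. energy_density d g ft f m r * r) absolutely_integrable_on {0<..}"
  using adm by (simp add: admissible_solution_def finite_energy_def)

lemma energy_density_eq: "energy_density d g ft f m r = 1 / 2 * ((f' r)\<^sup>2 + (m' r)\<^sup>2 + g * (m r)\<^sup>2 + D / r\<^sup>2 * ((f r)\<^sup>2 - (ft r)\<^sup>2) + 1 / 2 * (h r)\<^sup>2)"
  by (simp add: energy_density_def f'_def m'_def D_def h_def)

section \<open>Behaviour of the solution at the origin\<close>

text \<open>On (0,1] one has \<open>D / r >= 1 >= r * h r\<close>, so \<open>r * f' r\<close> is
  nondecreasing. A negative value would persist towards 0 and force \<open>f\<close> to grow
  logarithmically; the term with \<open>D / r\<^sup>2\<close> would then make the energy
  infinite.\<close>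

lemma f'_nonneg_near_0:
  assumes r0: "0 < r0" "r0 \<le> 1"
  shows "0 \<le> f' r0"
proof (rule ccontr)
  assume "\<not> 0 \<le> f' r0"
  define c where "c = - (r0 * f' r0)"
  have c: "0 < c" using r0 \<open>\<not> 0 \<le> f' r0\<close> by (simp add: c_def mult_pos_neg not_le)
  have mono: "s * f' s \<le> - c" if s: "0 < s" "s \<le> r0" for s
    unfolding c_def minus_minus
  proof (rule DERIV_nonneg_imp_nondecreasing[OF s(2)])
    fix x assume x: "s \<le> x" "x \<le> r0"
    have x0: "0 < x" "x \<le> 1" using x s r0 by auto
    have "x * h x \<le> 1" using mult_mono[of x 1 "h x" 1] h_le_1[of x] x0 by (cases "0 \<le> h x") (auto intro: order_trans[OF mult_nonneg_nonpos])
    also have "1 \<le> D / x" using D_ge_1 x0 by (simp add: field_simps)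
    finally have "0 \<le> (D / x - x * h x) * f x" using f_nonneg x0 by simp
    then show "\<exists>y. ((\<lambda>s. s * f' s) has_real_derivative y) (at x) \<and> 0 \<le> y" using rf'_deriv[OF x0(1)] by blast
  qed
  \<comment> \<open>The level 2 ensures \<open>f s >= 2\<close> below \<open>a\<close>, which
    together with \<open>ft <= 1\<close> leaves at least 1 in
    \<open>(f s)\<^sup>2 - (ft s)\<^sup>2\<close>.\<close>
  obtain a where a: "0 < a" "a \<le> r0" and lg: "\<And>s. 0 < s \<Longrightarrow> s \<le> a \<Longrightarrow> 2 < c * ln (r0 / s)"
    using log_unbounded_near_0[OF c r0(1), of 2] by blast
  have big: "1 / 2 / s \<le> energy_density d g ft f m s * s" if s: "0 < s" "s \<le> a" for s
  proof -
    have "f r0 + c * ln (r0 / s) \<le> f s"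
      by (rule has_derivative_log_lower_bound[where \<theta>'=f']) (use f_deriv mono s a in auto)
    then have "2 \<le> f s" using lg[OF s] f_nonneg[of r0] r0 by linarith
    then have "2\<^sup>2 \<le> (f s)\<^sup>2" by (intro power_mono) auto
    then have "1 \<le> (f s)\<^sup>2 - (ft s)\<^sup>2" using ft_bounds[OF s(1)] by auto
    then have "1 * 1 \<le> D * ((f s)\<^sup>2 - (ft s)\<^sup>2)" using D_ge_1 by (intro mult_mono) auto
    moreover define X where "X = D / s\<^sup>2 * ((f s)\<^sup>2 - (ft s)\<^sup>2)"
    ultimately have "1 / s\<^sup>2 \<le> X" using s by (simp add: divide_right_mono)
    moreover have "0 \<le> (f' s)\<^sup>2" "0 \<le> (m' s)\<^sup>2" "0 \<le> g * (m s)\<^sup>2" "0 \<le> (h s)\<^sup>2" using g by auto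
    ultimately have "1 / 2 * (1 / s\<^sup>2) \<le> energy_density d g ft f m s"
      unfolding energy_density_eq X_def[symmetric] by (intro mult_left_mono) linarith+
    then have "1 / 2 * (1 / s\<^sup>2) * s \<le> energy_density d g ft f m s * s" using s by (intro mult_right_mono) auto
    then show ?thesis using s by (simp add: power2_eq_square)
  qed
  obtain I where I': "\<forall>x y. 0 < x \<longrightarrow> (\<lambda>r. energy_density d g ft f m r * r) absolutely_integrable_on {x..y}
     \<and> integral {x..y} (\<lambda>r. energy_density d g ft f m r * r) \<le> I"
    using absolutely_integrable_bounded_integrals[OF energy_integrable] .
  have I: "(\<lambda>r. energy_density d g ft f m r * r) absolutely_integrable_on {x..y}"
     "integral {x..y} (\<lambda>r. energy_density d g ft f m r * r) \<le> I" if "0 < x" for x y using I' that by auto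
  obtain b where b: "0 < b" "b \<le> a" "\<And>s. 0 < s \<Longrightarrow> s \<le> b \<Longrightarrow> I < 1 / 2 * ln (a / s)"
    using log_unbounded_near_0[OF half_gt_zero[OF zero_less_one] a(1), of I] by blast
  have "1 / 2 * ln (a / b) = integral {b..a} (\<lambda>r. 1 / 2 / r)" using integral_inverse_Icc(2)[OF b(1,2), of "1/2"] by simp
  also have "\<dots> \<le> integral {b..a} (\<lambda>r. energy_density d g ft f m r * r)"
    using b big by (intro integral_le integral_inverse_Icc set_lebesgue_integral_eq_integral(1)[OF I(1)]) auto
  also have "\<dots> \<le> I" by (rule I(2)[OF b(1)])
  finally show False using b(3)[of b] b(1) by simp
qed

lemma f_mono_near_0: "0 < r \<Longrightarrow> r \<le> s \<Longrightarrow> s \<le> 1 \<Longrightarrow> f r \<le> f s"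
  by (rule DERIV_nonneg_imp_nondecreasing[where f=f], assumption)
     (meson f_deriv f'_nonneg_near_0 less_le_trans order_trans)

lemma rf'_mono_near_0:
  assumes "0 < r" "r \<le> 1" shows "r * f' r \<le> f' 1"
proof -
  have "r * f' r \<le> 1 * f' 1"
  proof (rule DERIV_nonneg_imp_nondecreasing[OF assms(2)])
    fix x assume x: "r \<le> x" "x \<le> 1"
    have x0: "0 < x" using x assms by auto
    have "x * h x \<le> 1" using mult_mono[of x 1 "h x" 1] h_le_1[of x] x0 x by (cases "0 \<le> h x") (auto intro: order_trans[OF mult_nonneg_nonpos])
    also have "1 \<le> D / x" using D_ge_1 x0 x by (simp add: field_simps)
    finally have "0 \<le> (D / x - x * h x) * f x" using f_nonneg x0 by simp
    then show "\<exists>y. ((\<lambda>s. s * f' s) has_real_derivative y) (at x) \<and> 0 \<le> y" using rf'_deriv[OF x0(1)] by blast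
  qed
  then show ?thesis by simp
qed

lemma h_bounded_near_0:
  obtains B where "1 \<le> B" "\<And>r. 0 < r \<Longrightarrow> r \<le> 1 \<Longrightarrow> \<bar>h r\<bar> \<le> B"
proof -
  obtain M where M: "0 < M" "\<And>r. 0 < r \<Longrightarrow> r \<le> 1 \<Longrightarrow> m r \<le> M" using m_upper_bound by blast
  show ?thesis
  proof (rule that[of "1 + (f 1)\<^sup>2 + M\<^sup>2"])
    fix r :: real assume r: "0 < r" "r \<le> 1"
    have "(f r)\<^sup>2 \<le> (f 1)\<^sup>2" "(m r)\<^sup>2 \<le> M\<^sup>2"
      using f_mono_near_0[OF r(1,2)] f_nonneg[of r] M(2)[OF r] m_pos[of r] r by (auto intro!: power_mono)
    then show "\<bar>h r\<bar> \<le> 1 + (f 1)\<^sup>2 + M\<^sup>2" unfolding h_def using zero_le_power2[of "f r"] zero_le_power2[of "m r"] by linarith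
  qed simp
qed

text \<open>Upper bound on \<open>r * f' r / f r\<close>, needed for the boundary term at 0. If
  \<open>y = r f' - K f\<close> were positive somewhere, a power of \<open>r\<close> times
  \<open>y\<close> would stay above a positive constant towards 0, so \<open>r * f' r\<close> would
  blow up, contrary to \<open>rf'_mono_near_0\<close>.\<close>

lemma rf'_le_near_0:
  obtains K where "0 \<le> K" "\<And>r. 0 < r \<Longrightarrow> r \<le> 1 \<Longrightarrow> r * f' r \<le> K * f r"
proof -
  obtain B where B: "1 \<le> B" "\<And>r. 0 < r \<Longrightarrow> r \<le> 1 \<Longrightarrow> \<bar>h r\<bar> \<le> B" using h_bounded_near_0 by blast
  \<comment> \<open>The same natural number serves as factor \<open>K\<close> and as exponent
    \<open>n\<close>: in the derivative of \<open>r ^ n * y r\<close> the terms with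
    \<open>f'\<close> cancel, leaving \<open>D - r\<^sup>2 * h r - K * K\<close> times nonnegative
    factors. Hence \<open>K * K >= D + B\<close> is required.\<close>
  obtain n0 :: nat where n0: "D + B \<le> real n0" using real_arch_simple by blast
  define n where "n = Suc n0"
  define K where "K = real n"
  have K1: "1 \<le> K" by (simp add: K_def n_def)
  have "D + B \<le> K * 1" using n0 by (simp add: K_def n_def)
  also have "\<dots> \<le> K * K" using K1 by (intro mult_left_mono) auto
  finally have K2: "D + B \<le> K * K" .
  define y where "y r = r * f' r - K * f r" for r
  have "y r0 \<le> 0" if r0: "0 < r0" "r0 \<le> 1" for r0
  proof (rule ccontr)
    assume y0: "\<not> y r0 \<le> 0"
    define c where "c = r0 ^ n * y r0"
    have c: "0 < c" using y0 r0 by (simp add: c_def)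
    have ge: "c / r \<le> f' 1" if r: "0 < r" "r \<le> r0" for r
    proof -
      have "r0 ^ n * y r0 \<le> r ^ n * y r"
      proof (rule DERIV_nonpos_imp_nonincreasing[OF r(2)])
        fix x assume x: "r \<le> x" "x \<le> r0"
        have x0: "0 < x" "x \<le> 1" using x r r0 by auto
        have yd: "(y has_real_derivative (D / x - x * h x) * f x - K * f' x) (at x)"
          unfolding y_def by (rule DERIV_diff[OF rf'_deriv[OF x0(1)] DERIV_cmult[OF f_deriv[OF x0(1)]]])
        have "((\<lambda>s. s ^ n * y s) has_real_derivative (real n * x ^ (n - 1) * y x + x ^ n * ((D / x - x * h x) * f x - K * f' x))) (at x)"
          using yd by (auto intro!: derivative_eq_intros)
        moreover have "real n * x ^ (n - 1) * y x + x ^ n * ((D / x - x * h x) * f x - K * f' x) \<le> 0"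
        proof -
          have xn: "x ^ n = x ^ (n - 1) * x" by (simp add: n_def)
          have "real n * x ^ (n - 1) * y x + x ^ n * ((D / x - x * h x) * f x - K * f' x)
              = x ^ (n - 1) * ((D - x\<^sup>2 * h x - K * K) * f x)"
            unfolding xn y_def K_def[symmetric] using x0 by (simp add: field_simps power2_eq_square)
          moreover have "(D - x\<^sup>2 * h x - K * K) \<le> 0"
          proof -
            have "- (x\<^sup>2 * h x) \<le> 1 * B"
              using mult_mono[of "x\<^sup>2" 1 "\<bar>h x\<bar>" B] B(2)[OF x0] x0 B(1) abs_mult[of "x\<^sup>2" "h x"] by (simp add: power_le_one)
            then show ?thesis using K2 by linarith
          qed
          ultimately show ?thesis using x0 f_nonneg[of x] by (simp add: mult_nonneg_nonpos mult_nonpos_nonneg)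
        qed
        ultimately show "\<exists>z. ((\<lambda>s. s ^ n * y s) has_real_derivative z) (at x) \<and> z \<le> 0" by blast
      qed
      then have 1: "c \<le> r ^ n * y r" by (simp add: c_def)
      then have "0 < r ^ n * y r" using c by linarith
      then have yr: "0 < y r" using r by (simp add: zero_less_mult_iff)
      have "r ^ n \<le> r" using r r0 power_decreasing[of 1 n r] by (simp add: n_def)
      then have "c \<le> r * y r" using 1 mult_right_mono[of "r ^ n" r "y r"] yr by linarith
      then have "c / r \<le> y r" using r by (simp add: field_simps)
      also have "y r \<le> r * f' r" using K1 f_nonneg[of r] r by (simp add: y_def)
      also have "\<dots> \<le> f' 1" using rf'_mono_near_0 r r0 by simp
      finally show ?thesis .
    qed
    \<comment> \<open>At this radius \<open>c / r\<close> is at least \<open>f' 1 + 1\<close>,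
      contradicting the bound \<open>ge\<close>.\<close>
    define r where "r = min r0 (c / (f' 1 + 1))"
    have p: "0 < f' 1 + 1" using f'_nonneg_near_0[of 1] by simp
    have r: "0 < r" "r \<le> r0" using r0 c p by (auto simp: r_def)
    have "r \<le> c / (f' 1 + 1)" by (simp add: r_def)
    then have "f' 1 + 1 \<le> c / r" using p r by (simp add: field_simps)
    then show False using ge[OF r] by linarith
  qed
  then show ?thesis using K1 by (intro that[of K]) (auto simp: y_def)
qed

text \<open>If \<open>y = r m' - C r\<^sup>2\<close> were positive at some radius, its monotonicity
  would keep \<open>r * m' r\<close> above a positive constant towards 0, driving \<open>m\<close>
  to minus infinity logarithmically and violating positivity. The quadratic rate matters later,
  because \<open>w\<close> itself need not be small at 0.\<close>

lemma rm'_le_near_0: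
  obtains C where "0 \<le> C" "\<And>r. 0 < r \<Longrightarrow> r \<le> 1 \<Longrightarrow> r * m' r \<le> C * r\<^sup>2"
proof -
  obtain B where B: "1 \<le> B" "\<And>r. 0 < r \<Longrightarrow> r \<le> 1 \<Longrightarrow> \<bar>h r\<bar> \<le> B" using h_bounded_near_0 by blast
  obtain M where M: "0 < M" "\<And>r. 0 < r \<Longrightarrow> r \<le> 1 \<Longrightarrow> m r \<le> M" using m_upper_bound by blast
  define C where "C = (g + B) * M"
  have C: "0 \<le> C" using g B M by (simp add: C_def)
  define y where "y r = r * m' r - C * r\<^sup>2" for r
  have "y r0 \<le> 0" if r0: "0 < r0" "r0 \<le> 1" for r0
  proof (rule ccontr)
    assume "\<not> y r0 \<le> 0"
    then have c: "0 < y r0" by simp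
    have mono: "y r0 \<le> y s" if s: "0 < s" "s \<le> r0" for s
    proof (rule DERIV_nonpos_imp_nonincreasing[OF s(2)])
      fix x assume x: "s \<le> x" "x \<le> r0"
      have x0: "0 < x" "x \<le> 1" using x s r0 by auto
      have yd: "(y has_real_derivative x * (g - h x) * m x - C * (2 * x)) (at x)"
        unfolding y_def by (rule DERIV_diff[OF rm'_deriv[OF x0(1)]]) (auto intro!: derivative_eq_intros)
      have "(g - h x) * m x \<le> C"
        unfolding C_def using B(2)[OF x0] B(1) g M m_pos[of x] x0 by (intro mult_mono) auto
      then have "x * ((g - h x) * m x) \<le> x * C" using x0 by (intro mult_left_mono) auto
      moreover have "0 \<le> x * C" using x0 C by simp
      moreover have "C * (2 * x) = 2 * (x * C)" by simp
      ultimately have "x * (g - h x) * m x - C * (2 * x) \<le> 0" unfolding mult.assoc[of x "g - h x"] by linarith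
      then show "\<exists>z. (y has_real_derivative z) (at x) \<and> z \<le> 0" using yd by blast
    qed
    have le: "s * (- m' s) \<le> - y r0" if s: "0 < s" "s \<le> r0" for s
      using mono[OF s] C by (simp add: y_def) (smt (verit) mult_nonneg_nonneg zero_le_power2)
    obtain a where a: "0 < a" "a \<le> r0" "\<And>s. 0 < s \<Longrightarrow> s \<le> a \<Longrightarrow> m r0 < y r0 * ln (r0 / s)"
      using log_unbounded_near_0[OF c r0(1), of "m r0"] by blast
    have "- m r0 + y r0 * ln (r0 / a) \<le> - m a"
      by (rule has_derivative_log_lower_bound[where \<theta>="\<lambda>r. - m r" and \<theta>'="\<lambda>r. - m' r", OF _ a(1,2) le]) (auto intro!: derivative_intros m_deriv)
    then show False using a(3)[of a] a(1) m_pos[of a] by simp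
  qed
  then show ?thesis using C by (intro that[of C]) (auto simp: y_def)
qed

section \<open>Decay at infinity and positivity\<close>

text \<open>Extracts an integrable sum of squares from the signed energy density. Since
  \<open>ft <= 1\<close>, the renormalised term is at least
  \<open>D / r\<^sup>2 * (- h r - (m r)\<^sup>2)\<close>; for large \<open>r\<close> the part with
  \<open>m\<close> is absorbed by half of \<open>g * (m r)\<^sup>2\<close>, and the part with
  \<open>h\<close> by half of its square plus an integrable remainder.\<close>

lemma tail_energy_bound:
  obtains R0 I where "1 \<le> R0"
    "\<forall>b. integral {R0..b} (\<lambda>r. r * ((f' r)\<^sup>2 + (m' r)\<^sup>2 + (m r)\<^sup>2 + (h r)\<^sup>2)) \<le> I"
proof -
  let ?k = "\<lambda>r. r * ((f' r)\<^sup>2 + (m' r)\<^sup>2 + (m r)\<^sup>2 + (h r)\<^sup>2)"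
  let ?e = "\<lambda>r. energy_density d g ft f m r * r"
  define \<kappa> where "\<kappa> = min (g / 2) (1/4)"
  have \<kappa>: "0 < \<kappa>" "\<kappa> \<le> g / 2" "\<kappa> \<le> 1/4" using g by (auto simp: \<kappa>_def)
  \<comment> \<open>Beyond the square root \<open>D / r\<^sup>2 <= g / 2\<close>; the bound 1 makes
    powers of \<open>r\<close> comparable.\<close>
  define R0 where "R0 = max 1 (sqrt (2 * D / g))"
  have R0: "1 \<le> R0" "sqrt (2 * D / g) \<le> R0" by (auto simp: R0_def)
  obtain I where I': "\<forall>x y. 0 < x \<longrightarrow> ?e absolutely_integrable_on {x..y} \<and> integral {x..y} ?e \<le> I" "0 \<le> I"
    using absolutely_integrable_bounded_integrals[OF energy_integrable] .
  have le: "\<kappa> * ?k r \<le> 2 * ?e r + D\<^sup>2 / r\<^sup>2" if r: "R0 \<le> r" for r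
  proof -
    have r0: "0 < r" "1 \<le> r" using r R0 by auto
    have "sqrt (2 * D / g) \<le> r" using R0 r by simp
    then have "(sqrt (2 * D / g))\<^sup>2 \<le> r\<^sup>2" by (rule power_mono) (use D_ge_1 g in auto)
    then have "2 * D / g \<le> r\<^sup>2" using D_ge_1 g by simp
    then have Dg: "D / r \<le> g / 2 * r" using g r0 by (simp add: field_simps power2_eq_square)
    have 2: "2 * ?e r = r * ((f' r)\<^sup>2 + (m' r)\<^sup>2 + g * (m r)\<^sup>2 + 1 / 2 * (h r)\<^sup>2) + D / r * ((f r)\<^sup>2 - (ft r)\<^sup>2)"
      unfolding energy_density_eq using r0 by (simp add: field_simps power2_eq_square)
    have "- h r - (m r)\<^sup>2 \<le> (f r)\<^sup>2 - (ft r)\<^sup>2" using ft_bounds[OF r0(1)] by (simp add: h_def)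
    then have "D / r * (- h r - (m r)\<^sup>2) \<le> D / r * ((f r)\<^sup>2 - (ft r)\<^sup>2)"
      using D_ge_1 r0 by (intro mult_left_mono) auto
    moreover have "D / r * (- h r - (m r)\<^sup>2) = - (D / r * h r) - D / r * (m r)\<^sup>2" by (simp add: algebra_simps)
    moreover have "D / r * (m r)\<^sup>2 \<le> g / 2 * r * (m r)\<^sup>2" using Dg by (intro mult_right_mono) auto
    moreover have "D / r * h r \<le> r * (h r)\<^sup>2 / 4 + D\<^sup>2 / r\<^sup>2"
    proof -
      have "0 \<le> (r * h r / 2 - D / r)\<^sup>2 / r" using r0 by simp
      also have "\<dots> = r * (h r)\<^sup>2 / 4 + D\<^sup>2 / (r\<^sup>2 * r) - D / r * h r"
        using r0 by (simp add: power2_eq_square field_simps)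
      finally have "D / r * h r \<le> r * (h r)\<^sup>2 / 4 + D\<^sup>2 / (r\<^sup>2 * r)" by simp
      moreover have "D\<^sup>2 / (r\<^sup>2 * r) \<le> D\<^sup>2 / r\<^sup>2" using r0 by (intro divide_left_mono) auto
      ultimately show ?thesis by simp
    qed
    ultimately have "r * ((f' r)\<^sup>2 + (m' r)\<^sup>2 + g * (m r)\<^sup>2 + 1 / 2 * (h r)\<^sup>2) - (r * (h r)\<^sup>2 / 4 + D\<^sup>2 / r\<^sup>2) - g / 2 * r * (m r)\<^sup>2 \<le> 2 * ?e r"
      unfolding 2 by linarith
    moreover have "r * ((f' r)\<^sup>2 + (m' r)\<^sup>2 + g * (m r)\<^sup>2 + 1 / 2 * (h r)\<^sup>2) - (r * (h r)\<^sup>2 / 4 + D\<^sup>2 / r\<^sup>2) - g / 2 * r * (m r)\<^sup>2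
      = r * ((f' r)\<^sup>2 + (m' r)\<^sup>2 + g / 2 * (m r)\<^sup>2 + 1 / 4 * (h r)\<^sup>2) - D\<^sup>2 / r\<^sup>2" by (simp add: algebra_simps)
    moreover have "\<kappa> * ((f' r)\<^sup>2 + (m' r)\<^sup>2 + (m r)\<^sup>2 + (h r)\<^sup>2) \<le> (f' r)\<^sup>2 + (m' r)\<^sup>2 + g / 2 * (m r)\<^sup>2 + 1 / 4 * (h r)\<^sup>2"
    proof -
      have "\<kappa> * (f' r)\<^sup>2 \<le> 1 * (f' r)\<^sup>2" "\<kappa> * (m' r)\<^sup>2 \<le> 1 * (m' r)\<^sup>2" "\<kappa> * (m r)\<^sup>2 \<le> g / 2 * (m r)\<^sup>2" "\<kappa> * (h r)\<^sup>2 \<le> 1 / 4 * (h r)\<^sup>2"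
        using \<kappa> by (intro mult_right_mono; simp)+
      then show ?thesis by (simp only: distrib_left)
    qed
    then have "r * (\<kappa> * ((f' r)\<^sup>2 + (m' r)\<^sup>2 + (m r)\<^sup>2 + (h r)\<^sup>2)) \<le> r * ((f' r)\<^sup>2 + (m' r)\<^sup>2 + g / 2 * (m r)\<^sup>2 + 1 / 4 * (h r)\<^sup>2)"
      using r0 by (intro mult_left_mono) auto
    moreover have "\<kappa> * ?k r = r * (\<kappa> * ((f' r)\<^sup>2 + (m' r)\<^sup>2 + (m r)\<^sup>2 + (h r)\<^sup>2))" by simp
    ultimately show ?thesis by linarith
  qed
  have kint: "?k integrable_on {R0..b}" for b
    by (intro integrable_continuous_real continuous_intros cont) (use R0 in auto)
  have bound: "integral {R0..b} ?k \<le> (2 * I + D\<^sup>2) / \<kappa>" for b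
  proof (cases "R0 \<le> b")
    case True
    have R00: "0 < R0" using R0 by simp
    have inv: "((\<lambda>r. D\<^sup>2 / r\<^sup>2) has_integral (- (D\<^sup>2 / b) - (- (D\<^sup>2 / R0)))) {R0..b}"
      by (rule fundamental_theorem_of_calculus[OF True])
         (use R00 in \<open>auto intro!: derivative_eq_intros simp: has_real_derivative_iff_has_vector_derivative[symmetric] power2_eq_square\<close>)
    have ei: "?e integrable_on {R0..b}" using I'(1) R00 set_lebesgue_integral_eq_integral(1) by blast
    have S: "((\<lambda>r. 2 * ?e r + D\<^sup>2 / r\<^sup>2) has_integral (2 * integral {R0..b} ?e + (- (D\<^sup>2 / b) - (- (D\<^sup>2 / R0))))) {R0..b}"
      by (intro has_integral_add has_integral_mult_right integrable_integral ei inv)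
    have "\<kappa> * integral {R0..b} ?k = integral {R0..b} (\<lambda>r. \<kappa> * ?k r)" by simp
    also have "\<dots> \<le> integral {R0..b} (\<lambda>r. 2 * ?e r + D\<^sup>2 / r\<^sup>2)"
    proof (rule integral_le)
      show "(\<lambda>r. \<kappa> * ?k r) integrable_on {R0..b}"
        by (intro integrable_continuous_real continuous_intros cont) (use R0 in auto)
      show "(\<lambda>r. 2 * ?e r + D\<^sup>2 / r\<^sup>2) integrable_on {R0..b}" using S by blast
    qed (use le in auto)
    also have "\<dots> = 2 * integral {R0..b} ?e + (- (D\<^sup>2 / b) - (- (D\<^sup>2 / R0)))"
      using S by (rule integral_unique)
    also have "\<dots> \<le> 2 * I + D\<^sup>2"
    proof -
      have "0 \<le> D\<^sup>2 / b" using True R00 by simp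
      moreover have "D\<^sup>2 / R0 \<le> D\<^sup>2 / 1" using R0 by (intro divide_left_mono) auto
      moreover have "integral {R0..b} ?e \<le> I" using I'(1) R00 by blast
      ultimately show ?thesis by simp
    qed
    finally show ?thesis using \<kappa> by (simp add: field_simps)
  next
    case False
    then show ?thesis using I'(2) \<kappa> by simp
  qed
  show ?thesis by (rule that[OF R0(1)]) (use bound in blast)
qed

text \<open>The tail density dominates the derivatives of suitable functions of \<open>m\<close> and
  \<open>f\<close> and is itself small along a sequence of radii, so both functions converge. For
  \<open>m\<close> the square is suitable.\<close>

lemma m_tendsto_0: "(m \<longlongrightarrow> 0) at_top"
  and f_tendsto_1: "(f \<longlongrightarrow> 1) at_top"
proof -
  let ?k = "\<lambda>r. r * ((f' r)\<^sup>2 + (m' r)\<^sup>2 + (m r)\<^sup>2 + (h r)\<^sup>2)"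
  obtain R0 I where R0: "1 \<le> R0" and I: "\<forall>b. integral {R0..b} ?k \<le> I" using tail_energy_bound .
  have kint: "?k integrable_on {R..b}" if "R0 \<le> R" for R b
    by (intro integrable_continuous_real continuous_intros cont) (use R0 that in auto)
  have nn: "0 \<le> ?k r" if "R0 \<le> r" for r using R0 that by (intro mult_nonneg_nonneg add_nonneg_nonneg) auto
  have kI: "integral {R..b} ?k \<le> I" if "R0 \<le> R" for R b
  proof (cases "R \<le> b")
    case True
    then have "integral {R..b} ?k \<le> integral {R0..b} ?k" using that nn kint by (intro integral_subset_le) auto
    then show ?thesis using I by (meson order_trans)
  next
    case False
    have "integral {R0..R0} ?k \<le> I" using I by blast
    then show ?thesis using False by simp
  qed
  have one: "X \<le> r * X" if "R0 \<le> r" "0 \<le> X" for r X :: real using mult_right_mono[of 1 r X] that R0 by simp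
  have small: "\<exists>r\<ge>R. R0 \<le> r \<and> (m r)\<^sup>2 + (h r)\<^sup>2 < \<epsilon>" if \<epsilon>: "0 < \<epsilon>" for R \<epsilon>
  proof -
    obtain r where r: "max R R0 \<le> r" "r * ?k r < \<epsilon>"
      using small_values_at_top[of R0 ?k I \<epsilon> "max R R0"] R0 kint kI nn \<epsilon> by auto
    have "(m r)\<^sup>2 + (h r)\<^sup>2 \<le> (f' r)\<^sup>2 + (m' r)\<^sup>2 + (m r)\<^sup>2 + (h r)\<^sup>2" by simp
    also have "\<dots> \<le> ?k r" by (rule one) (use r in auto)
    also have "\<dots> \<le> r * ?k r" by (rule one) (use r nn[of r] in auto)
    finally show ?thesis using r by auto
  qed
  have m2: "((\<lambda>r. (m r)\<^sup>2) \<longlongrightarrow> 0) at_top"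
  proof (rule tendsto_at_top_of_integrable_derivative[where k="?k" and a=R0 and I=I and y'="\<lambda>r. 2 * m r * m' r"])
    fix r assume r: "R0 \<le> r"
    show "((\<lambda>r. (m r)\<^sup>2) has_real_derivative 2 * m r * m' r) (at r)"
      using m_deriv[of r] r R0 by (auto intro!: derivative_eq_intros)
    have "\<bar>2 * m r * m' r\<bar> \<le> (f' r)\<^sup>2 + (m' r)\<^sup>2 + (m r)\<^sup>2 + (h r)\<^sup>2"
    proof -
      have "\<bar>2 * m r * m' r\<bar> = 2 * \<bar>m r\<bar> * \<bar>m' r\<bar>" by (simp add: abs_mult)
      also have "\<dots> \<le> (m r)\<^sup>2 + (m' r)\<^sup>2" using sum_squares_bound[of "\<bar>m r\<bar>" "\<bar>m' r\<bar>"] by simp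
      finally show ?thesis using zero_le_power2[of "f' r"] zero_le_power2[of "h r"] by linarith
    qed
    also have "\<dots> \<le> ?k r" by (rule one[OF r]) simp
    finally show "\<bar>2 * m r * m' r\<bar> \<le> ?k r" .
  next
    fix R \<epsilon> :: real assume "0 < \<epsilon>"
    then obtain r where "R \<le> r" "(m r)\<^sup>2 + (h r)\<^sup>2 < \<epsilon>" using small by blast
    then show "\<exists>r\<ge>R. \<bar>(m r)\<^sup>2 - 0\<bar> < \<epsilon>" by (intro exI[of _ r]) (auto intro: le_less_trans[rotated])
  qed (use kint kI nn in auto)
  have "((\<lambda>r. sqrt ((m r)\<^sup>2)) \<longlongrightarrow> sqrt 0) at_top" by (intro tendsto_real_sqrt m2)
  then show m0: "(m \<longlongrightarrow> 0) at_top" by (simp add: tendsto_rabs_zero_iff)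
  have "eventually (\<lambda>r. (m r)\<^sup>2 < 1) at_top" using m2 by (rule order_tendstoD) simp
  \<comment> \<open>The bound \<open>m\<^sup>2 < 1\<close> is needed to estimate the fourth power of
    \<open>m\<close> by its square.\<close>
  then obtain R1 where R1: "\<And>r. R1 \<le> r \<Longrightarrow> (m r)\<^sup>2 < 1" by (auto simp: eventually_at_top_linorder)
  let ?R = "max R0 R1"
  \<comment> \<open>The derivative \<open>(1 - f\<^sup>2) * f'\<close> equals
    \<open>h * f' + m\<^sup>2 * f'\<close>, a sum of products and hence dominated by squares;
    \<open>f'\<close> alone would not be. By \<open>id\<close>, for nonnegative arguments closeness
    of \<open>?y\<close> to 2/3 controls \<open>(f - 1)\<^sup>2\<close>.\<close>
  let ?y = "\<lambda>r. f r - (f r)^3 / 3"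
  have id: "2 / 3 - (x - x^3 / 3) = (x - 1)\<^sup>2 * (x + 2) / 3" for x :: real
    by (simp add: power2_eq_square power3_eq_cube field_simps)
  have y: "(?y \<longlongrightarrow> 2 / 3) at_top"
  proof (rule tendsto_at_top_of_integrable_derivative[where k="?k" and a="?R" and I=I and y'="\<lambda>r. (1 - (f r)\<^sup>2) * f' r"])
    fix r assume r: "?R \<le> r"
    show "(?y has_real_derivative (1 - (f r)\<^sup>2) * f' r) (at r)"
      using f_deriv[of r] r R0 by (auto intro!: derivative_eq_intros simp: field_simps power2_eq_square)
    have mm: "(m r)\<^sup>2 * (m r)\<^sup>2 \<le> 1 * (m r)\<^sup>2" using R1[of r] r by (intro mult_right_mono) auto
    have "\<bar>(1 - (f r)\<^sup>2) * f' r\<bar> = \<bar>h r * f' r + (m r)\<^sup>2 * f' r\<bar>" by (simp add: h_def algebra_simps)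
    also have "\<dots> \<le> \<bar>h r\<bar> * \<bar>f' r\<bar> + (m r)\<^sup>2 * \<bar>f' r\<bar>" by (rule order_trans[OF abs_triangle_ineq]) (simp add: abs_mult)
    also have "\<dots> \<le> (f' r)\<^sup>2 + (m' r)\<^sup>2 + (m r)\<^sup>2 + (h r)\<^sup>2"
      using sum_squares_bound[of "\<bar>h r\<bar>" "\<bar>f' r\<bar>"] sum_squares_bound[of "(m r)\<^sup>2" "\<bar>f' r\<bar>"] mm
      unfolding power2_eq_square[of "(m r)\<^sup>2"] by (simp add: algebra_simps) (smt (verit) zero_le_power2)
    also have "\<dots> \<le> ?k r" by (rule one) (use r in auto)
    finally show "\<bar>(1 - (f r)\<^sup>2) * f' r\<bar> \<le> ?k r" .
  next
    fix R \<epsilon> :: real assume \<epsilon>: "0 < \<epsilon>"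
    \<comment> \<open>The quarter pays for \<open>f + 2 <= 4\<close>, which holds once
      \<open>f\<close> is within 1 of its limit.\<close>
    define e where "e = min 1 (\<epsilon> / 4)"
    have e: "0 < e" "e \<le> 1" "e \<le> \<epsilon> / 4" using \<epsilon> by (auto simp: e_def)
    obtain r where r: "R \<le> r" "R0 \<le> r" "(m r)\<^sup>2 + (h r)\<^sup>2 < (e / 2)\<^sup>2"
      using small[of "(e/2)\<^sup>2" R] e by auto
    have "(h r)\<^sup>2 < (e/2)\<^sup>2" using r(3) zero_le_power2[of "m r"] by linarith
    then have h1: "\<bar>h r\<bar> < e / 2" using e by (intro power2_less_imp_less[of "\<bar>h r\<bar>" "e / 2"]) auto
    have "(e/2)\<^sup>2 \<le> e / 2" using e mult_left_le[of "e/2" "e/2"] by (simp add: power2_eq_square)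
    then have m1: "(m r)\<^sup>2 < e / 2" using r(3) zero_le_power2[of "h r"] by linarith
    have f0: "0 \<le> f r" using r R0 by (intro f_nonneg) auto
    have "\<bar>f r - 1\<bar> * 1 \<le> \<bar>f r - 1\<bar> * \<bar>f r + 1\<bar>" using f0 by (intro mult_left_mono) auto
    also have "\<dots> = \<bar>(f r)\<^sup>2 - 1\<bar>" by (simp add: abs_mult[symmetric] power2_eq_square algebra_simps)
    also have "\<dots> \<le> \<bar>h r\<bar> + (m r)\<^sup>2" unfolding h_def using zero_le_power2[of "m r"] by linarith
    also have "\<dots> < e / 2 + e / 2" by (rule add_strict_mono[OF h1 m1])
    finally have f1: "\<bar>f r - 1\<bar> < e" by simp
    then have "(f r - 1)\<^sup>2 \<le> e * 1" using mult_mono[of "\<bar>f r - 1\<bar>" e "\<bar>f r - 1\<bar>" 1] e by (simp add: power2_eq_square abs_mult[symmetric])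
    then have "(f r - 1)\<^sup>2 * (f r + 2) \<le> e * 4" using f1 f0 e by (intro mult_mono) auto
    then have "2 / 3 - ?y r < \<epsilon>" unfolding id using e \<epsilon> by simp
    moreover have "0 \<le> 2 / 3 - ?y r" unfolding id using f0 by simp
    ultimately have "\<bar>?y r - 2 / 3\<bar> < \<epsilon>" by linarith
    then show "\<exists>r\<ge>R. \<bar>?y r - 2 / 3\<bar> < \<epsilon>" using r by blast
  qed (use kint kI nn in auto)
  have "((\<lambda>r. (f r - 1)\<^sup>2) \<longlongrightarrow> 0) at_top"
  proof (rule tendsto_sandwich[OF _ _ tendsto_const])
    show "((\<lambda>r. 3 / 2 * (2 / 3 - ?y r)) \<longlongrightarrow> 0) at_top"
      using tendsto_mult[OF tendsto_const[of "3/2"] tendsto_diff[OF tendsto_const[of "2/3"] y]] by simp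
    show "\<forall>\<^sub>F r in at_top. 0 \<le> (f r - 1)\<^sup>2" by simp
    show "\<forall>\<^sub>F r in at_top. (f r - 1)\<^sup>2 \<le> 3 / 2 * (2 / 3 - ?y r)"
      using eventually_ge_at_top[of 0]
    proof eventually_elim
      case (elim r)
      have "(f r - 1)\<^sup>2 * 2 \<le> (f r - 1)\<^sup>2 * (f r + 2)" using f_nonneg[OF elim] by (intro mult_left_mono) auto
      then show ?case unfolding id by (simp add: mult_ac)
    qed
  qed
  then have "((\<lambda>r. sqrt ((f r - 1)\<^sup>2)) \<longlongrightarrow> sqrt 0) at_top" by (intro tendsto_real_sqrt)
  then have "((\<lambda>r. f r - 1) \<longlongrightarrow> 0) at_top" by (simp add: tendsto_rabs_zero_iff)
  then show "(f \<longlongrightarrow> 1) at_top" by (simp add: LIM_zero_iff)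
qed

lemma h_tendsto_0: "(h \<longlongrightarrow> 0) at_top"
proof -
  have "((\<lambda>r. 1 - (f r)\<^sup>2 - (m r)\<^sup>2) \<longlongrightarrow> 1 - 1\<^sup>2 - 0\<^sup>2) at_top"
    by (intro tendsto_intros f_tendsto_1 m_tendsto_0)
  then show ?thesis by (simp add: h_def[abs_def])
qed

lemma h_bounded:
  obtains B where "1 \<le> B" "\<And>r. 0 < r \<Longrightarrow> \<bar>h r\<bar> \<le> B"
proof -
  obtain B where B: "1 \<le> B" "\<And>r. 0 < r \<Longrightarrow> r \<le> 1 \<Longrightarrow> \<bar>h r\<bar> \<le> B" using h_bounded_near_0 by blast
  have "eventually (\<lambda>r. \<bar>h r\<bar> < 1) at_top"
    using tendsto_rabs_zero[OF h_tendsto_0] by (rule order_tendstoD) simp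
  then obtain R where R: "\<And>r. R \<le> r \<Longrightarrow> \<bar>h r\<bar> < 1" by (auto simp: eventually_at_top_linorder)
  have "compact (h ` {1..R})" by (intro compact_continuous_image cont) auto
  then have "bounded (h ` {1..R})" by (rule compact_imp_bounded)
  then obtain C where C: "\<forall>r\<in>{1..R}. \<bar>h r\<bar> \<le> C" by (auto simp: bounded_iff)
  show ?thesis
  proof (rule that[of "max B C"])
    show "\<bar>h r\<bar> \<le> max B C" if "0 < r" for r
      using B(1) R[of r] bspec[OF C, of r] that B(2)[of r] by (cases "r \<le> 1"; cases "R \<le> r") auto
  qed (use B in auto)
qed

text \<open>A zero of the nonnegative \<open>f\<close> is an interior minimum, so \<open>f'\<close>
  vanishes there too. Uniqueness for the linear equation then keeps \<open>f\<close> zero to the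
  right, contradicting its limit 1.\<close>

lemma f_pos: assumes r0: "0 < r0" shows "0 < f r0"
proof (rule ccontr)
  assume "\<not> 0 < f r0"
  then have f0: "f r0 = 0" using f_nonneg[of r0] r0 by simp
  have f'0: "f' r0 = 0"
    by (rule DERIV_local_min[OF f_deriv[OF r0] r0]) (use f0 f_nonneg in auto)
  have "eventually (\<lambda>r. 0 < f r) at_top" using f_tendsto_1 by (rule order_tendstoD) simp
  then obtain R0 where R0: "\<And>r. R0 \<le> r \<Longrightarrow> 0 < f r" by (auto simp: eventually_at_top_linorder)
  define R where "R = max R0 r0"
  have R: "r0 \<le> R" "0 < f R" using R0 by (auto simp: R_def)
  have "compact ((\<lambda>r. D / r\<^sup>2 - h r) ` {r0..R})"
    by (intro compact_continuous_image continuous_intros cont) (use r0 in auto)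
  then have "bounded ((\<lambda>r. D / r\<^sup>2 - h r) ` {r0..R})" by (rule compact_imp_bounded)
  then obtain C where C: "\<forall>r\<in>{r0..R}. \<bar>D / r\<^sup>2 - h r\<bar> \<le> C" by (auto simp: bounded_iff)
  define N where "N r = (f r)\<^sup>2 + (f' r)\<^sup>2" for r
  \<comment> \<open>Gronwall's inequality for \<open>f\<^sup>2 + f'\<^sup>2\<close>: the exponential
    weight makes it nonincreasing, the damping term \<open>- f' / r\<close> having the favourable
    sign.\<close>
  have "exp (- (1 + C) * R) * N R \<le> exp (- (1 + C) * r0) * N r0"
  proof (rule DERIV_nonpos_imp_nonincreasing[OF R(1)])
    fix x assume x: "r0 \<le> x" "x \<le> R"
    have x0: "0 < x" using x r0 by simp
    define c where "c = D / x\<^sup>2 - h x"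
    have cC: "\<bar>c\<bar> \<le> C" using C x by (simp add: c_def)
    have "(N has_real_derivative 2 * f x * f' x + 2 * f' x * (c * f x - f' x / x)) (at x)"
      unfolding N_def c_def using x0 by (auto intro!: derivative_eq_intros f_deriv f'_deriv)
    then have "((\<lambda>r. exp (- (1 + C) * r) * N r) has_real_derivative
       exp (- (1 + C) * x) * (- (1 + C)) * N x + exp (- (1 + C) * x) * (2 * f x * f' x + 2 * f' x * (c * f x - f' x / x))) (at x)"
      by (auto intro!: derivative_eq_intros)
    moreover have "2 * f x * f' x + 2 * f' x * (c * f x - f' x / x) \<le> (1 + C) * N x"
    proof -
      have a: "2 * f x * f' x \<le> N x" using sum_squares_bound[of "f x" "f' x"] by (simp add: N_def)
      have "c * (2 * f x * f' x) \<le> \<bar>c\<bar> * \<bar>2 * f x * f' x\<bar>" using abs_ge_self[of "c * (2 * f x * f' x)"] by (simp add: abs_mult)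
      also have "\<dots> \<le> C * N x" using cC sum_squares_bound[of "\<bar>f x\<bar>" "\<bar>f' x\<bar>"] by (intro mult_mono) (auto simp: N_def abs_mult)
      finally have b: "c * (2 * f x * f' x) \<le> C * N x" .
      have "0 \<le> 2 * f' x * (f' x / x)" using x0 by (simp add: power2_eq_square[symmetric])
      then show ?thesis using a b by (simp add: algebra_simps)
    qed
    then have "exp (- (1 + C) * x) * (- (1 + C)) * N x + exp (- (1 + C) * x) * (2 * f x * f' x + 2 * f' x * (c * f x - f' x / x)) \<le> 0"
    proof -
      assume le: "2 * f x * f' x + 2 * f' x * (c * f x - f' x / x) \<le> (1 + C) * N x"
      have eq: "exp (- (1 + C) * x) * (- (1 + C)) * N x + exp (- (1 + C) * x) * (2 * f x * f' x + 2 * f' x * (c * f x - f' x / x))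
        = exp (- (1 + C) * x) * ((2 * f x * f' x + 2 * f' x * (c * f x - f' x / x)) - (1 + C) * N x)"
        by (simp only: right_diff_distrib)
      show ?thesis unfolding eq by (intro mult_nonneg_nonpos) (use le in auto)
    qed
    ultimately show "\<exists>y. ((\<lambda>r. exp (- (1 + C) * r) * N r) has_real_derivative y) (at x) \<and> y \<le> 0" by blast
  qed
  then have "N R \<le> 0" using f0 f'0 by (simp add: N_def mult_le_0_iff)
  moreover have "0 < N R" using R(2) by (simp add: N_def add_pos_nonneg)
  ultimately show False by simp
qed

text \<open>Bounds the logarithmic derivative of \<open>m\<close> from below, as the boundary term
  at infinity requires. A negative value of \<open>y = m' + K m\<close> would grow in modulus like
  \<open>exp (K * r) / r\<close>, push \<open>m'\<close> below a negative constant, and make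
  \<open>m\<close> negative at a finite radius.\<close>

lemma m'_lower_bound_at_top:
  obtains K R where "0 \<le> K" "1 \<le> R" "\<And>r. R \<le> r \<Longrightarrow> - (K * m r) \<le> m' r"
proof -
  have "eventually (\<lambda>r. \<bar>h r\<bar> < 1) at_top"
    using tendsto_rabs_zero[OF h_tendsto_0] by (rule order_tendstoD) simp
  then obtain R1 where R1: "\<And>r. R1 \<le> r \<Longrightarrow> \<bar>h r\<bar> < 1" by (auto simp: eventually_at_top_linorder)
  define R where "R = max R1 1"
  \<comment> \<open>Large enough for \<open>g + 1 <= K * K - K\<close>: the 1 covers
    \<open>- h\<close>, and the spare \<open>K\<close> covers the derivative of the factor
    \<open>r\<close> in the weighted function.\<close>
  define K where "K = g + 3"
  have K: "3 \<le> K" using g by (simp add: K_def)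
  have "g + 1 \<le> (K - 1) * 1" by (simp add: K_def)
  also have "\<dots> \<le> (K - 1) * K" using K by (intro mult_left_mono) auto
  finally have KK: "g + 1 \<le> K * K - K" by (simp add: algebra_simps)
  define y where "y r = m' r + K * m r" for r
  have "0 \<le> y r0" if r0: "R \<le> r0" for r0
  proof (rule ccontr)
    assume "\<not> 0 \<le> y r0"
    have r00: "1 \<le> r0" using r0 by (simp add: R_def)
    define c where "c = - (r0 * exp (- K * r0) * y r0)"
    have c: "0 < c" using \<open>\<not> 0 \<le> y r0\<close> r00 by (simp add: c_def mult_pos_neg)
    have bound: "m' r \<le> - (c * K)" if r: "r0 \<le> r" for r
    proof -
      have "r * exp (- K * r) * y r \<le> r0 * exp (- K * r0) * y r0"
      proof (rule DERIV_nonpos_imp_nonincreasing[OF r])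
        fix x assume x: "r0 \<le> x" "x \<le> r"
        have x0: "0 < x" "1 \<le> x" "R \<le> x" using x r00 r0 by auto
        have "((\<lambda>r. r * exp (- K * r) * y r) has_real_derivative
           ((1 * exp (- K * x) + x * (exp (- K * x) * (- K))) * y x + x * exp (- K * x) * ((g - h x) * m x - m' x / x + K * m' x))) (at x)"
          unfolding y_def using x0 by (auto intro!: derivative_eq_intros m_deriv m'_deriv simp: algebra_simps)
        moreover have "(1 * exp (- K * x) + x * (exp (- K * x) * (- K))) * y x + x * exp (- K * x) * ((g - h x) * m x - m' x / x + K * m' x)
           = exp (- K * x) * m x * (x * (g - h x - K * K) + K)"
          unfolding y_def using x0 by (simp add: field_simps)
        moreover have "exp (- K * x) * m x * (x * (g - h x - K * K) + K) \<le> 0"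
        proof -
          have "g - h x - K * K \<le> - K" using KK R1[of x] x0 by (simp add: R_def)
          then have "x * (g - h x - K * K) \<le> x * (- K)" using x0 by (intro mult_left_mono) auto
          moreover have "x * (- K) \<le> - K" using x0 K mult_right_mono[of 1 x K] by simp
          ultimately have "x * (g - h x - K * K) + K \<le> 0" by linarith
          then show ?thesis using m_pos[of x] x0 by (intro mult_nonneg_nonpos) auto
        qed
        ultimately show "\<exists>z. ((\<lambda>r. r * exp (- K * r) * y r) has_real_derivative z) (at x) \<and> z \<le> 0" by metis
      qed
      then have 1: "r * exp (- K * r) * y r \<le> - c" by (simp add: c_def)
      have r1: "0 < r" using r r00 by simp
      have "K * r \<le> exp (K * r)" using exp_ge_add_one_self[of "K * r"] by linarith
      then have "c * (K * r) \<le> c * exp (K * r)" using c by simp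
      also have "c \<le> - (r * exp (- K * r) * y r)" using 1 by simp
      then have "c * exp (K * r) \<le> - (r * exp (- K * r) * y r) * exp (K * r)" by (rule mult_right_mono) simp
      also have "\<dots> = - (r * y r) * (exp (- (K * r)) * exp (K * r))" by simp
      also have "\<dots> = - (r * y r)" by (simp add: exp_minus)
      finally have "r * (c * K) \<le> r * (- y r)" by (simp add: mult_ac)
      then have "c * K \<le> - y r" by (simp only: mult_le_cancel_left_pos[OF r1])
      moreover have "0 \<le> K * m r" using K m_pos[of r] r1 by simp
      ultimately show ?thesis by (simp add: y_def)
    qed
    have cK: "0 < c * K" using c K by simp
    \<comment> \<open>Where the line of slope \<open>- (c * K)\<close> bounding \<open>m\<close>
      from above reaches zero.\<close>
    define r where "r = r0 + m r0 / (c * K)"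
    have r: "r0 \<le> r" using m_pos[of r0] r00 cK by (simp add: r_def)
    have "m r + c * K * r \<le> m r0 + c * K * r0"
    proof (rule DERIV_nonpos_imp_nonincreasing[OF r])
      fix x assume x: "r0 \<le> x" "x \<le> r"
      have "((\<lambda>r. m r + c * K * r) has_real_derivative m' x + c * K) (at x)"
        using x r00 by (auto intro!: derivative_eq_intros m_deriv)
      then show "\<exists>y. ((\<lambda>r. m r + c * K * r) has_real_derivative y) (at x) \<and> y \<le> 0" using bound[OF x(1)] by auto
    qed
    moreover have "c * K * (m r0 / (c * K)) = m r0"
      unfolding times_divide_eq_right by (rule nonzero_mult_div_cancel_left) (rule less_imp_neq[OF cK, symmetric])
    then have "c * K * r = c * K * r0 + m r0" by (simp only: r_def distrib_left)
    ultimately have "m r \<le> 0" by linarith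
    then show False using m_pos[of r] r r00 by simp
  qed
  then have "- (K * m r) \<le> m' r" if "R \<le> r" for r using that by (fastforce simp: y_def)
  then show ?thesis using K by (intro that[of K R]) (auto simp: R_def)
qed

end

section \<open>Picone's identity\<close>

lemma absolutely_integrable_continuous_mult:
  fixes k F :: "real \<Rightarrow> real"
  assumes "continuous_on {a..b} k" "F absolutely_integrable_on {a..b}"
  shows "(\<lambda>r. k r * F r) absolutely_integrable_on {a..b}"
  using assms by (intro absolutely_integrable_bounded_measurable_product_real)
    (auto intro: continuous_imp_measurable_on_sets_lebesgue compact_imp_bounded compact_continuous_image)

lemma weighted_am_gm:
  fixes k p s t :: real
  assumes "0 < t" "0 < s"
  shows "\<bar>k * p\<bar> \<le> (t / 2) * (s * p\<^sup>2) + k\<^sup>2 / (2 * t) / s"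
proof -
  have "0 \<le> (t * s * \<bar>p\<bar> - \<bar>k\<bar>)\<^sup>2 / (2 * (t * s))" using assms by simp
  also have "\<dots> = (t / 2) * (s * p\<^sup>2) + k\<^sup>2 / (2 * t) / s - \<bar>k * p\<bar>"
    using assms by (simp add: power2_diff abs_mult field_simps power2_eq_square)
  finally show ?thesis by simp
qed

text \<open>Optimising over \<open>t\<close> recovers Cauchy-Schwarz from the family of Young
  inequalities given by \<open>weighted_am_gm\<close>; the optimal choice is
  \<open>t = x / A\<close>.\<close>

lemma square_le_mult_of_weighted_sum:
  fixes x A B :: real
  assumes t: "\<And>t. 0 < t \<Longrightarrow> 2 * x \<le> t * A + B / t" and "0 \<le> A" "0 \<le> B" "0 \<le> x"
  shows "x\<^sup>2 \<le> A * B"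
proof (cases "x = 0")
  case False
  then have x: "0 < x" using assms by simp
  show ?thesis
  proof (cases "A = 0")
    case True
    \<comment> \<open>With \<open>A = 0\<close> there is no optimal \<open>t\<close>; this large one
      already contradicts \<open>x > 0\<close>.\<close>
    have "2 * x \<le> ((B + 1) / x) * A + B / ((B + 1) / x)" by (rule t) (use x assms in auto)
    then have "2 * x * (B + 1) \<le> B * x" using x assms True by (simp add: field_simps)
    moreover have "0 < x * B + 2 * x" using x assms by (simp add: add_nonneg_pos)
    ultimately show ?thesis by (simp add: algebra_simps)
  next
    case False
    then have A: "0 < A" using assms by simp
    have "2 * x \<le> x / A * A + B / (x / A)" by (rule t) (use x A in auto)
    then have "x \<le> B * A / x" using A by simp
    then show ?thesis using x by (simp add: field_simps power2_eq_square)
  qed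
qed (use assms in simp)

text \<open>\<open>F\<close> may change sign, so its integrals over growing intervals need not be
  monotone. The thresholds are chosen for \<open>\<bar>F\<bar>\<close>, whose small remainder
  controls every larger interval at once; this freedom is needed to pick good endpoints
  afterwards.\<close>

lemma integral_exhaustion:
  fixes F :: "real \<Rightarrow> real"
  assumes F: "F absolutely_integrable_on {0<..}" and e: "0 < \<epsilon>"
  obtains \<delta> R where "0 < \<delta>" "\<delta> \<le> R"
    "\<forall>a b. 0 < a \<longrightarrow> a \<le> \<delta> \<longrightarrow> R \<le> b \<longrightarrow> integral {a..b} F \<le> integral {0<..} F + \<epsilon>"
proof -
  let ?A = "\<lambda>r. \<bar>F r\<bar>"
  let ?S = "\<lambda>n::nat. {1 / Suc n .. real (Suc n)}"
  have Fi: "F integrable_on {0<..}" and A: "?A integrable_on {0<..}" using F by (auto simp: absolutely_integrable_on_def)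
  have sub: "F absolutely_integrable_on {a..b}" if "0 < a" for a b
    by (rule set_integrable_subset[OF F]) (use that in auto)
  have "(\<lambda>n. integral {0<..} (\<lambda>r. if r \<in> ?S n then ?A r else 0)) \<longlonglongrightarrow> integral {0<..} ?A"
  proof (rule dominated_convergence(2)[where h="?A"])
    have Si: "?S n \<inter> {0<..} = ?S n" for n using zero_less_divide_1_iff[of "real (Suc n)"] by (auto intro: less_le_trans[of 0 "1 / real (Suc n)"])
    show "(\<lambda>r. if r \<in> ?S n then ?A r else 0) integrable_on {0<..}" for n
      using sub[of "1 / Suc n" "real (Suc n)"] Si[of n]
      by (subst integrable_restrict_Int) (simp add: absolutely_integrable_on_def del: of_nat_Suc)
    show "norm (if r \<in> ?S n then ?A r else 0) \<le> ?A r" for n r by simp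
    show "(\<lambda>n. if r \<in> ?S n then ?A r else 0) \<longlonglongrightarrow> ?A r" if "r \<in> {0<..}" for r
    proof (rule tendsto_eventually)
      obtain n1 :: nat where n1: "r \<le> n1" using real_arch_simple by blast
      obtain n2 :: nat where n2: "1 / r \<le> n2" using real_arch_simple by blast
      show "\<forall>\<^sub>F n in sequentially. (if r \<in> ?S n then ?A r else 0) = ?A r"
      proof (rule eventually_sequentiallyI[of "max n1 n2"])
        fix n assume "max n1 n2 \<le> n"
        then have n: "r \<le> real (Suc n)" "1 / r \<le> real (Suc n)" using n1 n2 by auto
        have "1 / real (Suc n) \<le> r" using n(2) that by (simp add: field_simps)
        then show "(if r \<in> ?S n then ?A r else 0) = ?A r" using n(1) by simp
      qed
    qed
  qed (rule A)
  then have "\<forall>\<^sub>F n in sequentially. integral {0<..} ?A - \<epsilon> < integral {0<..} (\<lambda>r. if r \<in> ?S n then ?A r else 0)"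
    by (rule order_tendstoD) (use e in simp)
  then obtain n where n: "integral {0<..} ?A - \<epsilon> < integral {0<..} (\<lambda>r. if r \<in> ?S n then ?A r else 0)"
    by (auto simp: eventually_sequentially)
  have S0: "0 < 1 / real (Suc n)" by simp
  have Sn: "?S n \<inter> {0<..} = ?S n" using S0 by (auto intro: less_le_trans[of 0 "1 / real (Suc n)"])
  have n': "integral {0<..} ?A - \<epsilon> < integral (?S n) ?A"
    using n unfolding integral_restrict_Int by (simp add: Sn del: of_nat_Suc)
  have "integral {a..b} F \<le> integral {0<..} F + \<epsilon>" if ab: "0 < a" "a \<le> 1 / Suc n" "real (Suc n) \<le> b" for a b
  proof -
    have I: "{0<..} \<inter> {a..b} = {a..b}" using ab by auto
    let ?r = "\<lambda>G r. if r \<in> {a..b} then G r else (0::real)"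
    have ri: "?r F integrable_on {0<..}" "?r ?A integrable_on {0<..}"
      using sub[OF ab(1), of b] by (simp_all only: integrable_restrict_Int I Int_commute[of "{a..b}"]) (auto simp: absolutely_integrable_on_def)
    have rI: "integral {0<..} (?r G) = integral {a..b} G" for G
      by (simp only: integral_restrict_Int I Int_commute[of "{a..b}"])
    have "integral {a..b} F - integral {0<..} F = integral {0<..} (\<lambda>r. ?r F r - F r)"
      unfolding rI[of F, symmetric] by (rule Henstock_Kurzweil_Integration.integral_diff[OF ri(1) Fi, symmetric])
    also have "\<dots> \<le> integral {0<..} (\<lambda>r. ?A r - ?r ?A r)"
      using ri Fi A by (intro integral_le Henstock_Kurzweil_Integration.integrable_diff) auto
    also have "\<dots> = integral {0<..} ?A - integral {a..b} ?A"
      unfolding rI[of ?A, symmetric] by (rule Henstock_Kurzweil_Integration.integral_diff[OF A ri(2)])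
    also have "integral (?S n) ?A \<le> integral {a..b} ?A"
      using ab sub S0 by (intro integral_subset_le) (auto simp: absolutely_integrable_on_def)
    then have "integral {0<..} ?A - integral {a..b} ?A \<le> \<epsilon>" using n' by linarith
    finally show ?thesis by simp
  qed
  moreover have "1 / real (Suc n) \<le> real (Suc n)" by (simp add: field_simps)
  ultimately show ?thesis using that[of "1 / Suc n" "real (Suc n)"] S0 by blast
qed

text \<open>Positive solutions of the radial equation in divergence form, with coefficient
  \<open>c\<close> regarded as given. Instantiated for \<open>f\<close> with
  \<open>D / r\<^sup>2 - h r\<close> and for \<open>m\<close> with \<open>g - h r\<close>.\<close>

locale jacobi_field =
  fixes \<theta> \<theta>' c :: "real \<Rightarrow> real"
  assumes pos: "\<And>r. 0 < r \<Longrightarrow> 0 < \<theta> r"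
    and D: "\<And>r. 0 < r \<Longrightarrow> (\<theta> has_real_derivative \<theta>' r) (at r)"
    and D2: "\<And>r. 0 < r \<Longrightarrow> ((\<lambda>r. r * \<theta>' r) has_real_derivative r * c r * \<theta> r) (at r)"
    and c_cont: "continuous_on {0<..} c"
begin

text \<open>The logarithmic derivative: \<open>v - q * u\<close> is \<open>\<theta>\<close> times
  the derivative of \<open>u / \<theta>\<close>. By \<open>rq_deriv\<close> it satisfies a Riccati
  equation.\<close>

definition q :: "real \<Rightarrow> real" where "q r = \<theta>' r / \<theta> r"

lemma \<theta>_nonzero: "S \<subseteq> {0<..} \<Longrightarrow> \<forall>s\<in>S. \<theta> s \<noteq> 0"
  using pos by (metis greaterThan_iff less_irrefl subsetD)

lemma cont_\<theta>: "S \<subseteq> {0<..} \<Longrightarrow> continuous_on S \<theta>"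
  by (meson D DERIV_isCont continuous_at_imp_continuous_on greaterThan_iff subsetD)

lemma cont_q:
  assumes S: "S \<subseteq> {0<..}" shows "continuous_on S q"
proof -
  have r\<theta>: "continuous_on S (\<lambda>r. r * \<theta>' r)"
    using D2 S by (meson DERIV_isCont continuous_at_imp_continuous_on greaterThan_iff subsetD)
  have "continuous_on S (\<lambda>r. (r * \<theta>' r) / (r * \<theta> r))"
    using S \<theta>_nonzero[OF S] by (intro continuous_on_divide[OF r\<theta>] continuous_intros cont_\<theta>) (auto simp: subset_eq)
  then show ?thesis by (rule continuous_on_eq) (use S in \<open>auto simp: q_def\<close>)
qed

lemma rq_deriv:
  assumes r: "0 < r" shows "((\<lambda>r. r * q r) has_real_derivative r * c r - r * (q r)\<^sup>2) (at r)"
proof -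
  have "((\<lambda>r. (r * \<theta>' r) / \<theta> r) has_real_derivative (r * c r * \<theta> r * \<theta> r - r * \<theta>' r * \<theta>' r) / (\<theta> r * \<theta> r)) (at r)"
    by (rule DERIV_divide[OF D2[OF r] D[OF r]]) (use pos[OF r] in simp)
  moreover have "(r * c r * \<theta> r * \<theta> r - r * \<theta>' r * \<theta>' r) / (\<theta> r * \<theta> r) = r * c r - r * (q r)\<^sup>2"
    using pos[OF r] by (simp add: q_def field_simps power2_eq_square)
  ultimately show ?thesis by (simp add: q_def)
qed

text \<open>By the Riccati equation,
  \<open>r * (v\<^sup>2 + c * u\<^sup>2) - r * (v - q * u)\<^sup>2\<close> is the derivative of
  \<open>r * q * u\<^sup>2\<close>. Since \<open>u\<close> is only absolutely continuous, the
  product rule used is \<open>primitive_mult\<close>.\<close>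

lemma picone:
  assumes u: "has_primitive v u" and v2: "(\<lambda>r. (v r)\<^sup>2 * r) absolutely_integrable_on {a..b}" and ab: "0 < a" "a \<le> b"
  shows "(\<lambda>r. r * (v r - q r * u r)\<^sup>2) absolutely_integrable_on {a..b}"
    and "integral {a..b} (\<lambda>r. r * ((v r)\<^sup>2 + c r * (u r)\<^sup>2)) = integral {a..b} (\<lambda>r. r * (v r - q r * u r)\<^sup>2) + (b * q b * (u b)\<^sup>2 - a * q a * (u a)\<^sup>2)"
proof -
  have S: "{a..b} \<subseteq> {0<..}" using ab by auto
  have uc: "continuous_on {a..b} u" by (rule has_primitive_continuous[OF u ab(1)])
  have vi: "v absolutely_integrable_on {a..b}" by (rule has_primitiveD(1)[OF u ab])
  have ux: "integral {a..x} v = u x - u a" if "x \<in> {a..b}" for x using has_primitiveD(3)[OF u ab(1)] that by auto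
  note uu = primitive_mult[OF ab(2) vi vi ux ux]
  let ?U = "\<lambda>r. v r * u r + u r * v r" and ?\<beta> = "\<lambda>r. r * q r" and ?\<beta>' = "\<lambda>r. r * c r - r * (q r)\<^sup>2"
  have c': "continuous_on {a..b} ?\<beta>'" by (intro continuous_intros cont_q S continuous_on_subset[OF c_cont])
  have \<beta>i: "?\<beta>' absolutely_integrable_on {a..b}" by (rule absolutely_integrable_continuous_real[OF c'])
  have \<beta>x: "integral {a..x} ?\<beta>' = ?\<beta> x - ?\<beta> a" if "x \<in> {a..b}" for x
  proof -
    have "(?\<beta>' has_integral ?\<beta> x - ?\<beta> a) {a..x}"
      by (rule fundamental_theorem_of_calculus)
       (use that rq_deriv ab in \<open>auto simp: has_real_derivative_iff_has_vector_derivative[symmetric] intro: has_field_derivative_at_within\<close>)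
    then show ?thesis by (rule integral_unique)
  qed
  have Ux: "integral {a..x} ?U = u x * u x - u a * u a" if "x \<in> {a..b}" for x
    using primitive_mult(2)[of a x v v u u] vi ux that absolutely_integrable_on_subinterval[OF vi, of a x] by auto
  have P: "(\<lambda>r. ?U r * ?\<beta> r + u r * u r * ?\<beta>' r) absolutely_integrable_on {a..b}"
    "integral {a..b} (\<lambda>r. ?U r * ?\<beta> r + u r * u r * ?\<beta>' r) = u b * u b * ?\<beta> b - u a * u a * ?\<beta> a"
    by (rule primitive_mult[OF ab(2) uu(1) \<beta>i, where A="\<lambda>r. u r * u r" and B="?\<beta>"]; use Ux \<beta>x in simp)+
  have "(\<lambda>r. (v r)\<^sup>2 * r + ((- 2 * r * q r * u r) * v r + r * (q r)\<^sup>2 * (u r)\<^sup>2)) absolutely_integrable_on {a..b}"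
    by (intro set_integral_add v2 absolutely_integrable_continuous_mult vi absolutely_integrable_continuous_real continuous_intros uc cont_q S)
  also have "(\<lambda>r. (v r)\<^sup>2 * r + ((- 2 * r * q r * u r) * v r + r * (q r)\<^sup>2 * (u r)\<^sup>2)) = (\<lambda>r. r * (v r - q r * u r)\<^sup>2)"
    by (auto simp: fun_eq_iff power2_eq_square algebra_simps)
  finally show I: "(\<lambda>r. r * (v r - q r * u r)\<^sup>2) absolutely_integrable_on {a..b}" .
  have "(\<lambda>r. r * ((v r)\<^sup>2 + c r * (u r)\<^sup>2)) = (\<lambda>r. r * (v r - q r * u r)\<^sup>2 + (?U r * ?\<beta> r + u r * u r * ?\<beta>' r))"
    by (auto simp: fun_eq_iff power2_eq_square algebra_simps)
  then have "integral {a..b} (\<lambda>r. r * ((v r)\<^sup>2 + c r * (u r)\<^sup>2)) = integral {a..b} (\<lambda>r. r * (v r - q r * u r)\<^sup>2) + integral {a..b} (\<lambda>r. ?U r * ?\<beta> r + u r * u r * ?\<beta>' r)"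
    using I P(1) by (simp add: Henstock_Kurzweil_Integration.integral_add set_lebesgue_integral_eq_integral(1))
  then show "integral {a..b} (\<lambda>r. r * ((v r)\<^sup>2 + c r * (u r)\<^sup>2)) = integral {a..b} (\<lambda>r. r * (v r - q r * u r)\<^sup>2) + (b * q b * (u b)\<^sup>2 - a * q a * (u a)\<^sup>2)"
    unfolding P(2) by (simp add: power2_eq_square algebra_simps)
qed

text \<open>The boundary term enters with opposite signs at the two ends, so it needs an upper bound
  near 0 and a lower bound far out, each at arbitrarily extreme radii only. Shrinking to
  \<open>{x..y}\<close> loses nothing because the remaining integrand is nonnegative.\<close>

lemma picone_global:
  assumes u: "has_primitive v u" and v2: "(\<lambda>r. (v r)\<^sup>2 * r) absolutely_integrable_on {0<..}"
    and F: "(\<lambda>r. r * ((v r)\<^sup>2 + c r * (u r)\<^sup>2)) absolutely_integrable_on {0<..}"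
    and near: "\<And>\<epsilon> \<delta>. 0 < \<epsilon> \<Longrightarrow> 0 < \<delta> \<Longrightarrow> \<exists>a. 0 < a \<and> a \<le> \<delta> \<and> a * q a * (u a)\<^sup>2 \<le> \<epsilon>"
    and far: "\<And>\<epsilon> R. 0 < \<epsilon> \<Longrightarrow> \<exists>b\<ge>R. - \<epsilon> \<le> b * q b * (u b)\<^sup>2"
    and xy: "0 < x" "x \<le> y"
  shows "integral {x..y} (\<lambda>r. r * (v r - q r * u r)\<^sup>2) \<le> integral {0<..} (\<lambda>r. r * ((v r)\<^sup>2 + c r * (u r)\<^sup>2))"
proof (rule field_le_epsilon)
  let ?F = "\<lambda>r. r * ((v r)\<^sup>2 + c r * (u r)\<^sup>2)" and ?G = "\<lambda>r. r * (v r - q r * u r)\<^sup>2"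
  fix e :: real assume e: "0 < e"
  \<comment> \<open>One third each for the exhaustion and the two boundary terms.\<close>
  have "0 < e / 3" using e by simp
  obtain \<delta> R where \<delta>: "0 < \<delta>" "\<delta> \<le> R" and ex: "\<forall>a b. 0 < a \<longrightarrow> a \<le> \<delta> \<longrightarrow> R \<le> b \<longrightarrow> integral {a..b} ?F \<le> integral {0<..} ?F + e / 3"
    using integral_exhaustion[OF F \<open>0 < e / 3\<close>] .
  obtain a where a: "0 < a" "a \<le> min \<delta> x" "a * q a * (u a)\<^sup>2 \<le> e / 3" using near[of "e/3" "min \<delta> x"] e \<delta> xy by auto
  obtain b where b: "max R y \<le> b" "- (e / 3) \<le> b * q b * (u b)\<^sup>2" using far[of "e/3" "max R y"] e by auto
  have v2': "(\<lambda>r. (v r)\<^sup>2 * r) absolutely_integrable_on {s..t}" if "0 < s" for s t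
    by (rule set_integrable_subset[OF v2]) (use that in auto)
  have ab: "a \<le> b" using a b xy by auto
  have "integral {x..y} ?G \<le> integral {a..b} ?G"
    using a b xy by (intro integral_subset_le set_lebesgue_integral_eq_integral(1)[OF picone(1)[OF u v2']]) auto
  also have "\<dots> = integral {a..b} ?F - (b * q b * (u b)\<^sup>2 - a * q a * (u a)\<^sup>2)"
    using picone(2)[OF u v2'[OF a(1)] a(1) ab] by simp
  also have "\<dots> \<le> integral {a..b} ?F + 2 * e / 3" using a b by simp
  also have "\<dots> \<le> integral {0<..} ?F + e" using ex[rule_format, of a b] a b by simp
  finally show "integral {x..y} ?G \<le> integral {0<..} ?F + e" .
qed

text \<open>Cauchy-Schwarz for the derivative \<open>(v - q * u) / \<theta>\<close> of
  \<open>u / \<theta>\<close>, with weights \<open>r\<close> and \<open>1 / r\<close>; the second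
  produces the logarithm. The factor \<open>T\<close>, later the value of \<open>\<theta>\<close> at
  \<open>x\<close>, prevents loss where \<open>\<theta>\<close> is small, since only the ratio of
  \<open>T\<close> to \<open>\<theta>\<close> counts.\<close>

lemma oscillation:
  assumes u: "has_primitive v u" and v2: "(\<lambda>r. (v r)\<^sup>2 * r) absolutely_integrable_on {0<..}" and xy: "0 < x" "x \<le> y"
    and Q: "integral {x..y} (\<lambda>r. r * (v r - q r * u r)\<^sup>2) \<le> Q"
    and ratio: "\<And>s. s \<in> {x..y} \<Longrightarrow> T\<^sup>2 \<le> \<Lambda> * (\<theta> s)\<^sup>2" and \<Lambda>: "0 \<le> \<Lambda>"
  shows "(T * (u y / \<theta> y - u x / \<theta> x))\<^sup>2 \<le> Q * (\<Lambda> * ln (y / x))"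
proof -
  have S: "{x..y} \<subseteq> {0<..}" using xy by auto
  have v2': "(\<lambda>r. (v r)\<^sup>2 * r) absolutely_integrable_on {x..y}" by (rule set_integrable_subset[OF v2]) (use S in auto)
  note p1 = picone(1)[OF u v2' xy]
  have vi: "v absolutely_integrable_on {x..y}" by (rule has_primitiveD(1)[OF u xy])
  have ux: "integral {x..s} v = u s - u x" if "s \<in> {x..y}" for s using has_primitiveD(3)[OF u xy(1)] that by auto
  let ?B = "\<lambda>s. T / \<theta> s" and ?B' = "\<lambda>s. - (T * (q s / \<theta> s))"
  have c': "continuous_on {x..y} ?B'" using \<theta>_nonzero[OF S] by (intro continuous_intros cont_q cont_\<theta> S) auto
  have Bd: "(?B has_real_derivative ?B' s) (at s)" if "0 < s" for s
    using pos[OF that] by (auto intro!: derivative_eq_intros D[OF that] simp: q_def power2_eq_square)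
  have Bx: "integral {x..s} ?B' = ?B s - ?B x" if "s \<in> {x..y}" for s
  proof -
    have "(?B' has_integral ?B s - ?B x) {x..s}"
      by (rule fundamental_theorem_of_calculus)
       (use that Bd xy in \<open>auto simp: has_real_derivative_iff_has_vector_derivative[symmetric] intro: has_field_derivative_at_within\<close>)
    then show ?thesis by (rule integral_unique)
  qed
  note P = primitive_mult[OF xy(2) vi absolutely_integrable_continuous_real[OF c'] ux Bx]
  let ?p = "\<lambda>s. v s - q s * u s"
  have eq: "v s * ?B s + u s * ?B' s = T / \<theta> s * ?p s" for s by (simp add: algebra_simps)
  have Ii: "(\<lambda>s. T / \<theta> s * ?p s) integrable_on {x..y}" using P(1) unfolding eq by (rule set_lebesgue_integral_eq_integral(1))
  have I: "integral {x..y} (\<lambda>s. T / \<theta> s * ?p s) = T * (u y / \<theta> y - u x / \<theta> x)"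
    using P(2) unfolding eq by (simp add: algebra_simps)
  have "\<bar>T * (u y / \<theta> y - u x / \<theta> x)\<bar>\<^sup>2 \<le> Q * (\<Lambda> * ln (y / x))"
  proof (rule square_le_mult_of_weighted_sum)
    fix t :: real assume t: "0 < t"
    have inv: "(\<lambda>s. (\<Lambda> / (2 * t)) / s) integrable_on {x..y}" "integral {x..y} (\<lambda>s. (\<Lambda> / (2 * t)) / s) = \<Lambda> / (2 * t) * ln (y / x)"
      by (rule integral_inverse_Icc[OF xy])+
    have pi: "(\<lambda>s. (t / 2) * (s * (?p s)\<^sup>2)) integrable_on {x..y}"
      using set_lebesgue_integral_eq_integral(1)[OF set_integrable_mult_right[OF p1, of "t/2"]] by simp
    have "\<bar>integral {x..y} (\<lambda>s. T / \<theta> s * ?p s)\<bar> \<le> integral {x..y} (\<lambda>s. (t / 2) * (s * (?p s)\<^sup>2) + (\<Lambda> / (2 * t)) / s)"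
      unfolding real_norm_def[symmetric]
    proof (rule integral_norm_bound_integral[OF Ii integrable_add[OF pi inv(1)]])
      fix s assume s: "s \<in> {x..y}"
      have s0: "0 < s" using s xy by auto
      define k where "k = T / \<theta> s"
      have k2: "k\<^sup>2 \<le> \<Lambda>" using ratio[OF s] pos[OF s0] by (simp add: k_def power_divide field_simps)
      have "\<bar>k * ?p s\<bar> \<le> (t / 2) * (s * (?p s)\<^sup>2) + k\<^sup>2 / (2 * t) / s" by (rule weighted_am_gm[OF t s0])
      also have "k\<^sup>2 / (2 * t) / s \<le> \<Lambda> / (2 * t) / s" using k2 t s0 by (intro divide_right_mono) auto
      finally show "norm (T / \<theta> s * ?p s) \<le> (t / 2) * (s * (?p s)\<^sup>2) + (\<Lambda> / (2 * t)) / s" by (simp add: k_def)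
    qed
    also have "\<dots> = (t / 2) * integral {x..y} (\<lambda>s. s * (?p s)\<^sup>2) + \<Lambda> / (2 * t) * ln (y / x)"
      unfolding Henstock_Kurzweil_Integration.integral_add[OF pi inv(1)] inv(2) by simp
    also have "\<dots> \<le> (t / 2) * Q + \<Lambda> / (2 * t) * ln (y / x)" using Q t by simp
    finally show "2 * \<bar>T * (u y / \<theta> y - u x / \<theta> x)\<bar> \<le> t * Q + (\<Lambda> * ln (y / x)) / t" unfolding I by simp
  next
    have "0 \<le> integral {x..y} (\<lambda>r. r * (v r - q r * u r)\<^sup>2)"
      using xy by (intro Henstock_Kurzweil_Integration.integral_nonneg set_lebesgue_integral_eq_integral(1)[OF p1]) auto
    then show "0 \<le> Q" using Q by simp
    show "0 \<le> \<Lambda> * ln (y / x)" using \<Lambda> xy by simp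
  qed simp
  then show ?thesis by simp
qed

end

section \<open>The second variation\<close>

lemma has_integral_const_halfopen:
  fixes k R :: real
  assumes "0 \<le> R"
  shows "((\<lambda>r. if r \<in> {0<..R} then k else 0) has_integral (k * R)) {0<..}"
proof -
  have "((\<lambda>_. k) has_integral (k * R)) {0..R}" using has_integral_const_real[of k 0 R] assms by (simp add: mult.commute)
  moreover have "negligible {x \<in> {0..R} - {0<..R}. k \<noteq> 0}" by (rule negligible_subset[of "{0}"]) auto
  moreover have "negligible {x \<in> {0<..R} - {0..R}. k \<noteq> 0}" by (rule negligible_subset[of "{}"]) auto
  ultimately have "((\<lambda>_. k) has_integral (k * R)) {0<..R}"
    by (subst has_integral_spike_set_eq[where T="{0..R}"]) auto
  then show ?thesis by (subst has_integral_restrict) auto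
qed

lemma bounded_continuous_mult_integrable:
  fixes k F :: "real \<Rightarrow> real"
  assumes "continuous_on {0<..} k" "\<And>r. 0 < r \<Longrightarrow> \<bar>k r\<bar> \<le> B" "F absolutely_integrable_on {0<..}"
  shows "(\<lambda>r. k r * F r) absolutely_integrable_on {0<..}"
proof (rule absolutely_integrable_bounded_measurable_product_real)
  show "k \<in> borel_measurable (lebesgue_on {0<..})"
    using assms(1) by (intro continuous_imp_measurable_on_sets_lebesgue) auto
  show "bounded (k ` {0<..})" using assms(2) by (auto simp: bounded_iff)
qed (use assms(3) in auto)

lemma absolutely_integrable_small_near_0:
  fixes F :: "real \<Rightarrow> real"
  assumes F: "F absolutely_integrable_on {0<..}" and nn: "\<And>r. 0 < r \<Longrightarrow> 0 \<le> F r" and pos: "0 < \<epsilon>" "0 < \<delta>"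
  shows "\<exists>r. 0 < r \<and> r \<le> min \<delta> 1 \<and> r * F r < \<epsilon>"
proof -
  obtain I where "\<forall>a b. 0 < a \<longrightarrow> F absolutely_integrable_on {a..b} \<and> integral {a..b} F \<le> I"
    using absolutely_integrable_bounded_integrals[OF F] .
  then show ?thesis
    using pos nn by (intro small_values_near_0[where I=I]) (auto simp: set_lebesgue_integral_eq_integral(1))
qed

lemma mult_ln_divide_le:
  fixes x R :: real assumes "0 < x" "x \<le> R" shows "x * ln (R / x) \<le> R"
proof -
  have "ln (R / x) \<le> R / x" using ln_le_minus_one[of "R / x"] assms by simp
  then show ?thesis using assms by (simp add: field_simps)
qed

text \<open>
  Applied with \<open>P1 = u / f\<close> and \<open>P2 = w / m\<close> frozen at one radius and \<open>\<rho>1\<close>, \<open>\<rho>2\<close> the values of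
  \<open>m\<^sup>2 / f\<^sup>2\<close> at two radii; the ratio is not constant because \<open>m\<close> decays while \<open>f\<close> tends to 1.
\<close>

lemma two_ratio_bound:
  fixes P1 P2 \<rho>1 \<rho>2 \<eta> \<rho> E :: real
  assumes "\<bar>P1 + \<rho>1 * P2\<bar> \<le> E" "\<bar>P1 + \<rho>2 * P2\<bar> \<le> E" "\<eta> \<le> \<rho>1 - \<rho>2" "0 < \<eta>" "0 \<le> \<rho>2" "\<rho>2 \<le> \<rho>"
  shows "\<bar>P2\<bar> \<le> 2 * E / \<eta>" "\<bar>P1\<bar> \<le> E + \<rho> * (2 * E / \<eta>)"
proof -
  have "\<eta> * \<bar>P2\<bar> \<le> (\<rho>1 - \<rho>2) * \<bar>P2\<bar>" using assms by (intro mult_right_mono) auto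
  also have "\<dots> = \<bar>(\<rho>1 - \<rho>2) * P2\<bar>" using assms by (simp add: abs_mult)
  also have "\<dots> = \<bar>(P1 + \<rho>1 * P2) - (P1 + \<rho>2 * P2)\<bar>" by (simp add: left_diff_distrib)
  also have "\<dots> \<le> 2 * E" using assms(1,2) by linarith
  finally show P2: "\<bar>P2\<bar> \<le> 2 * E / \<eta>" using assms by (simp add: field_simps)
  have "\<bar>P1\<bar> \<le> \<bar>P1 + \<rho>2 * P2\<bar> + \<bar>\<rho>2 * P2\<bar>" by linarith
  also have "\<bar>\<rho>2 * P2\<bar> \<le> \<rho> * (2 * E / \<eta>)" unfolding abs_mult using assms P2 by (intro mult_mono) auto
  finally show "\<bar>P1\<bar> \<le> E + \<rho> * (2 * E / \<eta>)" using assms(2) by linarith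
qed

context gl_vortex
begin

sublocale F: jacobi_field f f' "\<lambda>r. D / r\<^sup>2 - h r"
proof
  show "((\<lambda>r. r * f' r) has_real_derivative r * (D / r\<^sup>2 - h r) * f r) (at r)" if "0 < r" for r
    using rf'_deriv[OF that] that by (simp add: algebra_simps power2_eq_square)
  show "continuous_on {0<..} (\<lambda>r. D / r\<^sup>2 - h r)" by (intro continuous_intros cont) auto
qed (use f_pos f_deriv in auto)

sublocale M: jacobi_field m m' "\<lambda>r. g - h r"
proof
  show "((\<lambda>r. r * m' r) has_real_derivative r * (g - h r) * m r) (at r)" if "0 < r" for r
    using rm'_deriv[OF that] .
  show "continuous_on {0<..} (\<lambda>r. g - h r)" by (intro continuous_intros cont) auto
qed (use m_pos m_deriv in auto)

text \<open>Works with continuous representatives and with their derivatives as separate data: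
  values at single radii become meaningful, and the choice in \<open>weak_deriv\<close> does not
  enter the estimates.\<close>

definition perturbation :: "(real \<Rightarrow> real) \<Rightarrow> (real \<Rightarrow> real) \<Rightarrow> (real \<Rightarrow> real) \<Rightarrow> (real \<Rightarrow> real) \<Rightarrow> bool" where
  "perturbation u v w z \<longleftrightarrow> has_primitive v u \<and> has_primitive z w \<and>
    (\<lambda>r. (v r)\<^sup>2 * r) absolutely_integrable_on {0<..} \<and> (\<lambda>r. (u r)\<^sup>2 * r) absolutely_integrable_on {0<..} \<and>
    (\<lambda>r. (u r)\<^sup>2 / r\<^sup>2 * r) absolutely_integrable_on {0<..} \<and>
    (\<lambda>r. (z r)\<^sup>2 * r) absolutely_integrable_on {0<..} \<and> (\<lambda>r. (w r)\<^sup>2 * r) absolutely_integrable_on {0<..}"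

lemma perturbationD:
  assumes "perturbation u v w z"
  shows "has_primitive v u" "has_primitive z w"
    "(\<lambda>r. (v r)\<^sup>2 * r) absolutely_integrable_on {0<..}" "(\<lambda>r. (u r)\<^sup>2 * r) absolutely_integrable_on {0<..}"
    "(\<lambda>r. (u r)\<^sup>2 / r\<^sup>2 * r) absolutely_integrable_on {0<..}"
    "(\<lambda>r. (z r)\<^sup>2 * r) absolutely_integrable_on {0<..}" "(\<lambda>r. (w r)\<^sup>2 * r) absolutely_integrable_on {0<..}"
    "continuous_on {0<..} u" "continuous_on {0<..} w"
  using assms has_primitive_continuous_on_halfline by (auto simp: perturbation_def)

definition quadratic_density :: "(real \<Rightarrow> real) \<Rightarrow> (real \<Rightarrow> real) \<Rightarrow> (real \<Rightarrow> real) \<Rightarrow> (real \<Rightarrow> real) \<Rightarrow> real \<Rightarrow> real" where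
  "quadratic_density u v w z r = ((v r)\<^sup>2 + (z r)\<^sup>2 + D / r\<^sup>2 * (u r)\<^sup>2 + g * (w r)\<^sup>2 - h r * ((u r)\<^sup>2 + (w r)\<^sup>2)
     + 2 * (f r * u r + m r * w r)\<^sup>2) * r"

definition quadratic_form :: "(real \<Rightarrow> real) \<Rightarrow> (real \<Rightarrow> real) \<Rightarrow> (real \<Rightarrow> real) \<Rightarrow> (real \<Rightarrow> real) \<Rightarrow> real" where
  "quadratic_form u v w z = integral {0<..} (quadratic_density u v w z)"

lemma f_m_square_le:
  assumes "\<bar>h r\<bar> \<le> B" shows "(f r)\<^sup>2 + (m r)\<^sup>2 \<le> 1 + B"
  using assms by (simp add: h_def abs_le_iff)

lemma coupling_square_le:
  "(f r * x + m r * y)\<^sup>2 \<le> ((f r)\<^sup>2 + (m r)\<^sup>2) * (x\<^sup>2 + y\<^sup>2)"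
proof -
  have "((f r)\<^sup>2 + (m r)\<^sup>2) * (x\<^sup>2 + y\<^sup>2) - (f r * x + m r * y)\<^sup>2 = (f r * y - m r * x)\<^sup>2"
    by (simp add: power2_eq_square algebra_simps)
  then show ?thesis using zero_le_power2[of "f r * y - m r * x"] by linarith
qed

lemma parts_integrable:
  assumes p: "perturbation u v w z"
  shows "(\<lambda>r. r * ((v r)\<^sup>2 + (D / r\<^sup>2 - h r) * (u r)\<^sup>2)) absolutely_integrable_on {0<..}"
    and "(\<lambda>r. r * ((z r)\<^sup>2 + (g - h r) * (w r)\<^sup>2)) absolutely_integrable_on {0<..}"
    and "(\<lambda>r. 2 * (r * (f r * u r + m r * w r)\<^sup>2)) absolutely_integrable_on {0<..}"
proof -
  note P = perturbationD[OF p]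
  obtain B where B: "1 \<le> B" "\<And>r. 0 < r \<Longrightarrow> \<bar>h r\<bar> \<le> B" using h_bounded by blast
  have hu: "(\<lambda>r. h r * ((u r)\<^sup>2 * r)) absolutely_integrable_on {0<..}" and hw: "(\<lambda>r. h r * ((w r)\<^sup>2 * r)) absolutely_integrable_on {0<..}"
    using B(2) by (auto intro!: bounded_continuous_mult_integrable cont P)
  have "(\<lambda>r. (v r)\<^sup>2 * r + D * ((u r)\<^sup>2 / r\<^sup>2 * r) - h r * ((u r)\<^sup>2 * r)) absolutely_integrable_on {0<..}"
    by (intro set_integral_diff set_integral_add set_integrable_mult_right hu P)
  then show "(\<lambda>r. r * ((v r)\<^sup>2 + (D / r\<^sup>2 - h r) * (u r)\<^sup>2)) absolutely_integrable_on {0<..}"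
    by (subst set_integrable_cong[OF refl refl]) (auto simp: algebra_simps)
  have "(\<lambda>r. (z r)\<^sup>2 * r + g * ((w r)\<^sup>2 * r) - h r * ((w r)\<^sup>2 * r)) absolutely_integrable_on {0<..}"
    by (intro set_integral_diff set_integral_add set_integrable_mult_right hw P)
  then show "(\<lambda>r. r * ((z r)\<^sup>2 + (g - h r) * (w r)\<^sup>2)) absolutely_integrable_on {0<..}"
    by (subst set_integrable_cong[OF refl refl]) (auto simp: algebra_simps)
  have "(\<lambda>r. (2 * (1 + B)) * ((u r)\<^sup>2 * r + (w r)\<^sup>2 * r)) absolutely_integrable_on {0<..}"
    by (intro set_integral_add set_integrable_mult_right P)
  then have i: "(\<lambda>r. (2 * (1 + B)) * ((u r)\<^sup>2 * r + (w r)\<^sup>2 * r)) integrable_on {0<..}" by (rule set_lebesgue_integral_eq_integral(1))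
  show "(\<lambda>r. 2 * (r * (f r * u r + m r * w r)\<^sup>2)) absolutely_integrable_on {0<..}"
  proof (rule measurable_bounded_by_integrable_imp_absolutely_integrable[OF _ _ i])
    show "(\<lambda>r. 2 * (r * (f r * u r + m r * w r)\<^sup>2)) \<in> borel_measurable (lebesgue_on {0<..})"
      by (intro continuous_imp_measurable_on_sets_lebesgue continuous_intros cont P) auto
    fix r :: real assume "r \<in> {0<..}"
    then have r: "0 < r" by simp
    have "(f r * u r + m r * w r)\<^sup>2 \<le> ((f r)\<^sup>2 + (m r)\<^sup>2) * ((u r)\<^sup>2 + (w r)\<^sup>2)" by (rule coupling_square_le)
    also have "\<dots> \<le> (1 + B) * ((u r)\<^sup>2 + (w r)\<^sup>2)" by (intro mult_right_mono f_m_square_le r B) auto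
    finally have "2 * (r * (f r * u r + m r * w r)\<^sup>2) \<le> 2 * (r * ((1 + B) * ((u r)\<^sup>2 + (w r)\<^sup>2)))" using r by simp
    then show "norm (2 * (r * (f r * u r + m r * w r)\<^sup>2)) \<le> (2 * (1 + B)) * ((u r)\<^sup>2 * r + (w r)\<^sup>2 * r)"
      using r by (simp add: algebra_simps)
  qed auto
qed

lemma quadratic_density_eq:
  assumes "0 < r"
  shows "quadratic_density u v w z r = r * ((v r)\<^sup>2 + (D / r\<^sup>2 - h r) * (u r)\<^sup>2) + r * ((z r)\<^sup>2 + (g - h r) * (w r)\<^sup>2) + 2 * (r * (f r * u r + m r * w r)\<^sup>2)"
  by (simp add: quadratic_density_def algebra_simps)

lemma quadratic_form_eq:
  assumes p: "perturbation u v w z"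
  shows "quadratic_density u v w z absolutely_integrable_on {0<..}"
    and "quadratic_form u v w z = integral {0<..} (\<lambda>r. r * ((v r)\<^sup>2 + (D / r\<^sup>2 - h r) * (u r)\<^sup>2))
      + integral {0<..} (\<lambda>r. r * ((z r)\<^sup>2 + (g - h r) * (w r)\<^sup>2)) + integral {0<..} (\<lambda>r. 2 * (r * (f r * u r + m r * w r)\<^sup>2))"
proof -
  let ?S = "\<lambda>r. r * ((v r)\<^sup>2 + (D / r\<^sup>2 - h r) * (u r)\<^sup>2) + r * ((z r)\<^sup>2 + (g - h r) * (w r)\<^sup>2) + 2 * (r * (f r * u r + m r * w r)\<^sup>2)"
  note I = parts_integrable[OF p]
  have S: "?S absolutely_integrable_on {0<..}" by (intro set_integral_add I)
  then show "quadratic_density u v w z absolutely_integrable_on {0<..}"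
    by (subst set_integrable_cong[OF refl refl, where f'="?S"]) (auto simp: quadratic_density_eq)
  have "quadratic_form u v w z = integral {0<..} ?S"
    unfolding quadratic_form_def by (rule Henstock_Kurzweil_Integration.integral_cong) (simp add: quadratic_density_eq)
  also have "\<dots> = integral {0<..} (\<lambda>r. r * ((v r)\<^sup>2 + (D / r\<^sup>2 - h r) * (u r)\<^sup>2))
      + integral {0<..} (\<lambda>r. r * ((z r)\<^sup>2 + (g - h r) * (w r)\<^sup>2)) + integral {0<..} (\<lambda>r. 2 * (r * (f r * u r + m r * w r)\<^sup>2))"
    by (simp only: Henstock_Kurzweil_Integration.integral_add integrable_add set_lebesgue_integral_eq_integral(1)[OF I(1)]
       set_lebesgue_integral_eq_integral(1)[OF I(2)] set_lebesgue_integral_eq_integral(1)[OF I(3)])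
  finally show "quadratic_form u v w z = integral {0<..} (\<lambda>r. r * ((v r)\<^sup>2 + (D / r\<^sup>2 - h r) * (u r)\<^sup>2))
      + integral {0<..} (\<lambda>r. r * ((z r)\<^sup>2 + (g - h r) * (w r)\<^sup>2)) + integral {0<..} (\<lambda>r. 2 * (r * (f r * u r + m r * w r)\<^sup>2))" .
qed

section \<open>Boundary terms in Picone's identity\<close>

text \<open>\<open>r * q r\<close> is bounded above near 0, and the extra integrability of
  \<open>u\<^sup>2 / r\<^sup>2 * r\<close> in \<open>X_space\<close> makes \<open>u\<close> small
  along a sequence of radii.\<close>

lemma f_boundary_near_0:
  assumes p: "perturbation u v w z" and pos: "0 < \<epsilon>" "0 < \<delta>"
  shows "\<exists>a. 0 < a \<and> a \<le> \<delta> \<and> a * F.q a * (u a)\<^sup>2 \<le> \<epsilon>"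
proof -
  obtain K where K: "0 \<le> K" "\<And>r. 0 < r \<Longrightarrow> r \<le> 1 \<Longrightarrow> r * f' r \<le> K * f r" using rf'_le_near_0 by blast
  obtain a where a: "0 < a" "a \<le> min \<delta> 1" "a * ((u a)\<^sup>2 / a\<^sup>2 * a) < \<epsilon> / (K + 1)"
    using absolutely_integrable_small_near_0[OF perturbationD(5)[OF p], of "\<epsilon> / (K + 1)" \<delta>] K pos by auto
  have "(u a)\<^sup>2 < \<epsilon> / (K + 1)" using a by (simp add: power2_eq_square)
  then have u: "(K + 1) * (u a)\<^sup>2 \<le> \<epsilon>" using K by (simp add: field_simps)
  have "a * F.q a \<le> K" using K(2)[of a] a f_pos[of a] by (simp add: F.q_def field_simps)
  then have "a * F.q a * (u a)\<^sup>2 \<le> (K + 1) * (u a)\<^sup>2" by (intro mult_right_mono) auto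
  with u a show ?thesis by (intro exI[of _ a]) auto
qed

text \<open>Without a Hardy term \<open>w\<close> may be unbounded at 0. Here the logarithmic
  derivative helps: \<open>r * q r\<close> is bounded above by a multiple of
  \<open>r\<^sup>2\<close>, and \<open>r\<^sup>2 * (w r)\<^sup>2\<close> is small along a
  sequence.\<close>

lemma m_boundary_near_0:
  assumes p: "perturbation u v w z" and pos: "0 < \<epsilon>" "0 < \<delta>"
  shows "\<exists>a. 0 < a \<and> a \<le> \<delta> \<and> a * M.q a * (w a)\<^sup>2 \<le> \<epsilon>"
proof -
  obtain C where C: "0 \<le> C" "\<And>r. 0 < r \<Longrightarrow> r \<le> 1 \<Longrightarrow> r * m' r \<le> C * r\<^sup>2" using rm'_le_near_0 by blast
  obtain \<mu> where \<mu>: "0 < \<mu>" "\<And>r. 0 < r \<Longrightarrow> r \<le> 1 \<Longrightarrow> \<mu> \<le> m r" using m_lower_bound by blast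
  define K where "K = C / \<mu> + 1"
  have K: "0 < K" using C \<mu> by (simp add: K_def add_nonneg_pos)
  obtain a where a: "0 < a" "a \<le> min \<delta> 1" "a * ((w a)\<^sup>2 * a) < \<epsilon> / K"
    using absolutely_integrable_small_near_0[OF perturbationD(7)[OF p], of "\<epsilon> / K" \<delta>] K pos by auto
  have w: "K * (a\<^sup>2 * (w a)\<^sup>2) \<le> \<epsilon>" using a(3) K by (simp add: field_simps power2_eq_square)
  have "a * M.q a = (a * m' a) / m a" by (simp add: M.q_def)
  also have "\<dots> \<le> C * a\<^sup>2 / m a" using C(2)[of a] a m_pos[of a] by (intro divide_right_mono) auto
  also have "\<dots> \<le> C * a\<^sup>2 / \<mu>" using C \<mu>(1) \<mu>(2)[of a] a m_pos[of a] by (intro divide_left_mono) auto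
  also have "\<dots> \<le> K * a\<^sup>2" by (simp add: K_def algebra_simps)
  finally have "a * M.q a * (w a)\<^sup>2 \<le> K * a\<^sup>2 * (w a)\<^sup>2" by (rule mult_right_mono) simp
  then have "a * M.q a * (w a)\<^sup>2 \<le> \<epsilon>" using w by (simp add: mult.assoc)
  with a show ?thesis by (intro exI[of _ a]) auto
qed

text \<open>At a suitable large radius \<open>r * f' r >= -1\<close> by the energy tail,
  \<open>f > 1/2\<close>, and \<open>u\<^sup>2\<close> is small, so the boundary term cannot be very
  negative.\<close>

lemma f_boundary_at_top:
  assumes p: "perturbation u v w z" and pos: "0 < \<epsilon>"
  shows "\<exists>b\<ge>R. - \<epsilon> \<le> b * F.q b * (u b)\<^sup>2"
proof -
  obtain R0 I where R0: "1 \<le> R0" and I: "\<forall>b. integral {R0..b} (\<lambda>r. r * ((f' r)\<^sup>2 + (m' r)\<^sup>2 + (m r)\<^sup>2 + (h r)\<^sup>2)) \<le> I"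
    using tail_energy_bound .
  obtain J where J: "\<forall>a b. 0 < a \<longrightarrow> (\<lambda>r. (u r)\<^sup>2 * r) absolutely_integrable_on {a..b} \<and> integral {a..b} (\<lambda>r. (u r)\<^sup>2 * r) \<le> J"
    using absolutely_integrable_bounded_integrals[OF perturbationD(4)[OF p]] .
  have "eventually (\<lambda>r. 1 / 2 < f r) at_top" using f_tendsto_1 by (rule order_tendstoD) simp
  then obtain R1 where R1: "\<And>r. R1 \<le> r \<Longrightarrow> 1 / 2 < f r" by (auto simp: eventually_at_top_linorder)
  \<comment> \<open>Adding the two densities makes \<open>u\<close> and \<open>f'\<close> small at
    one and the same radius.\<close>
  let ?k = "\<lambda>r. (u r)\<^sup>2 * r + r * ((f' r)\<^sup>2 + (m' r)\<^sup>2 + (m r)\<^sup>2 + (h r)\<^sup>2)"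
  have ui: "(\<lambda>r. (u r)\<^sup>2 * r) integrable_on {R0..b}" for b using J R0 set_lebesgue_integral_eq_integral(1) by (metis less_le_trans zero_less_one)
  have fi: "(\<lambda>r. r * ((f' r)\<^sup>2 + (m' r)\<^sup>2 + (m r)\<^sup>2 + (h r)\<^sup>2)) integrable_on {R0..b}" for b
    by (intro integrable_continuous_real continuous_intros cont) (use R0 in auto)
  \<comment> \<open>The bound 1 gives \<open>\<bar>b * f' b\<bar> <= 1\<close>; half of
    \<open>\<epsilon>\<close> compensates \<open>b * F.q b >= -2\<close>.\<close>
  define \<eta> where "\<eta> = min 1 (\<epsilon> / 2)"
  have \<eta>: "0 < \<eta>" "\<eta> \<le> 1" "2 * \<eta> \<le> \<epsilon>" using pos by (auto simp: \<eta>_def)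
  have "\<exists>b\<ge>max R (max R0 R1). b * ?k b < \<eta>"
  proof (rule small_values_at_top[where a=R0 and I="J + I"])
    show "?k integrable_on {R0..b}" for b by (intro integrable_add ui fi)
    show "integral {R0..b} ?k \<le> J + I" for b
      using J I R0 by (subst Henstock_Kurzweil_Integration.integral_add[OF ui fi]) (intro add_mono; auto)
    show "0 \<le> ?k r" if "R0 \<le> r" for r using that R0 by (intro add_nonneg_nonneg mult_nonneg_nonneg) auto
  qed (use R0 \<eta> in auto)
  then obtain b where b: "R \<le> b" "R0 \<le> b" "R1 \<le> b" "b * ?k b < \<eta>" by auto
  have b1: "1 \<le> b" using b R0 by simp
  have fb: "1 / 2 < f b" using R1 b by simp
  have "b * ?k b = b\<^sup>2 * (u b)\<^sup>2 + (b * f' b)\<^sup>2 + b\<^sup>2 * ((m' b)\<^sup>2 + (m b)\<^sup>2 + (h b)\<^sup>2)" by (simp add: power2_eq_square algebra_simps)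
  then have k2: "b\<^sup>2 * (u b)\<^sup>2 + (b * f' b)\<^sup>2 < \<eta>" using b(4) by (smt (verit) mult_nonneg_nonneg zero_le_power2)
  have "(b * f' b)\<^sup>2 \<le> 1\<^sup>2" using k2 \<eta> by (smt (verit) mult_nonneg_nonneg zero_le_power2 one_power2)
  then have "\<bar>b * f' b\<bar> \<le> 1" by (simp add: abs_le_square_iff[of _ 1, simplified])
  then have bf: "- 1 \<le> b * f' b" by linarith
  have "1 * (u b)\<^sup>2 \<le> b\<^sup>2 * (u b)\<^sup>2" using b1 by (intro mult_right_mono) auto
  then have ub: "(u b)\<^sup>2 \<le> \<eta>" using k2 zero_le_power2[of "b * f' b"] by linarith
  have "- 2 \<le> b * F.q b"
  proof -
    have "- 2 * f b \<le> - 1" using fb by simp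
    also have "\<dots> \<le> b * f' b" by (rule bf)
    finally show ?thesis using fb by (simp add: F.q_def field_simps)
  qed
  then have "- 2 * (u b)\<^sup>2 \<le> b * F.q b * (u b)\<^sup>2" by (rule mult_right_mono) simp
  moreover have "- \<epsilon> \<le> - 2 * (u b)\<^sup>2" using ub \<eta> by linarith
  ultimately show ?thesis using b(1) by (intro exI[of _ b]) auto
qed

text \<open>The logarithmic derivative of \<open>m\<close> is at least \<open>- K\<close>, and
  \<open>b\<^sup>2 * (w b)\<^sup>2\<close> is small along a sequence, more than the term
  \<open>b * (w b)\<^sup>2\<close> requires.\<close>

lemma m_boundary_at_top:
  assumes p: "perturbation u v w z" and pos: "0 < \<epsilon>"
  shows "\<exists>b\<ge>R. - \<epsilon> \<le> b * M.q b * (w b)\<^sup>2"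
proof -
  obtain K R0 where K: "0 \<le> K" "1 \<le> R0" "\<And>r. R0 \<le> r \<Longrightarrow> - (K * m r) \<le> m' r" using m'_lower_bound_at_top by blast
  obtain J where J: "\<forall>a b. 0 < a \<longrightarrow> (\<lambda>r. (w r)\<^sup>2 * r) absolutely_integrable_on {a..b} \<and> integral {a..b} (\<lambda>r. (w r)\<^sup>2 * r) \<le> J"
    using absolutely_integrable_bounded_integrals[OF perturbationD(7)[OF p]] .
  have "\<exists>b\<ge>max R R0. b * ((w b)\<^sup>2 * b) < \<epsilon> / (K + 1)"
  proof (rule small_values_at_top[where a=1 and I="J"])
    show "(\<lambda>r. (w r)\<^sup>2 * r) integrable_on {1..b}" for b using J set_lebesgue_integral_eq_integral(1) by (metis zero_less_one)
    show "integral {1..b} (\<lambda>r. (w r)\<^sup>2 * r) \<le> J" for b using J by simp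
  qed (use K pos in auto)
  then obtain b where b: "R \<le> b" "R0 \<le> b" "b * ((w b)\<^sup>2 * b) < \<epsilon> / (K + 1)" by auto
  have b1: "1 \<le> b" using b K by simp
  have "b * ((w b)\<^sup>2 * b) * (K + 1) < \<epsilon>" using b(3) K by (simp add: pos_less_divide_eq)
  then have w: "(K + 1) * (b * b * (w b)\<^sup>2) < \<epsilon>" by (simp add: mult_ac)
  have "- K \<le> M.q b" using K(3)[OF b(2)] m_pos[of b] b1 by (simp add: M.q_def field_simps)
  then have "b * (- K) \<le> b * M.q b" using b1 by (intro mult_left_mono) auto
  moreover have "b * K \<le> b * b * (K + 1)" using b1 K mult_mono[of 1 b "b * K" "b * (K + 1)"] by (simp add: mult_ac)
  ultimately have "- (b * b * (K + 1)) \<le> b * M.q b" by linarith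
  then have "- (b * b * (K + 1)) * (w b)\<^sup>2 \<le> b * M.q b * (w b)\<^sup>2" by (rule mult_right_mono) simp
  moreover have "- (b * b * (K + 1)) * (w b)\<^sup>2 = - ((K + 1) * (b * b * (w b)\<^sup>2))" by (simp add: algebra_simps)
  ultimately show ?thesis using b(1) w by (intro exI[of _ b]) linarith
qed

text \<open>The two Picone parts and the coupling term split the form into three nonnegative totals,
  so each one is separately bounded by the whole.\<close>

lemma quadratic_form_bounds:
  assumes p: "perturbation u v w z" and xy: "0 < x" "x \<le> y"
  shows "integral {x..y} (\<lambda>r. r * (v r - F.q r * u r)\<^sup>2) \<le> quadratic_form u v w z"
    and "integral {x..y} (\<lambda>r. r * (z r - M.q r * w r)\<^sup>2) \<le> quadratic_form u v w z"
    and "integral {x..y} (\<lambda>r. 2 * (r * (f r * u r + m r * w r)\<^sup>2)) \<le> quadratic_form u v w z"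
    and "0 \<le> quadratic_form u v w z"
proof -
  note I = parts_integrable[OF p] and P = perturbationD[OF p]
  have PF: "integral {s..t} (\<lambda>r. r * (v r - F.q r * u r)\<^sup>2) \<le> integral {0<..} (\<lambda>r. r * ((v r)\<^sup>2 + (D / r\<^sup>2 - h r) * (u r)\<^sup>2))"
    if "0 < s" "s \<le> t" for s t
    by (intro F.picone_global[OF P(1,3) I(1)] f_boundary_near_0[OF p] f_boundary_at_top[OF p] that)
  have PM: "integral {s..t} (\<lambda>r. r * (z r - M.q r * w r)\<^sup>2) \<le> integral {0<..} (\<lambda>r. r * ((z r)\<^sup>2 + (g - h r) * (w r)\<^sup>2))"
    if "0 < s" "s \<le> t" for s t
    by (intro M.picone_global[OF P(2,6) I(2)] m_boundary_near_0[OF p] m_boundary_at_top[OF p] that)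
  let ?G = "\<lambda>r. 2 * (r * (f r * u r + m r * w r)\<^sup>2)"
  have Gsub: "?G integrable_on {s..t}" if "0 < s" for s t
    by (rule set_lebesgue_integral_eq_integral(1)[OF set_integrable_subset[OF I(3)]]) (use that in auto)
  have G: "integral {s..t} ?G \<le> integral {0<..} ?G" if "0 < s" for s t
    using that by (intro integral_subset_le Gsub set_lebesgue_integral_eq_integral(1)[OF I(3)]) auto
  \<comment> \<open>On the degenerate interval \<open>{1..1}\<close> the left-hand sides vanish,
    which yields the signs of the totals.\<close>
  have 0: "0 \<le> integral {0<..} (\<lambda>r. r * ((v r)\<^sup>2 + (D / r\<^sup>2 - h r) * (u r)\<^sup>2))" "0 \<le> integral {0<..} (\<lambda>r. r * ((z r)\<^sup>2 + (g - h r) * (w r)\<^sup>2))"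
    "0 \<le> integral {0<..} ?G"
    using PF[of 1 1] PM[of 1 1] G[of 1 1] by auto
  show "integral {x..y} (\<lambda>r. r * (v r - F.q r * u r)\<^sup>2) \<le> quadratic_form u v w z"
    "integral {x..y} (\<lambda>r. r * (z r - M.q r * w r)\<^sup>2) \<le> quadratic_form u v w z"
    "integral {x..y} ?G \<le> quadratic_form u v w z" "0 \<le> quadratic_form u v w z"
    unfolding quadratic_form_eq(2)[OF p] using PF[OF xy] PM[OF xy] G[OF xy(1), of y] 0 by linarith+
qed

section \<open>Local control by the quadratic form\<close>

text \<open>Supplies the ratio hypothesis of \<open>oscillation\<close> uniformly as
  \<open>x\<close> tends to 0, where no positive lower bound on \<open>f\<close> is available: up to
  1 monotonicity suffices, and from 1 to \<open>R\<close> the minimum of \<open>f\<close> is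
  positive.\<close>

lemma f_ratio:
  assumes R: "1 \<le> R"
  obtains \<Lambda> where "0 \<le> \<Lambda>" "\<forall>x s. 0 < x \<longrightarrow> x \<le> s \<longrightarrow> s \<le> R \<longrightarrow> (f x)\<^sup>2 \<le> \<Lambda> * (f s)\<^sup>2"
proof -
  obtain B where B: "1 \<le> B" "\<And>r. 0 < r \<Longrightarrow> \<bar>h r\<bar> \<le> B" using h_bounded by blast
  have "\<exists>x\<in>{1..R}. \<forall>y\<in>{1..R}. f x \<le> f y"
    by (intro continuous_attains_inf cont) (use R in auto)
  then obtain t where t: "t \<in> {1..R}" "\<forall>y\<in>{1..R}. f t \<le> f y" by blast
  define \<nu> where "\<nu> = (f t)\<^sup>2"
  have \<nu>: "0 < \<nu>" using f_pos[of t] t by (simp add: \<nu>_def)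
  define \<Lambda> where "\<Lambda> = max 1 ((1 + B) / \<nu>)"
  have "(f x)\<^sup>2 \<le> \<Lambda> * (f s)\<^sup>2" if x: "0 < x" "x \<le> s" "s \<le> R" for x s
  proof (cases "s \<le> 1")
    case True
    have "(f x)\<^sup>2 \<le> (f s)\<^sup>2" using f_mono_near_0[OF x(1,2) True] f_nonneg[of x] x by (intro power_mono) auto
    also have "\<dots> \<le> \<Lambda> * (f s)\<^sup>2" using mult_right_mono[of 1 \<Lambda> "(f s)\<^sup>2"] by (simp add: \<Lambda>_def)
    finally show ?thesis .
  next
    case False
    have "\<nu> \<le> (f s)\<^sup>2" unfolding \<nu>_def using t False x f_nonneg[of t] by (intro power_mono) auto
    then have "(1 + B) / \<nu> * \<nu> \<le> \<Lambda> * (f s)\<^sup>2" using B \<nu> by (intro mult_mono) (auto simp: \<Lambda>_def)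
    then have "1 + B \<le> \<Lambda> * (f s)\<^sup>2" using \<nu> by simp
    moreover have "(f x)\<^sup>2 \<le> 1 + B" using f_m_square_le[OF B(2)[OF x(1)]] zero_le_power2[of "m x"] by linarith
    ultimately show ?thesis by linarith
  qed
  then show ?thesis by (intro that[of \<Lambda>]) (auto simp: \<Lambda>_def)
qed

lemma m_ratio:
  obtains \<Lambda> where "0 \<le> \<Lambda>" "\<forall>x s. 0 < x \<longrightarrow> x \<le> s \<longrightarrow> s \<le> R \<longrightarrow> (m x)\<^sup>2 \<le> \<Lambda> * (m s)\<^sup>2"
proof -
  obtain \<mu> where \<mu>: "0 < \<mu>" "\<And>r. 0 < r \<Longrightarrow> r \<le> R \<Longrightarrow> \<mu> \<le> m r" using m_lower_bound by blast
  obtain K where K: "0 < K" "\<And>r. 0 < r \<Longrightarrow> r \<le> R \<Longrightarrow> m r \<le> K" using m_upper_bound by blast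
  have "(m x)\<^sup>2 \<le> (K\<^sup>2 / \<mu>\<^sup>2) * (m s)\<^sup>2" if x: "0 < x" "x \<le> s" "s \<le> R" for x s
  proof -
    have "(m x)\<^sup>2 \<le> K\<^sup>2" using K(2)[of x] m_pos[of x] x by (intro power_mono) auto
    also have "K\<^sup>2 = (K\<^sup>2 / \<mu>\<^sup>2) * \<mu>\<^sup>2" using \<mu> by simp
    also have "\<dots> \<le> (K\<^sup>2 / \<mu>\<^sup>2) * (m s)\<^sup>2" using \<mu>(1) \<mu>(2)[of s] x by (intro mult_left_mono power_mono) auto
    finally show ?thesis .
  qed
  then show ?thesis by (intro that[of "K\<^sup>2 / \<mu>\<^sup>2"]) auto
qed

text \<open>The minimum of the coupling square over a unit interval is at most its integral, and the
  weight \<open>2 * r\<close> exceeds 1 there.\<close>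

lemma coupling_small_somewhere:
  assumes p: "perturbation u v w z" and a: "1 \<le> a"
  obtains x where "x \<in> {a..a+1}" "(f x * u x + m x * w x)\<^sup>2 \<le> quadratic_form u v w z"
proof -
  note P = perturbationD[OF p]
  have S: "{a..a+1} \<subseteq> {0<..}" using a by auto
  let ?G = "\<lambda>r. (f r * u r + m r * w r)\<^sup>2"
  have c: "continuous_on {a..a+1} ?G"
    by (intro continuous_intros cont continuous_on_subset[OF P(8)] continuous_on_subset[OF P(9)] S)
  have "\<exists>x\<in>{a..a+1}. \<forall>y\<in>{a..a+1}. ?G x \<le> ?G y"
    by (intro continuous_attains_inf c) auto
  then obtain x where x: "x \<in> {a..a+1}" "\<forall>y\<in>{a..a+1}. ?G x \<le> ?G y" by blast
  have "?G x = integral {a..a+1} (\<lambda>_. ?G x)" by simp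
  also have "\<dots> \<le> integral {a..a+1} (\<lambda>r. 2 * (r * ?G r))"
  proof (rule integral_le)
    show "(\<lambda>r. 2 * (r * ?G r)) integrable_on {a..a+1}"
      by (intro integrable_continuous_real continuous_intros c)
    fix y assume y: "y \<in> {a..a+1}"
    have "?G x \<le> ?G y" using x y by blast
    also have "\<dots> \<le> (2 * y) * ?G y" using mult_right_mono[of 1 "2 * y" "?G y"] y a by simp
    finally show "?G x \<le> 2 * (y * ?G y)" by simp
  qed (rule integrable_const_ivl)
  also have "\<dots> \<le> quadratic_form u v w z" by (rule quadratic_form_bounds(3)[OF p]) (use a in auto)
  finally show ?thesis using x(1) that by blast
qed

text \<open>\<open>\<eta>\<close> is half the minimum of \<open>m\<^sup>2 / f\<^sup>2\<close> over
  \<open>{1..2}\<close>; beyond \<open>a\<close> the ratio has dropped below that half, so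
  \<open>\<eta>\<close> serves both as the gap and as the upper bound of the smaller ratio.\<close>

lemma ratio_separation:
  obtains \<eta> a where "0 < \<eta>" "1 \<le> a"
    "\<forall>x1 x2. x1 \<in> {1..2} \<longrightarrow> a \<le> x2 \<longrightarrow> \<eta> \<le> (m x1)\<^sup>2 / (f x1)\<^sup>2 - (m x2)\<^sup>2 / (f x2)\<^sup>2 \<and> (m x2)\<^sup>2 / (f x2)\<^sup>2 \<le> \<eta>"
proof -
  let ?\<rho> = "\<lambda>x. (m x)\<^sup>2 / (f x)\<^sup>2"
  have ne: "f x \<noteq> 0" if "x \<in> {1..2}" for x using f_pos[of x] that by auto
  have "\<exists>x\<in>{1..2}. \<forall>y\<in>{1..2}. ?\<rho> x \<le> ?\<rho> y"
    by (intro continuous_attains_inf continuous_intros cont) (use ne in auto)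
  then obtain t where t: "t \<in> {1..2}" "\<forall>y\<in>{1..2}. ?\<rho> t \<le> ?\<rho> y" by blast
  have pos: "0 < ?\<rho> t" using t m_pos[of t] ne[of t] by auto
  have "((\<lambda>x. ?\<rho> x) \<longlongrightarrow> 0\<^sup>2 / 1\<^sup>2) at_top"
    by (intro tendsto_intros f_tendsto_1 m_tendsto_0) auto
  then have "eventually (\<lambda>x. ?\<rho> x < ?\<rho> t / 2) at_top" by (rule order_tendstoD) (use pos in simp)
  then obtain a where a: "\<And>x. a \<le> x \<Longrightarrow> ?\<rho> x < ?\<rho> t / 2" by (auto simp: eventually_at_top_linorder)
  show ?thesis
  proof (rule that[of "?\<rho> t / 2" "max a 1"], use pos in simp, simp, intro allI impI)
    fix x1 x2 :: real assume x: "x1 \<in> {1..2}" "max a 1 \<le> x2"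
    have "?\<rho> t \<le> ?\<rho> x1" using t x by blast
    moreover have "?\<rho> x2 < ?\<rho> t / 2" using a x by auto
    ultimately show "?\<rho> t / 2 \<le> ?\<rho> x1 - ?\<rho> x2 \<and> ?\<rho> x2 \<le> ?\<rho> t / 2" by linarith
  qed
qed

lemma local_bound:
  obtains C where "0 \<le> C"
    "\<forall>u v w z r. perturbation u v w z \<longrightarrow> 0 < r \<longrightarrow> r \<le> R \<longrightarrow> r * ((u r)\<^sup>2 + (w r)\<^sup>2) \<le> C * quadratic_form u v w z"
proof -
  obtain \<eta> a where \<eta>: "0 < \<eta>" "1 \<le> a" and sep: "\<forall>x1 x2. x1 \<in> {1..2} \<longrightarrow> a \<le> x2 \<longrightarrow> \<eta> \<le> (m x1)\<^sup>2 / (f x1)\<^sup>2 - (m x2)\<^sup>2 / (f x2)\<^sup>2 \<and> (m x2)\<^sup>2 / (f x2)\<^sup>2 \<le> \<eta>"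
    using ratio_separation .
  \<comment> \<open>Large enough to contain the radii to be controlled and both intervals in which
    the coupling is tested.\<close>
  define S where "S = max R (a + 1)"
  have S: "R \<le> S" "a + 1 \<le> S" "2 \<le> S" "1 \<le> S" using \<eta> by (auto simp: S_def)
  obtain \<Lambda>1 where \<Lambda>1: "0 \<le> \<Lambda>1" "\<forall>x s. 0 < x \<longrightarrow> x \<le> s \<longrightarrow> s \<le> S \<longrightarrow> (f x)\<^sup>2 \<le> \<Lambda>1 * (f s)\<^sup>2" using f_ratio[OF S(4)] .
  obtain \<Lambda>2 where \<Lambda>2: "0 \<le> \<Lambda>2" "\<forall>x s. 0 < x \<longrightarrow> x \<le> s \<longrightarrow> s \<le> S \<longrightarrow> (m x)\<^sup>2 \<le> \<Lambda>2 * (m s)\<^sup>2" using m_ratio .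
  obtain B where B: "1 \<le> B" "\<And>r. 0 < r \<Longrightarrow> \<bar>h r\<bar> \<le> B" using h_bounded by blast
  have "\<exists>x\<in>{1..S}. \<forall>y\<in>{1..S}. f x \<le> f y"
    by (intro continuous_attains_inf cont) (use S in auto)
  then obtain t where t: "t \<in> {1..S}" "\<forall>y\<in>{1..S}. f t \<le> f y" by blast
  define \<nu> where "\<nu> = (f t)\<^sup>2"
  have \<nu>: "0 < \<nu>" using f_pos[of t] t by (simp add: \<nu>_def)
  have f\<nu>: "\<nu> \<le> (f x)\<^sup>2" if "x \<in> {1..S}" for x unfolding \<nu>_def using t that f_nonneg[of t] by (intro power_mono) auto
  define L where "L = sqrt ((\<Lambda>1 + \<Lambda>2) * S)"
  have L: "0 \<le> L" using \<Lambda>1 \<Lambda>2 S by (simp add: L_def)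
  \<comment> \<open>The 1 is the coupling term, the two equal terms are the oscillation errors of
    \<open>u\<close> and \<open>w\<close>, and \<open>\<nu>\<close> is the lower bound for
    \<open>f\<^sup>2\<close> by which one divides.\<close>
  define C1 where "C1 = (1 + 2 * ((1 + B) * L)) / \<nu>"
  have C1: "0 \<le> C1" using B L \<nu> by (simp add: C1_def)
  \<comment> \<open>With error \<open>C1 * sqrt Q\<close> and ratio bound \<open>\<eta>\<close>,
    \<open>two_ratio_bound\<close> gives at most three times this error for \<open>P1\<close> and
    \<open>2 / \<eta>\<close> times it for \<open>P2\<close>; the sum covers both.\<close>
  define C2 where "C2 = C1 + 2 * C1 + 2 * C1 / \<eta>"
  have C2: "0 \<le> C2" using C1 \<eta> by (simp add: C2_def)
  define E where "E = 2 * ((\<Lambda>1 + \<Lambda>2) * S) + 2 * ((1 + B) * S * C2\<^sup>2)"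
  define C where "C = 2 * E"
  have C: "0 \<le> C" using \<Lambda>1 \<Lambda>2 S B by (simp add: C_def E_def)
  have "r * ((u r)\<^sup>2 + (w r)\<^sup>2) \<le> C * quadratic_form u v w z" if p: "perturbation u v w z" and r: "0 < r" "r \<le> R" for u v w z r
  proof -
    note P = perturbationD[OF p]
    define Q where "Q = quadratic_form u v w z"
    have Q: "0 \<le> Q" using quadratic_form_bounds(4)[OF p, of 1 1] by (simp add: Q_def)
    define P1 P2 where "P1 = u S / f S" and "P2 = w S / m S"
    have osc1: "(f x * (P1 - u x / f x))\<^sup>2 \<le> Q * (\<Lambda>1 * ln (S / x))" if x: "0 < x" "x \<le> S" for x
      unfolding P1_def Q_def
      by (rule F.oscillation[OF P(1,3) x quadratic_form_bounds(1)[OF p x]]) (use \<Lambda>1 x in auto)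
    have osc2: "(m x * (P2 - w x / m x))\<^sup>2 \<le> Q * (\<Lambda>2 * ln (S / x))" if x: "0 < x" "x \<le> S" for x
      unfolding P2_def Q_def
      by (rule M.oscillation[OF P(2,6) x quadratic_form_bounds(2)[OF p x]]) (use \<Lambda>2 x in auto)
    \<comment> \<open>Replacing \<open>u x\<close> by \<open>f x * P1\<close> and \<open>w x\<close>
      by \<open>m x * P2\<close> in the small coupling term costs only oscillations; division by
      \<open>f\<^sup>2\<close> leaves a linear relation between \<open>P1\<close> and
      \<open>P2\<close>.\<close>
    have bnd: "\<bar>P1 + (m x)\<^sup>2 / (f x)\<^sup>2 * P2\<bar> \<le> C1 * sqrt Q" if x: "x \<in> {1..S}" and Gx: "(f x * u x + m x * w x)\<^sup>2 \<le> Q" for x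
    proof -
      have x0: "0 < x" "x \<le> S" using x by auto
      have "ln (S / x) \<le> S" using ln_le_minus_one[of "S / x"] x divide_left_mono[of 1 x S] S by simp
      moreover have "0 \<le> ln (S / x)" using x by simp
      ultimately have "\<Lambda>1 * ln (S / x) \<le> (\<Lambda>1 + \<Lambda>2) * S" "\<Lambda>2 * ln (S / x) \<le> (\<Lambda>1 + \<Lambda>2) * S"
        using \<Lambda>1 \<Lambda>2 by (intro mult_mono; simp)+
      then have "Q * (\<Lambda>1 * ln (S / x)) \<le> Q * ((\<Lambda>1 + \<Lambda>2) * S)" "Q * (\<Lambda>2 * ln (S / x)) \<le> Q * ((\<Lambda>1 + \<Lambda>2) * S)"
        using Q by (intro mult_left_mono; simp)+
      then have "(f x * (P1 - u x / f x))\<^sup>2 \<le> Q * ((\<Lambda>1 + \<Lambda>2) * S)" "(m x * (P2 - w x / m x))\<^sup>2 \<le> Q * ((\<Lambda>1 + \<Lambda>2) * S)"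
        using osc1[OF x0] osc2[OF x0] by linarith+
      then have d: "\<bar>f x * (P1 - u x / f x)\<bar> \<le> sqrt Q * L" "\<bar>m x * (P2 - w x / m x)\<bar> \<le> sqrt Q * L"
        unfolding L_def real_sqrt_mult[symmetric] by (metis real_sqrt_abs real_sqrt_le_iff)+
      have G1: "\<bar>f x * u x + m x * w x\<bar> \<le> sqrt Q" using Gx by (metis real_sqrt_abs real_sqrt_le_iff)
      have fm: "(f x)\<^sup>2 + (m x)\<^sup>2 \<le> 1 + B" by (rule f_m_square_le[OF B(2)[OF x0(1)]])
      have B2: "1 + B \<le> (1 + B)\<^sup>2" using mult_left_mono[of 1 "1 + B" "1 + B"] B by (simp add: power2_eq_square)
      have fm': "(f x)\<^sup>2 \<le> 1 + B" "(m x)\<^sup>2 \<le> 1 + B" using fm zero_le_power2[of "f x"] zero_le_power2[of "m x"] by linarith+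
      have fB: "\<bar>f x\<bar> \<le> 1 + B" "\<bar>m x\<bar> \<le> 1 + B" using B order_trans[OF fm'(1) B2] order_trans[OF fm'(2) B2] by (simp_all add: abs_le_square_iff[symmetric])
      have fne: "f x \<noteq> 0" "m x \<noteq> 0" using f_pos[OF x0(1)] m_pos[of x] x0 by auto
      have e: "(f x)\<^sup>2 * P1 + (m x)\<^sup>2 * P2 = (f x * u x + m x * w x) + f x * (f x * (P1 - u x / f x)) + m x * (m x * (P2 - w x / m x))"
        using fne by (simp add: power2_eq_square algebra_simps)
      have "\<bar>(f x)\<^sup>2 * P1 + (m x)\<^sup>2 * P2\<bar> \<le> \<bar>f x * u x + m x * w x\<bar> + \<bar>f x\<bar> * \<bar>f x * (P1 - u x / f x)\<bar> + \<bar>m x\<bar> * \<bar>m x * (P2 - w x / m x)\<bar>"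
        unfolding e abs_mult[symmetric] by linarith
      also have "\<dots> \<le> sqrt Q + (1 + B) * (sqrt Q * L) + (1 + B) * (sqrt Q * L)"
        using G1 d fB B Q by (intro add_mono mult_mono) auto
      also have "\<dots> = C1 * \<nu> * sqrt Q"
      proof -
        have "C1 * \<nu> = 1 + 2 * ((1 + B) * L)" using \<nu> by (simp add: C1_def)
        then show ?thesis by (simp only:) (simp add: algebra_simps)
      qed
      finally have "\<bar>(f x)\<^sup>2 * P1 + (m x)\<^sup>2 * P2\<bar> \<le> C1 * \<nu> * sqrt Q" .
      also have "\<dots> \<le> C1 * (f x)\<^sup>2 * sqrt Q" using f\<nu>[OF x] C1 Q by (intro mult_right_mono mult_left_mono) auto
      finally have 1: "\<bar>(f x)\<^sup>2 * P1 + (m x)\<^sup>2 * P2\<bar> \<le> (f x)\<^sup>2 * (C1 * sqrt Q)" by (simp add: mult_ac)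
      have "(f x)\<^sup>2 * P1 + (m x)\<^sup>2 * P2 = (f x)\<^sup>2 * (P1 + (m x)\<^sup>2 / (f x)\<^sup>2 * P2)" using fne by (simp add: field_simps)
      then have "(f x)\<^sup>2 * \<bar>P1 + (m x)\<^sup>2 / (f x)\<^sup>2 * P2\<bar> \<le> (f x)\<^sup>2 * (C1 * sqrt Q)" using 1 by (simp add: abs_mult)
      then show ?thesis using fne by (simp add: mult_le_cancel_left)
    qed
    obtain x1 where x1: "x1 \<in> {1..1+1}" "(f x1 * u x1 + m x1 * w x1)\<^sup>2 \<le> Q"
      using coupling_small_somewhere[OF p, of 1] unfolding Q_def by auto
    obtain x2 where x2: "x2 \<in> {a..a+1}" "(f x2 * u x2 + m x2 * w x2)\<^sup>2 \<le> Q"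
      using coupling_small_somewhere[OF p \<eta>(2)] unfolding Q_def .
    have x12: "x1 \<in> {1..2}" "a \<le> x2" "x1 \<in> {1..S}" "x2 \<in> {1..S}" using x1 x2 S \<eta> by auto
    note sp = sep[rule_format, OF x12(1,2)]
    note T = two_ratio_bound[OF bnd[OF x12(3) x1(2)] bnd[OF x12(4) x2(2)] sp[THEN conjunct1] \<eta>(1) _ sp[THEN conjunct2]]
    have P2': "\<bar>P2\<bar> \<le> C2 * sqrt Q" and P1': "\<bar>P1\<bar> \<le> C2 * sqrt Q"
    proof -
      have "2 * (C1 * sqrt Q) / \<eta> \<le> C2 * sqrt Q" using C1 Q by (simp add: C2_def algebra_simps)
      then show "\<bar>P2\<bar> \<le> C2 * sqrt Q" using T(1) by simp
      have "C1 * sqrt Q + \<eta> * (2 * (C1 * sqrt Q) / \<eta>) \<le> C2 * sqrt Q" using C1 Q \<eta> by (simp add: C2_def algebra_simps)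
      then show "\<bar>P1\<bar> \<le> C2 * sqrt Q" using T(2) by simp
    qed
    have sq: "X\<^sup>2 \<le> C2\<^sup>2 * Q" if "\<bar>X\<bar> \<le> C2 * sqrt Q" for X
    proof -
      have "\<bar>X\<bar>\<^sup>2 \<le> (C2 * sqrt Q)\<^sup>2" using that by (intro power_mono) auto
      then show ?thesis using Q by (simp add: power_mult_distrib)
    qed
    \<comment> \<open>One argument for both components: \<open>y\<close> is
      \<open>\<theta> * X\<close> minus the oscillation, and \<open>E\<close> collects their two
      contributions.\<close>
    have gen: "r * y\<^sup>2 \<le> E * Q"
      if o: "(\<theta> * (X - y / \<theta>))\<^sup>2 \<le> Q * (\<Lambda> * ln (S / r))" and th: "0 < \<theta>" "\<theta>\<^sup>2 \<le> 1 + B" and X: "\<bar>X\<bar> \<le> C2 * sqrt Q" and \<Lambda>: "0 \<le> \<Lambda>" "\<Lambda> \<le> \<Lambda>1 + \<Lambda>2"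
      for \<theta> X y \<Lambda>
    proof -
      have rS: "r \<le> S" using r S by simp
      have y: "y = \<theta> * X - \<theta> * (X - y / \<theta>)" using th by (simp add: algebra_simps)
      have "y\<^sup>2 \<le> 2 * (\<theta> * X)\<^sup>2 + 2 * (\<theta> * (X - y / \<theta>))\<^sup>2"
      proof -
        have "(s - t)\<^sup>2 \<le> 2 * s\<^sup>2 + 2 * t\<^sup>2" for s t :: real using zero_le_power2[of "s + t"] by (simp add: power2_eq_square algebra_simps)
        then show ?thesis using y by metis
      qed
      also have "(\<theta> * X)\<^sup>2 \<le> (1 + B) * (C2\<^sup>2 * Q)" unfolding power_mult_distrib using th sq[OF X] B by (intro mult_mono) auto
      finally have "y\<^sup>2 \<le> 2 * ((1 + B) * (C2\<^sup>2 * Q)) + 2 * (Q * (\<Lambda> * ln (S / r)))" using o by linarith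
      then have "r * y\<^sup>2 \<le> r * (2 * ((1 + B) * (C2\<^sup>2 * Q)) + 2 * (Q * (\<Lambda> * ln (S / r))))" using r by (intro mult_left_mono) auto
      also have "\<dots> = 2 * (r * ((1 + B) * (C2\<^sup>2 * Q))) + 2 * (Q * (\<Lambda> * (r * ln (S / r))))" by (simp add: algebra_simps)
      also have "\<dots> \<le> 2 * (S * ((1 + B) * (C2\<^sup>2 * Q))) + 2 * (Q * ((\<Lambda>1 + \<Lambda>2) * S))"
        using rS mult_ln_divide_le[OF r(1) rS] B Q \<Lambda> r S by (intro add_mono mult_left_mono mult_mono mult_right_mono) auto
      also have "\<dots> = E * Q" by (simp add: E_def algebra_simps)
      finally show ?thesis .
    qed
    have rS: "r \<le> S" using r S by simp
    have fm: "(f r)\<^sup>2 + (m r)\<^sup>2 \<le> 1 + B" by (rule f_m_square_le[OF B(2)[OF r(1)]])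
    have fm': "(f r)\<^sup>2 \<le> 1 + B" "(m r)\<^sup>2 \<le> 1 + B" using fm zero_le_power2[of "f r"] zero_le_power2[of "m r"] by linarith+
    have "r * (u r)\<^sup>2 \<le> E * Q"
      by (rule gen[OF osc1[OF r(1) rS] f_pos[OF r(1)] fm'(1) P1']) (use \<Lambda>1 \<Lambda>2 in auto)
    moreover have "r * (w r)\<^sup>2 \<le> E * Q"
      by (rule gen[OF osc2[OF r(1) rS] _ fm'(2) P2']) (use \<Lambda>1 \<Lambda>2 m_pos r in auto)
    ultimately show ?thesis unfolding C_def Q_def[symmetric] distrib_left mult.assoc by linarith
  qed
  then show ?thesis using C that by blast
qed

section \<open>Coercivity\<close>

text \<open>At infinity the pointwise form tends to \<open>2 * x\<^sup>2 + g * y\<^sup>2\<close>.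
  The thresholds on \<open>h\<close>, \<open>f\<close> and \<open>m\<close> are tuned to leave
  exactly one half of \<open>x\<^sup>2\<close> and \<open>g / 2\<close> times
  \<open>y\<^sup>2\<close>.\<close>

lemma tail_coercive:
  obtains R where "1 \<le> R" "\<forall>r x y. R \<le> r \<longrightarrow> min (1/2) (g/2) * (x\<^sup>2 + y\<^sup>2) \<le> g * y\<^sup>2 - h r * (x\<^sup>2 + y\<^sup>2) + 2 * (f r * x + m r * y)\<^sup>2"
proof -
  have "eventually (\<lambda>r. \<bar>h r\<bar> < min (1/4) (g/4)) at_top"
    using tendsto_rabs_zero[OF h_tendsto_0] by (rule order_tendstoD) (use g in simp)
  moreover have "((\<lambda>r. (f r)\<^sup>2) \<longlongrightarrow> 1\<^sup>2) at_top" by (intro tendsto_intros f_tendsto_1)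
  then have "eventually (\<lambda>r. 3/4 < (f r)\<^sup>2) at_top" by (rule order_tendstoD) simp
  moreover have "((\<lambda>r. (m r)\<^sup>2) \<longlongrightarrow> 0\<^sup>2) at_top" by (intro tendsto_intros m_tendsto_0)
  then have "eventually (\<lambda>r. (m r)\<^sup>2 < g / 8) at_top" by (rule order_tendstoD) (use g in simp)
  ultimately have "eventually (\<lambda>r. \<bar>h r\<bar> < min (1/4) (g/4) \<and> 3/4 < (f r)\<^sup>2 \<and> (m r)\<^sup>2 < g / 8) at_top"
    by eventually_elim simp
  then obtain R where R: "\<And>r. R \<le> r \<Longrightarrow> \<bar>h r\<bar> < min (1/4) (g/4) \<and> 3/4 < (f r)\<^sup>2 \<and> (m r)\<^sup>2 < g / 8"
    by (auto simp: eventually_at_top_linorder)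
  have "min (1/2) (g/2) * (x\<^sup>2 + y\<^sup>2) \<le> g * y\<^sup>2 - h r * (x\<^sup>2 + y\<^sup>2) + 2 * (f r * x + m r * y)\<^sup>2" if "R \<le> r" for r x y
  proof -
    have c: "\<bar>h r\<bar> \<le> 1/4" "\<bar>h r\<bar> \<le> g/4" "3/4 \<le> (f r)\<^sup>2" "(m r)\<^sup>2 \<le> g / 8" using R[OF that] by auto
    \<comment> \<open>The difference of the two sides is the square of
      \<open>f r * x + 2 * (m r * y)\<close>.\<close>
    have "(f r * x)\<^sup>2 \<le> 2 * (f r * x + m r * y)\<^sup>2 + 2 * (m r * y)\<^sup>2"
      using zero_le_power2[of "f r * x + 2 * (m r * y)"] by (simp add: power2_eq_square algebra_simps)
    moreover have "3/4 * x\<^sup>2 \<le> (f r * x)\<^sup>2" "(m r * y)\<^sup>2 \<le> g / 8 * y\<^sup>2" unfolding power_mult_distrib using c by (intro mult_right_mono; simp)+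
    moreover have "h r * x\<^sup>2 \<le> 1/4 * x\<^sup>2" "h r * y\<^sup>2 \<le> g/4 * y\<^sup>2" using c by (intro mult_right_mono; simp)+
    moreover have "min (1/2) (g/2) * x\<^sup>2 \<le> 1/2 * x\<^sup>2" "min (1/2) (g/2) * y\<^sup>2 \<le> g/2 * y\<^sup>2" by (intro mult_right_mono; simp)+
    ultimately show ?thesis unfolding distrib_left by linarith
  qed
  then show ?thesis by (intro that[of "max R 1"]) auto
qed

text \<open>The density dominates \<open>\<kappa>\<close> times the norm density up to a constant
  deficit on (0,R]. By \<open>local_bound\<close> that deficit is a multiple of the form itself,
  which is moved to the other side; hence the constant \<open>\<kappa> / A\<close>.\<close>

lemma coercivity:
  obtains \<sigma> where "0 < \<sigma>"
    "\<forall>u v w z. perturbation u v w z \<longrightarrow>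
       \<sigma> * (integral {0<..} (\<lambda>r. ((v r)\<^sup>2 + (u r)\<^sup>2 + (u r)\<^sup>2 / r\<^sup>2) * r) + integral {0<..} (\<lambda>r. ((z r)\<^sup>2 + (w r)\<^sup>2) * r))
        \<le> quadratic_form u v w z"
proof -
  obtain R where R: "1 \<le> R" and tail: "\<forall>r x y. R \<le> r \<longrightarrow> min (1/2) (g/2) * (x\<^sup>2 + y\<^sup>2) \<le> g * y\<^sup>2 - h r * (x\<^sup>2 + y\<^sup>2) + 2 * (f r * x + m r * y)\<^sup>2"
    using tail_coercive .
  obtain C where C: "0 \<le> C" and loc: "\<forall>u v w z r. perturbation u v w z \<longrightarrow> 0 < r \<longrightarrow> r \<le> R \<longrightarrow> r * ((u r)\<^sup>2 + (w r)\<^sup>2) \<le> C * quadratic_form u v w z"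
    using local_bound .
  obtain B where B: "1 \<le> B" "\<And>r. 0 < r \<Longrightarrow> \<bar>h r\<bar> \<le> B" using h_bounded by blast
  define \<kappa> where "\<kappa> = min (1/2) (g/2)"
  have \<kappa>: "0 < \<kappa>" "\<kappa> \<le> 1" using g by (auto simp: \<kappa>_def)
  define A where "A = 1 + (B + \<kappa>) * C * R"
  have A: "1 \<le> A" using B \<kappa> C R by (simp add: A_def)
  have "(\<kappa> / A) * (integral {0<..} (\<lambda>r. ((v r)\<^sup>2 + (u r)\<^sup>2 + (u r)\<^sup>2 / r\<^sup>2) * r) + integral {0<..} (\<lambda>r. ((z r)\<^sup>2 + (w r)\<^sup>2) * r))
        \<le> quadratic_form u v w z" if p: "perturbation u v w z" for u v w z
  proof -
    note P = perturbationD[OF p]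
    define Q where "Q = quadratic_form u v w z"
    let ?X = "\<lambda>r. ((v r)\<^sup>2 + (u r)\<^sup>2 + (u r)\<^sup>2 / r\<^sup>2) * r" and ?H = "\<lambda>r. ((z r)\<^sup>2 + (w r)\<^sup>2) * r"
    have X: "?X integrable_on {0<..}" and H: "?H integrable_on {0<..}"
      unfolding distrib_right by (intro set_lebesgue_integral_eq_integral(1) set_integral_add P)+
    \<comment> \<open>Bounds \<open>(B + \<kappa>) * r * (u\<^sup>2 + w\<^sup>2)\<close> on (0,R]:
      \<open>B\<close> compensates a negative potential and \<open>\<kappa>\<close> restores the
      missing zeroth-order part of the norm.\<close>
    define k where "k = (B + \<kappa>) * (C * Q)"
    let ?k = "\<lambda>r. if r \<in> {0<..R} then k else 0"
    have kI: "(?k has_integral (k * R)) {0<..}" by (rule has_integral_const_halfopen) (use R in simp)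
    have qI: "(quadratic_density u v w z has_integral Q) {0<..}"
      unfolding Q_def quadratic_form_def
      by (intro integrable_integral set_lebesgue_integral_eq_integral(1) quadratic_form_eq(1)[OF p])
    have pt: "\<kappa> * (?X r + ?H r) \<le> quadratic_density u v w z r + ?k r" if "r \<in> {0<..}" for r
    proof -
      have r: "0 < r" using that by simp
      let ?E = "g * (w r)\<^sup>2 - h r * ((u r)\<^sup>2 + (w r)\<^sup>2) + 2 * (f r * u r + m r * w r)\<^sup>2"
      have qd: "quadratic_density u v w z r = ((v r)\<^sup>2 + (z r)\<^sup>2 + D * ((u r)\<^sup>2 / r\<^sup>2)) * r + ?E * r"
        by (simp add: quadratic_density_def algebra_simps)
      have XH: "\<kappa> * (?X r + ?H r) = \<kappa> * (((v r)\<^sup>2 + (z r)\<^sup>2 + 1 * ((u r)\<^sup>2 / r\<^sup>2)) * r) + \<kappa> * ((u r)\<^sup>2 + (w r)\<^sup>2) * r"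
        by (simp add: algebra_simps)
      \<comment> \<open>The derivative and Hardy terms need no correction, because
        \<open>\<kappa> <= 1 <= D\<close>.\<close>
      have "\<kappa> * (((v r)\<^sup>2 + (z r)\<^sup>2 + 1 * ((u r)\<^sup>2 / r\<^sup>2)) * r) \<le> 1 * (((v r)\<^sup>2 + (z r)\<^sup>2 + D * ((u r)\<^sup>2 / r\<^sup>2)) * r)"
        using \<kappa> D_ge_1 r by (intro mult_mono mult_right_mono add_mono mult_nonneg_nonneg add_nonneg_nonneg) auto
      moreover have "\<kappa> * ((u r)\<^sup>2 + (w r)\<^sup>2) * r \<le> ?E * r + ?k r"
      proof (cases "r \<le> R")
        case True
        have "- ?E \<le> B * ((u r)\<^sup>2 + (w r)\<^sup>2)"
        proof -
          have "h r * ((u r)\<^sup>2 + (w r)\<^sup>2) \<le> B * ((u r)\<^sup>2 + (w r)\<^sup>2)" using B(2)[OF r] by (intro mult_right_mono) auto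
          moreover have "0 \<le> g * (w r)\<^sup>2" "0 \<le> 2 * (f r * u r + m r * w r)\<^sup>2" using g by auto
          ultimately show ?thesis by linarith
        qed
        then have "- ?E * r \<le> B * ((u r)\<^sup>2 + (w r)\<^sup>2) * r" using r by (intro mult_right_mono) auto
        moreover have "(B + \<kappa>) * (r * ((u r)\<^sup>2 + (w r)\<^sup>2)) \<le> k"
          unfolding k_def Q_def using loc p r True B \<kappa> by (intro mult_left_mono) auto
        moreover have "(B + \<kappa>) * (r * ((u r)\<^sup>2 + (w r)\<^sup>2)) = B * ((u r)\<^sup>2 + (w r)\<^sup>2) * r + \<kappa> * ((u r)\<^sup>2 + (w r)\<^sup>2) * r"
          by (simp add: algebra_simps)
        moreover have "?k r = k" using True r by simp
        ultimately show ?thesis unfolding minus_mult_left[symmetric] by linarith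
      next
        case False
        then have "\<kappa> * ((u r)\<^sup>2 + (w r)\<^sup>2) \<le> ?E" using tail unfolding \<kappa>_def by simp
        then have "\<kappa> * ((u r)\<^sup>2 + (w r)\<^sup>2) * r \<le> ?E * r" using r by (intro mult_right_mono) auto
        then show ?thesis using False by simp
      qed
      ultimately show ?thesis unfolding qd XH by linarith
    qed
    have kXH: "((\<lambda>r. \<kappa> * (?X r + ?H r)) has_integral \<kappa> * (integral {0<..} ?X + integral {0<..} ?H)) {0<..}"
      by (intro has_integral_mult_right has_integral_add integrable_integral X H)
    have "\<kappa> * (integral {0<..} ?X + integral {0<..} ?H) \<le> Q + k * R"
      by (rule has_integral_le[OF kXH has_integral_add[OF qI kI]], rule pt)
    also have "\<dots> = A * Q" by (simp add: A_def k_def algebra_simps)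
    finally have "\<kappa> * (integral {0<..} ?X + integral {0<..} ?H) \<le> A * Q" .
    then show ?thesis using A unfolding Q_def[symmetric] by (simp add: field_simps)
  qed
  moreover have "0 < \<kappa> / A" using \<kappa> A by simp
  ultimately show ?thesis using that by blast
qed

end

text \<open>Existence of a weak derivative justifies the choice in \<open>weak_deriv\<close>;
  uniqueness then transfers square integrability from the constructed derivative to the chosen
  one.\<close>

lemma H_space_representative:
  assumes u: "u \<in> H_space"
  obtains U where "has_primitive (weak_deriv u) U" "AE r in lebesgue. r \<in> {0<..} \<longrightarrow> u r = U r"
    "(\<lambda>r. (weak_deriv u r)\<^sup>2 * r) absolutely_integrable_on {0<..}" "(\<lambda>r. (U r)\<^sup>2 * r) absolutely_integrable_on {0<..}"
proof -
  obtain v where v: "weak_partial_derivative {0<..} 1 u v" "(\<lambda>r. (v r)\<^sup>2 * r) absolutely_integrable_on {0<..}"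
    and u2: "(\<lambda>r. (u r)\<^sup>2 * r) absolutely_integrable_on {0<..}"
    using H_space_weak_derivative[OF u] .
  have wd: "weak_partial_derivative {0<..} 1 u (weak_deriv u)"
    unfolding weak_deriv_def by (rule someI[where P="weak_partial_derivative {0<..} 1 u", OF v(1)])
  obtain U where U: "has_primitive (weak_deriv u) U" "AE r in lebesgue. 0 < r \<longrightarrow> u r = U r"
    using weak_derivative_imp_primitive[OF wd] .
  have "(\<lambda>r. (weak_deriv u r)\<^sup>2 * r) absolutely_integrable_on {0<..}"
    by (rule absolutely_integrable_cong_AE[OF v(2)])
       (use weak_derivative_unique[OF v(1) wd] in \<open>eventually_elim, simp\<close>)
  moreover have "(\<lambda>r. (U r)\<^sup>2 * r) absolutely_integrable_on {0<..}"
    by (rule absolutely_integrable_cong_AE[OF u2]) (use U(2) in \<open>eventually_elim, simp\<close>)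
  moreover have "AE r in lebesgue. r \<in> {0<..} \<longrightarrow> u r = U r" using U(2) by simp
  ultimately show ?thesis using that U(1) by blast
qed

lemma radial_integral_eq_integral:
  assumes F: "F absolutely_integrable_on {0<..}" and ae: "AE r in lebesgue. r \<in> {0<..} \<longrightarrow> F r = G r * r"
  shows "radial_integral G = integral {0<..} F"
proof -
  have G: "(\<lambda>r. G r * r) absolutely_integrable_on {0<..}" by (rule absolutely_integrable_cong_AE[OF F ae])
  have "radial_integral G = integral {0<..} (\<lambda>r. G r * r)"
    unfolding radial_integral_def by (rule set_lebesgue_integral_eq_integral(2)[OF G])
  also have "\<dots> = integral {0<..} F" by (rule integral_cong_AE_lebesgue[OF ae, symmetric])
  finally show ?thesis .
qed

theorem theorem3p1:
  fixes d :: int and g :: real and ft f m :: "real \<Rightarrow> real"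
  assumes "d \<noteq> 0" and "g > 0"
    and "vortex_profile d ft"
    and "admissible_solution d g ft f m"
    and "\<forall>r\<ge>0. m r > 0"
  shows "\<exists>\<sigma>>0. \<forall>u\<in>X_space. \<forall>w\<in>H_space.
           second_variation d g f m u w \<ge> \<sigma> * (X_norm_sq u + H_norm_sq w)"
proof -
  interpret gl_vortex d g ft f m by unfold_locales (use assms in auto)
  obtain \<sigma> where \<sigma>: "0 < \<sigma>" and coercive: "\<forall>u v w z. perturbation u v w z \<longrightarrow>
       \<sigma> * (integral {0<..} (\<lambda>r. ((v r)\<^sup>2 + (u r)\<^sup>2 + (u r)\<^sup>2 / r\<^sup>2) * r) + integral {0<..} (\<lambda>r. ((z r)\<^sup>2 + (w r)\<^sup>2) * r))
        \<le> quadratic_form u v w z"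
    using coercivity .
  have "second_variation d g f m u w \<ge> \<sigma> * (X_norm_sq u + H_norm_sq w)" if u: "u \<in> X_space" and w: "w \<in> H_space" for u w
  proof -
    let ?v = "weak_deriv u" and ?z = "weak_deriv w"
    have uH: "u \<in> H_space" and ux: "(\<lambda>r. (u r)\<^sup>2 / r\<^sup>2 * r) absolutely_integrable_on {0<..}" using u by (auto simp: X_space_def)
    obtain U where U: "has_primitive ?v U" "AE r in lebesgue. r \<in> {0<..} \<longrightarrow> u r = U r"
      "(\<lambda>r. (?v r)\<^sup>2 * r) absolutely_integrable_on {0<..}" "(\<lambda>r. (U r)\<^sup>2 * r) absolutely_integrable_on {0<..}"
      using H_space_representative[OF uH] .
    obtain W where W: "has_primitive ?z W" "AE r in lebesgue. r \<in> {0<..} \<longrightarrow> w r = W r"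
      "(\<lambda>r. (?z r)\<^sup>2 * r) absolutely_integrable_on {0<..}" "(\<lambda>r. (W r)\<^sup>2 * r) absolutely_integrable_on {0<..}"
      using H_space_representative[OF w] .
    have Ux: "(\<lambda>r. (U r)\<^sup>2 / r\<^sup>2 * r) absolutely_integrable_on {0<..}"
      by (rule absolutely_integrable_cong_AE[OF ux]) (use U(2) in \<open>eventually_elim, simp\<close>)
    \<comment> \<open>The form and both norms depend on the profiles only up to null sets, so they
      may be evaluated on the continuous representatives while keeping the chosen weak
      derivatives.\<close>
    have p: "perturbation U ?v W ?z" unfolding perturbation_def by (intro conjI U W Ux)
    have "(\<lambda>r. ((?v r)\<^sup>2 + (U r)\<^sup>2 + (U r)\<^sup>2 / r\<^sup>2) * r) absolutely_integrable_on {0<..}"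
      unfolding distrib_right by (intro set_integral_add U Ux)
    then have X: "X_norm_sq u = integral {0<..} (\<lambda>r. ((?v r)\<^sup>2 + (U r)\<^sup>2 + (U r)\<^sup>2 / r\<^sup>2) * r)"
      unfolding X_norm_sq_def by (rule radial_integral_eq_integral) (use U(2) in \<open>eventually_elim, simp\<close>)
    have "(\<lambda>r. ((?z r)\<^sup>2 + (W r)\<^sup>2) * r) absolutely_integrable_on {0<..}"
      unfolding distrib_right by (intro set_integral_add W)
    then have H: "H_norm_sq w = integral {0<..} (\<lambda>r. ((?z r)\<^sup>2 + (W r)\<^sup>2) * r)"
      unfolding H_norm_sq_def by (rule radial_integral_eq_integral) (use W(2) in \<open>eventually_elim, simp\<close>)
    have S: "second_variation d g f m u w = quadratic_form U ?v W ?z"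
      unfolding second_variation_def quadratic_form_def
    proof (rule radial_integral_eq_integral[OF quadratic_form_eq(1)[OF p]])
      show "AE r in lebesgue. r \<in> {0<..} \<longrightarrow> quadratic_density U ?v W ?z r =
        ((?v r)\<^sup>2 + (?z r)\<^sup>2 + (of_int d)\<^sup>2 / r\<^sup>2 * (u r)\<^sup>2 + g * (w r)\<^sup>2 - (1 - (f r)\<^sup>2 - (m r)\<^sup>2) * ((u r)\<^sup>2 + (w r)\<^sup>2)
         + 2 * (f r * u r + m r * w r)\<^sup>2) * r"
        using U(2) W(2) by eventually_elim (simp add: quadratic_density_def D_def h_def)
    qed
    show ?thesis unfolding S X H using coercive p by blast
  qed
  then show ?thesis using \<sigma> by blast
qed

end
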